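(* Let $c\in[0,1)$, $d\in(0,1]$, $c+d\le1$. Suppose that the sequence of vertex-weighted directed random graphs $\{G(V_n,E_n;\mathscr{A}_n):n\ge1\}$ admits a strong coupling with a marked directed graph $\mathcal{G}(\boldsymbol{\mathcal{X}})$ which is a tree, and that the conditional law $\nu(\cdot)$ of the external signals given the vertex marks satisfies $d_1(\nu(\mathbf{x}),\nu(\tilde{\mathbf{x}}))\le K\rho(\mathbf{x},\tilde{\mathbf{x}})$ for all $\mathbf{x},\tilde{\mathbf{x}}\in\mathcal{S}$ and some $K<\infty$. Let $\mathcal{R}^*$ be the limiting typical stationary opinion, i.e. the random variable such that $E[|R_{I_n}-\mathcal{R}^*|\mid\mathscr{A}_n]\xrightarrow{P}0$ as $n\to\infty$, where $\mathbf{R}=(R_1,\dots,R_n)$ has the stationary distribution of the opinion process on $G(V_n,E_n;\mathscr{A}_n)$ and $I_n$ is uniform in $V_n$. Then $\mathcal{R}^*$ is given (in distribution) by $$\mathcal{R}^*=\sum_{s=0}^\infty\sum_{l=0}^s\sum_{|\mathbf{j}|=l}\Pi_{\mathbf{j}}\,a_{l,s}\,\mathcal{W}_{\mathbf{j}}^{(s)},$$ where $a_{l,s}=\binom{s}{l}(1-c-d)^{s-l}$ (with $0^0=1$), and $\Pi_{\mathbf{j}}$ is defined recursively by $\Pi_\emptyset=1$ and $\Pi_{(\mathbf{i},j)}=\Pi_{\mathbf{i}}\,\mathcal{C}_{(\mathbf{i},j)}$.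
   Context: Mark space. $\mathcal{S}=\mathcal{S}'\times[-1,1]\times\{0,1\}\times\mathbb{N}\times[0,1]^\infty$, with $\mathcal{S}'$ a Polish space with metric $\rho'$. For $\mathbf{x}=(\mathbf{a},q,s,d^-,c_11(d^-\ge1),c_21(d^-\ge2),\dots)$ and $\tilde{\mathbf{x}}$ similarly, $$\rho(\mathbf{x},\tilde{\mathbf{x}})=\rho'(\mathbf{a},\tilde{\mathbf{a}})+|q-\tilde q|+|s-\tilde s|+|d^--\tilde d^-|+\sum_{j\ge1}|c_j1(d^-\ge j)-\tilde c_j1(\tilde d^-\ge j)|.$$ $d_1(\mu,\nu)=\inf\{E|X-Y|:\mathrm{law}(X)=\mu,\mathrm{law}(Y)=\nu\}$ is the Wasserstein metric. Random graphs. $G(V_n,E_n;\mathscr{A}_n)$ has vertex set $V_n=\{1,\dots,n\}$; vertex $i$ has attribute $\mathbf{Y}_i=(\mathbf{A}_i,Q_i,S_i)\in\mathcal{S}'\times[-1,1]\times\{0,1\}$, and $\mathscr{A}_n=\{\mathbf{Y}_i:i\in V_n\}$. The edge set $E_n$ is random; $D_i^-$ is the in-degree of $i$. After the edges are realized, weight vectors $(C(i,1),\dots,C(i,D_i^-))$ with entries in $[0,1]$ and $\sum_{r=1}^{D_i^-}C(i,r)=c$ whenever $D_i^->0$ are sampled; their distribution may depend on $\mathbf{Y}_i$, and they are conditionally independent given $\mathscr{A}_n$. The full mark of $i$ is $\mathbf{X}_i=(\mathbf{A}_i,Q_i,S_i,D_i^-,C(i,1)1(D_i^-\ge1),C(i,2)1(D_i^-\ge2),\dots)\in\mathcal{S}$.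 Opinion process. Given the marked graph, $\mathbf{R}^{(k)}\in[-1,1]^n$ evolves by $$R_i^{(k+1)}=\sum_{r=1}^{D_i^-}C(i,r)R^{(k)}_{L(i,r)}+W_i^{(k)}+(1-c-d)R_i^{(k)},\qquad k\ge0,$$ where $L(i,r)$ is the $r$th inbound neighbor of $i$. The external signals $W_i^{(k)}$ are conditionally independent given the marked graph, $W_i^{(k)}$ has conditional law $\nu(\mathbf{X}_i)$, and $|W_i^{(k)}|\le d+c-\sum_{r=1}^{D_i^-}C(i,r)$. The initial vector is conditionally independent of the signals given the graph. Since $d>0$, given the graph this Markov chain has a unique stationary distribution. $\mathcal{R}^*$ is understood to be constructed on a common probability space with the graph, signals and $I_n$; its law does not depend on $\mathscr{A}_n$. Strong coupling. Multigraphs are isomorphic ($\simeq$) if there is a bijection $\theta$ of the vertex sets preserving numbers of self-loops and numbers of edges between ordered pairs. $G_i^{(k)}(\mathbf{X})$ is the marked induced subgraph on the vertices having a directed path of length at most $k$ to $i$ (in-component of depth $k$); $G_i^{(k)}$ is the same without marks. $\{G(V_n,E_n;\mathscr{A}_n)\}$ admits a strong coupling with a (locally finite, rooted) marked directed graph $\mathcal{G}(\boldsymbol{\mathcal{X}})$ if: (a) for $I_n$ uniform in $V_n$ and any fixed $k\ge1$, $\epsilon>0$, there is a coupling between $G_{I_n}^{(k)}(\mathbf{X})$ and a copy $\mathcal{G}_\emptyset(\boldsymbol{\mathcal{X}})$ of $\mathcal{G}(\boldsymbol{\mathcal{X}})$, with root $\emptyset$ and depth-$k$ in-component of the root $\mathcal{G}_\emptyset^{(k)}$,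 such that the event $\mathcal{E}_{I_n}^{(k,\epsilon)}=\{\mathcal{G}_\emptyset^{(k)}\simeq G_{I_n}^{(k)},\ \theta(\emptyset)=I_n,\ \bigcap_{i\in\mathcal{G}_\emptyset^{(k)}}\{\rho(\mathbf{X}_{\theta(i)},\boldsymbol{\mathcal{X}}_i)\le\epsilon\}\}$ satisfies $P(\mathcal{E}_{I_n}^{(k,\epsilon)}\mid\mathscr{A}_n)\xrightarrow{P}1$; (b) given two independent uniform vertices $I_n,J_n$ there exist two independent copies of $\mathcal{G}(\boldsymbol{\mathcal{X}})$ such that the corresponding events satisfy $P(\mathcal{E}_{I_n}^{(k,\epsilon)}\cap\mathcal{E}_{J_n}^{(k,\epsilon)}\mid\mathscr{A}_n)\xrightarrow{P}1$ as $n\to\infty$. Tree notation. When $\mathcal{G}(\boldsymbol{\mathcal{X}})$ is a tree (edges pointing towards the root), its nodes are labeled by $\mathbf{i}=(i_1,\dots,i_k)\in\mathcal{U}=\bigcup_{k\ge0}\mathbb{N}_+^k$, $\mathbb{N}_+^0=\{\emptyset\}$; $|\mathbf{i}|$ is the generation of $\mathbf{i}$ and $(\mathbf{i},j)$ denotes concatenation, so the inbound neighbors of $\mathbf{i}$ are $(\mathbf{i},1),\dots,(\mathbf{i},\mathcal{N}_{\mathbf{i}})$. Node $\mathbf{i}$ has full mark $\boldsymbol{\mathcal{X}}_{\mathbf{i}}=(\boldsymbol{\mathcal{A}}_{\mathbf{i}},\mathcal{Q}_{\mathbf{i}},\mathcal{S}_{\mathbf{i}},\mathcal{N}_{\mathbf{i}},\mathcal{C}_{(\mathbf{i},1)}1(\mathcal{N}_{\mathbf{i}}\ge1),\mathcal{C}_{(\mathbf{i},2)}1(\mathcal{N}_{\mathbf{i}}\ge2),\dots)\in\mathcal{S}$.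 The sum over $|\mathbf{j}|=l$ runs over the nodes of generation $l$ of the tree. The signals $\mathcal{W}_{\mathbf{i}}^{(k)}$, $k\ge0$, are conditionally independent given the marked tree, with $\mathcal{W}_{\mathbf{i}}^{(k)}$ having conditional law $\nu(\boldsymbol{\mathcal{X}}_{\mathbf{i}})$.
   Formalization: The isomorphism θ in the strong coupling must also send the r-th inbound neighbor to the r-th inbound neighbor; with edge counts alone the weights could attach to different neighbors and the formula fails (e.g. weights (c,0) with neighbors swapped in the tree). *)

theory Defs
  imports "HOL-Probability.Probability"
begin

text \<open>
  A mark is \<open>(a, q, s, m, w)\<close>, where \<open>m\<close> is the in-degree of the vertex and \<open>w j\<close> the weight of
  its inbound edge number \<open>j\<close>. Inbound edges are numbered from 0, so the weight written
  \<open>c_r 1(m \<ge> r)\<close> for \<open>r \<ge> 1\<close> is \<open>w (r - 1) * of_bool (r - 1 < m)\<close> here. The Polish space with its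
  metric is the type \<open>'a\<close> with \<open>dist\<close>.
\<close>

type_synonym 'a mark = "'a \<times> real \<times> nat \<times> nat \<times> (nat \<Rightarrow> real)"

fun mattr :: "'a mark \<Rightarrow> 'a \<times> real \<times> nat" where
  "mattr (a, q, s, m, w) = (a, q, s)"

fun mdeg :: "'a mark \<Rightarrow> nat" where
  "mdeg (a, q, s, m, w) = m"

fun mweight :: "'a mark \<Rightarrow> nat \<Rightarrow> real" where
  "mweight (a, q, s, m, w) = w"

definition mark_space :: "'a mark set" where
  "mark_space = UNIV \<times> {-1..1} \<times> {0, 1} \<times> UNIV \<times> {w. \<forall>j. w j \<in> {0..1}}"

fun mark_dist :: "'a::metric_space mark \<Rightarrow> 'a mark \<Rightarrow> real" where
  "mark_dist (a, q, s, m, w) (a', q', s', m', w') =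
     dist a a' + \<bar>q - q'\<bar> + \<bar>real s - real s'\<bar> + \<bar>real m - real m'\<bar>
     + (\<Sum>j. \<bar>w j * of_bool (j < m) - w' j * of_bool (j < m')\<bar>)"

definition couplings :: "'x measure \<Rightarrow> 'y measure \<Rightarrow> ('x \<times> 'y) measure set" where
  "couplings \<mu> \<nu> = {\<pi>. sets \<pi> = sets (\<mu> \<Otimes>\<^sub>M \<nu>) \<and> distr \<pi> \<mu> fst = \<mu> \<and> distr \<pi> \<nu> snd = \<nu>}"

definition wasserstein1 :: "real measure \<Rightarrow> real measure \<Rightarrow> ennreal" where
  "wasserstein1 \<mu> \<nu> = (INF \<pi>\<in>couplings \<mu> \<nu>. \<integral>\<^sup>+z. ennreal \<bar>fst z - snd z\<bar> \<partial>\<pi>)"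

definition has_cond_law ::
  "'w measure \<Rightarrow> 'w measure \<Rightarrow> 'b measure \<Rightarrow> ('w \<Rightarrow> 'b) \<Rightarrow> ('w \<Rightarrow> 'b measure) \<Rightarrow> bool" where
  "has_cond_law M F N Z \<kappa> \<longleftrightarrow> Z \<in> M \<rightarrow>\<^sub>M N \<and>
     (\<forall>B\<in>sets N. AE \<omega> in M.
        real_cond_exp M F (indicator {\<omega> \<in> space M. Z \<omega> \<in> B}) \<omega> = measure (\<kappa> \<omega>) B)"

text \<open>
  Given \<open>F\<close>, the variables \<open>Z i\<close> with \<open>i\<close> in the (possibly random, \<open>F\<close>-measurable) index set \<open>Ix\<close> are
  conditionally independent, and \<open>Z i\<close> has conditional law \<open>\<kappa> i\<close>.
\<close>

definition cond_indep_with_laws ::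
  "'w measure \<Rightarrow> 'w measure \<Rightarrow> ('w \<Rightarrow> 'i set) \<Rightarrow> 'b measure \<Rightarrow> ('i \<Rightarrow> 'w \<Rightarrow> 'b) \<Rightarrow>
   ('i \<Rightarrow> 'w \<Rightarrow> 'b measure) \<Rightarrow> bool" where
  "cond_indep_with_laws M F Ix N Z \<kappa> \<longleftrightarrow> (\<forall>i. Z i \<in> M \<rightarrow>\<^sub>M N) \<and>
     (\<forall>J B. finite J \<longrightarrow> (\<forall>i\<in>J. B i \<in> sets N) \<longrightarrow>
        (AE \<omega> in M. J \<subseteq> Ix \<omega> \<longrightarrow>
           real_cond_exp M F (indicator {\<omega> \<in> space M. \<forall>i\<in>J. Z i \<omega> \<in> B i}) \<omega>
             = (\<Prod>i\<in>J. measure (\<kappa> i \<omega>) (B i))))"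

definition tendsto_in_prob :: "(nat \<Rightarrow> 'w measure) \<Rightarrow> (nat \<Rightarrow> 'w \<Rightarrow> real) \<Rightarrow> real \<Rightarrow> bool" where
  "tendsto_in_prob M Z l \<longleftrightarrow>
     (\<forall>\<delta>>0. (\<lambda>n. measure (M n) {\<omega> \<in> space (M n). \<delta> < \<bar>Z n \<omega> - l\<bar>}) \<longlonglongrightarrow> 0)"

text \<open>
  The edges into a vertex \<open>v\<close> are numbered \<open>0, \<dots>, indeg G v - 1\<close>, the in-degree being a component
  of the mark of \<open>v\<close>; edge number \<open>r\<close> comes from \<open>inn G v r\<close>. Several edges with the same tail
  and self-loops are allowed.
\<close>

record ('v, 'a) mgraph =
  verts :: "'v set"
  inn :: "'v \<Rightarrow> nat \<Rightarrow> 'v"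
  mark :: "'v \<Rightarrow> 'a mark"

definition indeg :: "('v, 'a) mgraph \<Rightarrow> 'v \<Rightarrow> nat" where
  "indeg G v = mdeg (mark G v)"

text \<open>Irrelevant values of \<open>inn\<close> and \<open>mark\<close> are \<open>undefined\<close>, so that they carry no information.\<close>

definition mgraph_wf :: "('v, 'a) mgraph \<Rightarrow> bool" where
  "mgraph_wf G \<longleftrightarrow>
     (\<forall>v\<in>verts G. mark G v \<in> mark_space \<and>
        (\<forall>r<indeg G v. inn G v r \<in> verts G) \<and>
        (\<forall>r\<ge>indeg G v. mweight (mark G v) r = 0 \<and> inn G v r = undefined)) \<and>
     (\<forall>v. v \<notin> verts G \<longrightarrow> mark G v = undefined \<and> inn G v = (\<lambda>_. undefined))"

definition mgraph_space :: "('v, 'a::polish_space) mgraph measure" where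
  "mgraph_space = vimage_algebra UNIV (\<lambda>G. ((\<lambda>v. v \<in> verts G), inn G, mark G))
     (Pi\<^sub>M UNIV (\<lambda>_. count_space UNIV) \<Otimes>\<^sub>M
      (Pi\<^sub>M UNIV (\<lambda>_. Pi\<^sub>M UNIV (\<lambda>_. count_space UNIV)) \<Otimes>\<^sub>M Pi\<^sub>M UNIV (\<lambda>_. borel)))"

definition arcs :: "('v, 'a) mgraph \<Rightarrow> ('v \<times> 'v) set" where
  "arcs G = {(inn G v r, v) | v r. v \<in> verts G \<and> r < indeg G v}"

definition edge_count :: "('v, 'a) mgraph \<Rightarrow> 'v \<Rightarrow> 'v \<Rightarrow> nat" where
  "edge_count G u v = card {r. r < indeg G v \<and> inn G v r = u}"

text \<open>In-degrees are finite by construction, so only out-degrees matter here.\<close>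

definition locally_finite :: "('v, 'a) mgraph \<Rightarrow> bool" where
  "locally_finite G \<longleftrightarrow>
     (\<forall>u\<in>verts G. finite {(v, r). v \<in> verts G \<and> r < indeg G v \<and> inn G v r = u})"

definition in_comp :: "('v, 'a) mgraph \<Rightarrow> 'v \<Rightarrow> nat \<Rightarrow> 'v set" where
  "in_comp G v k = {u. \<exists>m\<le>k. (u, v) \<in> arcs G ^^ m}"

text \<open>
  The last clause makes \<open>\<theta>\<close> respect the numbering of the inbound edges: the \<open>r\<close>-th weight in the
  mark of a vertex belongs to its \<open>r\<close>-th inbound neighbour, so closeness of the marks is only
  meaningful if the \<open>r\<close>-th neighbours correspond to each other.
\<close>

definition close_in_comp ::
  "nat \<Rightarrow> real \<Rightarrow> ('v, 'a::metric_space) mgraph \<Rightarrow> 'v \<Rightarrow> ('u, 'a) mgraph \<Rightarrow> 'u \<Rightarrow> bool" where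
  "close_in_comp k \<epsilon> H rt G i \<longleftrightarrow>
     (\<exists>\<theta>. bij_betw \<theta> (in_comp H rt k) (in_comp G i k) \<and>
       (\<forall>u\<in>in_comp H rt k. \<forall>v\<in>in_comp H rt k. edge_count G (\<theta> u) (\<theta> v) = edge_count H u v) \<and>
       \<theta> rt = i \<and>
       (\<forall>v\<in>in_comp H rt k. mark_dist (mark G (\<theta> v)) (mark H v) \<le> \<epsilon>) \<and>
       (\<forall>v\<in>in_comp H rt k. \<forall>r<indeg H v. inn H v r \<in> in_comp H rt k \<longrightarrow>
          r < indeg G (\<theta> v) \<and> inn G (\<theta> v) r = \<theta> (inn H v r)))"

definition attr_algebra ::
  "nat \<Rightarrow> 'w measure \<Rightarrow> ('w \<Rightarrow> (nat, 'a::polish_space) mgraph) \<Rightarrow> 'w measure" where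
  "attr_algebra n M G =
     vimage_algebra (space M) (\<lambda>\<omega>. \<lambda>i\<in>{1..n}. mattr (mark (G \<omega>) i)) (Pi\<^sub>M {1..n} (\<lambda>_. borel))"

definition forget_weights :: "('v, 'a) mgraph \<Rightarrow> ('v, 'a) mgraph" where
  "forget_weights G = G\<lparr>mark := \<lambda>v. case mark G v of (a, q, s, m, w) \<Rightarrow> (a, q, s, m, \<lambda>_. 0)\<rparr>"

text \<open>
  The last clause says that, once attributes and edges are realized, the weight vectors are sampled
  independently, that of \<open>i\<close> from a law determined by the attribute and the in-degree (the length
  of the vector) of \<open>i\<close>.
\<close>

definition weighted_random_digraph ::
  "real \<Rightarrow> nat \<Rightarrow> 'w measure \<Rightarrow> ('w \<Rightarrow> (nat, 'a::polish_space) mgraph) \<Rightarrow> bool" where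
  "weighted_random_digraph c n M G \<longleftrightarrow>
     prob_space M \<and> G \<in> M \<rightarrow>\<^sub>M mgraph_space \<and>
     (AE \<omega> in M. mgraph_wf (G \<omega>) \<and> verts (G \<omega>) = {1..n} \<and>
        (\<forall>i\<in>{1..n}. 0 < indeg (G \<omega>) i \<longrightarrow>
           (\<Sum>r<indeg (G \<omega>) i. mweight (mark (G \<omega>) i) r) = c)) \<and>
     (\<exists>\<kappa> \<in> borel \<Otimes>\<^sub>M count_space UNIV \<rightarrow>\<^sub>M prob_algebra borel.
        cond_indep_with_laws M
          (vimage_algebra (space M) (\<lambda>\<omega>. forget_weights (G \<omega>)) mgraph_space) (\<lambda>_. {1..n}) borel
          (\<lambda>i \<omega>. mweight (mark (G \<omega>) i))
          (\<lambda>i \<omega>. \<kappa> (mattr (mark (G \<omega>) i), indeg (G \<omega>) i)))"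

text \<open>
  \<open>\<gamma> n\<close> is the law of the marked graph on \<open>{1..n}\<close>, and \<open>\<tau>\<close> that of the limiting marked graph with
  root \<open>rt\<close>. The elements of the coupling in the second clause are \<open>((g, i), t)\<close>, and
  \<open>((g, i, j), (t, t'))\<close> in the third.
\<close>

definition strong_coupling ::
  "(nat \<Rightarrow> (nat, 'a::polish_space) mgraph measure) \<Rightarrow> ('v, 'a) mgraph measure \<Rightarrow> 'v \<Rightarrow> bool" where
  "strong_coupling \<gamma> \<tau> rt \<longleftrightarrow>
     (AE t in \<tau>. mgraph_wf t \<and> rt \<in> verts t \<and> locally_finite t) \<and>
     (\<forall>k\<ge>1. \<forall>\<epsilon>>0. \<exists>\<pi>.
        (\<forall>n\<ge>1. \<pi> n \<in> couplings (\<gamma> n \<Otimes>\<^sub>M measure_pmf (pmf_of_set {1..n})) \<tau>) \<and>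
        tendsto_in_prob \<pi> (\<lambda>n. real_cond_exp (\<pi> n) (attr_algebra n (\<pi> n) (\<lambda>((g, i), t). g))
          (indicator {((g, i), t). ((g, i), t) \<in> space (\<pi> n) \<and> close_in_comp k \<epsilon> t rt g i})) 1) \<and>
     (\<forall>k\<ge>1. \<forall>\<epsilon>>0. \<exists>\<pi>.
        (\<forall>n\<ge>1. \<pi> n \<in> couplings
           (\<gamma> n \<Otimes>\<^sub>M (measure_pmf (pmf_of_set {1..n}) \<Otimes>\<^sub>M measure_pmf (pmf_of_set {1..n})))
           (\<tau> \<Otimes>\<^sub>M \<tau>)) \<and>
        tendsto_in_prob \<pi> (\<lambda>n. real_cond_exp (\<pi> n) (attr_algebra n (\<pi> n) (\<lambda>((g, i, j), (t, t')). g))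
          (indicator {((g, i, j), (t, t')). ((g, i, j), (t, t')) \<in> space (\<pi> n) \<and>
             close_in_comp k \<epsilon> t rt g i \<and> close_in_comp k \<epsilon> t' rt g j})) 1)"

definition opinion_update ::
  "real \<Rightarrow> real \<Rightarrow> ('v, 'a) mgraph \<Rightarrow> ('v \<Rightarrow> real) \<Rightarrow> ('v \<Rightarrow> real) \<Rightarrow> 'v \<Rightarrow> real" where
  "opinion_update c d G x w = (\<lambda>i\<in>verts G.
     (\<Sum>r<indeg G i. mweight (mark G i) r * x (inn G i r)) + w i + (1 - c - d) * x i)"

text \<open>
  Transition kernel of the opinion process given the marked graph: the signals at a given time are
  independent with laws \<open>\<nu> (mark G i)\<close>.
\<close>

definition opinion_kernel ::
  "real \<Rightarrow> real \<Rightarrow> ('a mark \<Rightarrow> real measure) \<Rightarrow> ('v, 'a) mgraph \<Rightarrow> ('v \<Rightarrow> real) \<Rightarrow>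
   ('v \<Rightarrow> real) measure" where
  "opinion_kernel c d \<nu> G x =
     distr (Pi\<^sub>M (verts G) (\<lambda>i. \<nu> (mark G i))) (Pi\<^sub>M (verts G) (\<lambda>_. borel)) (opinion_update c d G x)"

definition stationary_opinion_law ::
  "real \<Rightarrow> real \<Rightarrow> ('a mark \<Rightarrow> real measure) \<Rightarrow> ('v, 'a) mgraph \<Rightarrow> ('v \<Rightarrow> real) measure \<Rightarrow> bool" where
  "stationary_opinion_law c d \<nu> G \<mu> \<longleftrightarrow>
     prob_space \<mu> \<and> sets \<mu> = sets (Pi\<^sub>M (verts G) (\<lambda>_. borel)) \<and>
     (AE x in \<mu>. \<forall>i\<in>verts G. x i \<in> {-1..1}) \<and>
     bind \<mu> (opinion_kernel c d \<nu> G) = \<mu>"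

text \<open>
  Trees with edges pointing towards the root \<open>[]\<close> and nodes labelled by words: the inbound
  neighbours of \<open>i\<close> are \<open>i @ [0], \<dots>, i @ [indeg G i - 1]\<close>.
\<close>

definition labelled_tree :: "(nat list, 'a) mgraph \<Rightarrow> bool" where
  "labelled_tree G \<longleftrightarrow> mgraph_wf G \<and> [] \<in> verts G \<and>
     (\<forall>i j. i @ [j] \<in> verts G \<longleftrightarrow> i \<in> verts G \<and> j < indeg G i) \<and>
     (\<forall>i\<in>verts G. \<forall>j<indeg G i. inn G i j = i @ [j])"

definition path_weight :: "(nat list, 'a) mgraph \<Rightarrow> nat list \<Rightarrow> real" where
  "path_weight G i = (\<Prod>m<length i. mweight (mark G (take m i)) (i ! m))"

lemma path_weight_Nil [simp]: "path_weight G [] = 1"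
  by (simp add: path_weight_def)

lemma path_weight_snoc [simp]:
  "path_weight G (i @ [j]) = path_weight G i * mweight (mark G i) j"
  by (auto simp: path_weight_def nth_append intro!: prod.cong)

definition acoef :: "real \<Rightarrow> real \<Rightarrow> nat \<Rightarrow> nat \<Rightarrow> real" where
  "acoef c d l s = real (s choose l) * (1 - c - d) ^ (s - l)"

text \<open>The \<open>s\<close>-th term of the series; \<open>W j s\<close> is the signal at node \<open>j\<close> and time \<open>s\<close>.\<close>

definition opinion_term ::
  "real \<Rightarrow> real \<Rightarrow> (nat list, 'a) mgraph \<Rightarrow> (nat list \<Rightarrow> nat \<Rightarrow> real) \<Rightarrow> nat \<Rightarrow> real" where
  "opinion_term c d G W s =
     (\<Sum>l=0..s. \<Sum>j\<in>{j \<in> verts G. length j = l}. path_weight G j * acoef c d l s * W j s)"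

end

theory Submission
  imports Defs
begin

text \<open>
  Everything is done with characteristic functions. Let \<open>A\<close> be the matrix with
  \<open>R\<^bsup>(k+1)\<^esup> = A R\<^bsup>(k)\<^esup> + W\<^bsup>(k)\<^esup>\<close>. Iterating stationarity \<open>t\<close> times gives
  \<open>E exp (i u R\<^sub>i) = E exp (i \<langle>(A\<^sup>T)\<^sup>t u e\<^sub>i, R\<rangle>) \<cdot> (\<Prod>s<t. \<Prod>j. char (\<nu> (X\<^sub>j)) (((A\<^sup>T)\<^sup>s u e\<^sub>i)\<^sub>j))\<close>,
  and \<open>A\<^sup>T\<close> contracts the 1-norm by \<open>1 - d\<close>, so up to \<open>|u| (1 - d)\<^sup>t\<close> only the product remains. It
  depends only on the in-component of depth \<open>t\<close> of \<open>i\<close>; if that component is isomorphic to the one of the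
  limiting tree, then \<open>((A\<^sup>T)\<^sup>s u e\<^sub>i)\<^sub>j\<close> is \<open>u a\<^sub>l\<^sub>,\<^sub>s\<close> times the product of the weights along the path from
  \<open>j\<close>, where \<open>l\<close> is its length, and by the Lipschitz condition on \<open>\<nu>\<close> close marks change the product only
  slightly. The strong coupling therefore carries the product over to the tree, where its expectation is the
  characteristic function of the partial sum of the first \<open>t\<close> terms of the series. The coupling also shows
  that almost surely the weights on the tree are substochastic and its signals are bounded by 1, which
  dominates the series by \<open>(1 - d)\<^sup>s\<close>.
\<close>

section \<open>Conditional expectations, couplings and convergence in probability\<close>

text \<open>The strong coupling relates graphs and marks only: nothing couples the signals, and its
  isomorphisms come without a measurable choice. Conditional characteristic functions given the
  marked graph avoid both obstacles. The signals enter only through their laws \<nu>, the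
  isomorphism is used only pointwise, and what is transferred is a measurable function of graph and
  root. Two features make the error estimates work. The number of nodes up to a given depth is
  random and unbounded, so errors are never counted per node: they are weighted by path weights,
  whose sum over level l is at most \<open>c ^ l\<close>. And the remainder after t steps, of order
  \<open>(1 - d) ^ t\<close>, does not depend on n, so that n can tend to infinity at a fixed depth
  before the depth does. Conditional laws are given event by event, up to null sets, and on the tree
  only for nodes that exist. Passing from events to bounded functions therefore takes an argument of
  its own, and expectations on the tree are split according to the finite random set of nodes
  involved.\<close>

lemma real_cond_exp_indicator_nonmeasurable:
  assumes "E \<subseteq> space M" "E \<notin> sets M \<or> \<not> subalgebra M F"
  shows "real_cond_exp M F (indicator E) x \<le> 0"
proof -
  \<comment> \<open>Outside measurable functions and genuine subalgebras \<open>nn_cond_exp\<close>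
    is 0 by definition. The positive part of \<open>real_cond_exp\<close> then vanishes, and the
    negative part can only lower the value.\<close>
  have "nn_cond_exp M F (\<lambda>x. ennreal (indicator E x)) = (\<lambda>_. 0)"
  proof (cases "subalgebra M F")
    case True
    have "(\<lambda>x. ennreal (indicator E x)) \<notin> borel_measurable M"
    proof
      assume [measurable]: "(\<lambda>x. ennreal (indicator E x)) \<in> borel_measurable M"
      have "{x\<in>space M. ennreal (indicator E x) = 1} \<in> sets M" by measurable
      also have "{x\<in>space M. ennreal (indicator E x) = 1} = E"
        using assms(1) by (auto simp: indicator_def split: if_splits)
      finally show False using assms(2) True by auto
    qed
    then show ?thesis by (simp add: nn_cond_exp_def)
  qed (simp add: nn_cond_exp_def)
  then show ?thesis by (simp add: real_cond_exp_def)
qed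

lemma prob_space_finite_subalgebra:
  assumes "prob_space M" "subalgebra M F"
  shows "sigma_finite_subalgebra M F"
  using assms by (intro finite_measure_subalgebra_is_sigma_finite)
    (auto simp: finite_measure_subalgebra_def finite_measure_subalgebra_axioms_def prob_space_def)

lemma measure_eq_cond_exp:
  assumes M: "prob_space M" and sub: "subalgebra M F" and D: "D \<in> sets M"
  shows "H \<in> sets F \<Longrightarrow> measure M (H \<inter> D) = (\<integral>x\<in>H. real_cond_exp M F (indicator D) x \<partial>M)"
    and "measure M D = (\<integral>x. real_cond_exp M F (indicator D) x \<partial>M)"
proof -
  interpret prob_space M by (rule M)
  interpret sigma_finite_subalgebra M F using M sub by (rule prob_space_finite_subalgebra)
  have i: "integrable M (indicator D :: _ \<Rightarrow> real)"
    using D by (intro integrable_real_indicator) (auto simp: less_top[symmetric])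
  show "measure M D = (\<integral>x. real_cond_exp M F (indicator D) x \<partial>M)"
    using sets.sets_into_space[OF D] by (simp add: real_cond_exp_int(2)[OF i] Int_absorb2)
  assume H: "H \<in> sets F"
  then have "H \<in> sets M" using sub by (auto simp: subalgebra_def)
  then have "H \<inter> D \<subseteq> space M" by (auto dest: sets.sets_into_space)
  then have "measure M (H \<inter> D) = (\<integral>x\<in>H. indicator D x \<partial>M)"
    unfolding set_lebesgue_integral_def by (simp add: indicator_inter_arith[symmetric] Int_absorb2)
  also have "\<dots> = (\<integral>x\<in>H. real_cond_exp M F (indicator D) x \<partial>M)" by (rule real_cond_exp_intA[OF i H])
  finally show "measure M (H \<inter> D) = (\<integral>x\<in>H. real_cond_exp M F (indicator D) x \<partial>M)" .
qed

text \<open>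
  No measurability of \<open>E n\<close> is assumed: for a non-measurable event \<open>real_cond_exp\<close> has a value \<open>\<le> 0\<close>,
  so the convergence to 1 forces the events to be measurable eventually.
\<close>

lemma tendsto_in_prob_event:
  assumes lim: "tendsto_in_prob \<pi> (\<lambda>n. real_cond_exp (\<pi> n) (F n) (indicator (E n))) 1"
    and prob: "\<And>n. n \<ge> 1 \<Longrightarrow> prob_space (\<pi> n)" and sub: "\<And>n. E n \<subseteq> space (\<pi> n)" and "0 < \<delta>"
  shows "\<forall>\<^sub>F n in sequentially. E n \<in> sets (\<pi> n) \<and> 1 - \<delta> \<le> measure (\<pi> n) (E n)"
proof -
  \<comment> \<open>The bound 1/2 keeps values \<le> 0, the non-measurable case, inside the
    exceptional set \<open>?B\<close>. Twice e is at most \<delta> because e is lost once as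
    distance from 1 and once as the probability of \<open>?B\<close>.\<close>
  define e where "e = min (\<delta>/2) (1/2)"
  have e: "0 < e" "e \<le> 1/2" "2 * e \<le> \<delta>" using \<open>0 < \<delta>\<close> by (auto simp: e_def)
  let ?Z = "\<lambda>n. real_cond_exp (\<pi> n) (F n) (indicator (E n))"
  let ?B = "\<lambda>n. {\<omega> \<in> space (\<pi> n). e < \<bar>?Z n \<omega> - 1\<bar>}"
  have "\<forall>\<^sub>F n in sequentially. measure (\<pi> n) (?B n) < e"
    using lim e unfolding tendsto_in_prob_def by (intro order_tendstoD(2)[where y=0]) auto
  then show ?thesis
    using eventually_ge_at_top[of 1]
  proof eventually_elim
    case (elim n)
    interpret prob_space "\<pi> n" using prob elim by auto
    have meas: "E n \<in> sets (\<pi> n)" "subalgebra (\<pi> n) (F n)"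
    proof -
      have "\<not> (E n \<notin> sets (\<pi> n) \<or> \<not> subalgebra (\<pi> n) (F n))"
      proof
        assume "E n \<notin> sets (\<pi> n) \<or> \<not> subalgebra (\<pi> n) (F n)"
        from real_cond_exp_indicator_nonmeasurable[OF sub this]
        have *: "?Z n x \<le> 0" for x .
        have "?B n = space (\<pi> n)"
        proof (intro equalityI subsetI)
          fix x assume "x \<in> space (\<pi> n)"
          then show "x \<in> ?B n" using *[of x] e by auto
        qed auto
        then show False using elim e prob_space by auto
      qed
      then show "E n \<in> sets (\<pi> n)" "subalgebra (\<pi> n) (F n)" by auto
    qed
    interpret sigma_finite_subalgebra "\<pi> n" "F n"
      by (intro prob_space_finite_subalgebra meas prob elim)
    have int: "integrable (\<pi> n) (indicator (E n) :: _ \<Rightarrow> real)"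
      using meas by (intro integrable_real_indicator) (auto simp: less_top[symmetric])
    have Bm: "?B n \<in> sets (\<pi> n)" by measurable
    have "AE x in \<pi> n. 0 \<le> ?Z n x" using meas by (intro real_cond_exp_pos) auto
    \<comment> \<open>Off \<open>?B\<close> the conditional expectation is at least 1 - e; on
      \<open>?B\<close> the left side is - e, and the conditional expectation is
      nonnegative.\<close>
    then have "AE x in \<pi> n. (1 - e) - indicator (?B n) x \<le> ?Z n x"
      using AE_space by eventually_elim (use e in \<open>auto simp: indicator_def abs_if split: if_splits\<close>)
    then have "(\<integral>x. (1 - e) - indicator (?B n) x \<partial>\<pi> n) \<le> (\<integral>x. ?Z n x \<partial>\<pi> n)"
      using Bm by (intro integral_mono_AE real_cond_exp_int int Bochner_Integration.integrable_diff
          integrable_real_indicator) (auto simp: less_top[symmetric])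
    also have "\<dots> = measure (\<pi> n) (E n)"
      by (rule measure_eq_cond_exp(2)[OF prob meas(2,1), symmetric]) (rule elim(2))
    also have "(\<integral>x. (1 - e) - indicator (?B n) x \<partial>\<pi> n) = (1 - e) - measure (\<pi> n) (?B n)"
      using Bm by (subst Bochner_Integration.integral_diff)
       (auto simp: prob_space less_top[symmetric] Int_absorb2 intro!: integrable_real_indicator)
    finally show ?case using elim e meas by auto
  qed
qed

text \<open>The conditional expectation is small only outside an event of small probability and may
  be large on that event. Truncation at 1 makes the event cost no more than its probability.\<close>

lemma tendsto_in_prob_cond_exp_zero:
  assumes lim: "tendsto_in_prob M (\<lambda>n. real_cond_exp (M n) (F n) (Z n)) 0"
    and prob: "\<And>n. n \<ge> 1 \<Longrightarrow> prob_space (M n)" 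
    and sub: "\<And>n. n \<ge> 1 \<Longrightarrow> subalgebra (M n) (F n)"
    and int: "\<And>n. n \<ge> 1 \<Longrightarrow> integrable (M n) (Z n)"
    and nonneg: "\<And>n \<omega>. 0 \<le> Z n \<omega>"
  shows "(\<lambda>n. \<integral>\<omega>. min 1 (Z n \<omega>) \<partial>M n) \<longlonglongrightarrow> 0"
proof (rule tendstoI)
  fix \<delta> :: real assume "0 < \<delta>"
  define e where "e = \<delta> / 2"
  have e: "0 < e" "2 * e = \<delta>" using \<open>0 < \<delta>\<close> by (auto simp: e_def)
  let ?C = "\<lambda>n. real_cond_exp (M n) (F n) (Z n)"
  let ?B = "\<lambda>n. {\<omega> \<in> space (M n). e < \<bar>?C n \<omega> - 0\<bar>}"
  have "\<forall>\<^sub>F n in sequentially. measure (M n) (?B n) < e"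
    using lim e unfolding tendsto_in_prob_def by (intro order_tendstoD(2)[where y=0]) auto
  then show "\<forall>\<^sub>F n in sequentially. dist (\<integral>\<omega>. min 1 (Z n \<omega>) \<partial>M n) 0 < \<delta>"
    using eventually_ge_at_top[of 1]
  proof eventually_elim
    case (elim n)
    interpret prob_space "M n" using prob elim by auto
    interpret sigma_finite_subalgebra "M n" "F n"
      by (intro prob_space_finite_subalgebra sub prob elim)
    let ?m = "\<lambda>\<omega>. min 1 (Z n \<omega>)"
    have Bm: "?B n \<in> sets (M n)" by measurable
    have [measurable]: "Z n \<in> borel_measurable (M n)" using int elim by auto
    have intm: "integrable (M n) ?m"
      by (rule integrable_const_bound[where B=1]) (use nonneg in auto)
    have "AE x in M n. real_cond_exp (M n) (F n) ?m x \<le> ?C n x"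
      using int elim intm by (intro real_cond_exp_mono) auto
    moreover have "AE x in M n. real_cond_exp (M n) (F n) ?m x \<le> real_cond_exp (M n) (F n) (\<lambda>_. 1) x"
      using intm by (intro real_cond_exp_mono) auto
    moreover have "AE x in M n. real_cond_exp (M n) (F n) (\<lambda>_. 1) x = 1"
      by (rule real_cond_exp_F_meas) auto
    ultimately have "AE x in M n. real_cond_exp (M n) (F n) ?m x \<le> e + indicator (?B n) x"
      using AE_space
      by eventually_elim (use e in \<open>auto simp: indicator_def abs_if split: if_splits\<close>)
    then have "(\<integral>x. real_cond_exp (M n) (F n) ?m x \<partial>M n) \<le> (\<integral>x. e + indicator (?B n) x \<partial>M n)"
      using Bm intm by (intro integral_mono_AE real_cond_exp_int Bochner_Integration.integrable_add
          integrable_real_indicator) (auto simp: less_top[symmetric])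
    also have "\<dots> = e + measure (M n) (?B n)"
      using Bm by (subst Bochner_Integration.integral_add)
       (auto simp: prob_space less_top[symmetric] Int_absorb2 intro!: integrable_real_indicator)
    also have "(\<integral>x. real_cond_exp (M n) (F n) ?m x \<partial>M n) = (\<integral>x. ?m x \<partial>M n)"
      by (rule real_cond_exp_int(2)[OF intm])
    finally have "(\<integral>x. ?m x \<partial>M n) < \<delta>" using elim e by auto
    moreover have "0 \<le> (\<integral>x. ?m x \<partial>M n)" by (rule Bochner_Integration.integral_nonneg) (simp add: nonneg)
    ultimately show ?case by (simp add: dist_real_def)
  qed
qed

section \<open>Couplings and the Wasserstein distance\<close>

lemma couplingsD:
  assumes "\<pi> \<in> couplings \<mu> \<nu>" 
  shows "sets \<pi> = sets (\<mu> \<Otimes>\<^sub>M \<nu>)" "distr \<pi> \<mu> fst = \<mu>" "distr \<pi> \<nu> snd = \<nu>"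
    "fst \<in> \<pi> \<rightarrow>\<^sub>M \<mu>" "snd \<in> \<pi> \<rightarrow>\<^sub>M \<nu>" "prob_space \<mu> \<Longrightarrow> prob_space \<pi>"
proof -
  show *: "sets \<pi> = sets (\<mu> \<Otimes>\<^sub>M \<nu>)" "distr \<pi> \<mu> fst = \<mu>" "distr \<pi> \<nu> snd = \<nu>"
    using assms by (auto simp: couplings_def)
  show m: "fst \<in> \<pi> \<rightarrow>\<^sub>M \<mu>" "snd \<in> \<pi> \<rightarrow>\<^sub>M \<nu>"
    by (simp_all add: measurable_cong_sets[OF *(1) refl])
  show "prob_space \<pi>" if "prob_space \<mu>"
    using that *(2) prob_space_distrD[OF m(1)] by metis
qed

lemma coupling_integral:
  fixes f :: "_ \<Rightarrow> 'b::{banach, second_countable_topology}" and f' :: "_ \<Rightarrow> 'b::{banach, second_countable_topology}"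
  assumes "\<pi> \<in> couplings \<mu> \<nu>"
  shows "f \<in> borel_measurable \<mu> \<Longrightarrow> (\<integral>z. f (fst z) \<partial>\<pi>) = (\<integral>x. f x \<partial>\<mu>)"
    "f' \<in> borel_measurable \<nu> \<Longrightarrow> (\<integral>z. f' (snd z) \<partial>\<pi>) = (\<integral>x. f' x \<partial>\<nu>)"
  using integral_distr[OF couplingsD(4)[OF assms], of f] integral_distr[OF couplingsD(5)[OF assms], of f']
  by (simp_all add: couplingsD(2,3)[OF assms])

text \<open>The easy half of Kantorovich duality: under any coupling the integrals differ by at most
  L times the expected distance, and the infimum over couplings does the rest.\<close>

lemma wasserstein1_lipschitz:
  fixes f :: "real \<Rightarrow> 'b::{banach, second_countable_topology}"
  assumes \<mu>: "prob_space \<mu>" "sets \<mu> = sets borel" and \<nu>: "prob_space \<nu>" "sets \<nu> = sets borel"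
    and f: "f \<in> borel_measurable borel" "\<And>x. norm (f x) \<le> B"
    and lip: "\<And>x y. norm (f x - f y) \<le> L * \<bar>x - y\<bar>" "0 \<le> L"
    and r: "wasserstein1 \<mu> \<nu> \<le> ennreal r" "0 \<le> r"
  shows "norm ((\<integral>x. f x \<partial>\<mu>) - (\<integral>x. f x \<partial>\<nu>)) \<le> L * r"
proof -
  let ?D = "norm ((\<integral>x. f x \<partial>\<mu>) - (\<integral>x. f x \<partial>\<nu>))"
  have meas: "f \<in> borel_measurable \<mu>" "f \<in> borel_measurable \<nu>"
    using f(1) by (simp_all add: measurable_cong_sets[OF \<mu>(2) refl] measurable_cong_sets[OF \<nu>(2) refl])
  have *: "ennreal ?D \<le> ennreal L * (\<integral>\<^sup>+z. ennreal \<bar>fst z - snd z\<bar> \<partial>\<pi>)" if \<pi>: "\<pi> \<in> couplings \<mu> \<nu>" for \<pi>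
  proof -
    interpret prob_space \<pi> using couplingsD(6)[OF \<pi> \<mu>(1)] .
    have [measurable]: "fst \<in> \<pi> \<rightarrow>\<^sub>M borel" "snd \<in> \<pi> \<rightarrow>\<^sub>M borel"
      using couplingsD(4,5)[OF \<pi>]
      by (simp_all add: measurable_cong_sets[OF refl \<mu>(2)] measurable_cong_sets[OF refl \<nu>(2)])
    note f(1)[measurable]
    have i: "integrable \<pi> (\<lambda>z. f (fst z))" "integrable \<pi> (\<lambda>z. f (snd z))"
      by (auto intro!: integrable_const_bound[where B=B] f)
    have "(\<integral>x. f x \<partial>\<mu>) - (\<integral>x. f x \<partial>\<nu>) = (\<integral>z. f (fst z) - f (snd z) \<partial>\<pi>)"
      using i by (simp add: coupling_integral[OF \<pi>] meas)
    then have "ennreal ?D \<le> (\<integral>\<^sup>+z. norm (f (fst z) - f (snd z)) \<partial>\<pi>)"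
      using i by (metis Bochner_Integration.integrable_diff integral_norm_bound_ennreal)
    also have "\<dots> \<le> (\<integral>\<^sup>+z. ennreal L * ennreal \<bar>fst z - snd z\<bar> \<partial>\<pi>)"
      using lip by (intro nn_integral_mono) (auto simp: ennreal_mult[symmetric] intro!: ennreal_leI)
    also have "\<dots> = ennreal L * (\<integral>\<^sup>+z. ennreal \<bar>fst z - snd z\<bar> \<partial>\<pi>)"
      by (rule nn_integral_cmult) measurable
    finally show ?thesis .
  qed
  show ?thesis
  \<comment> \<open>Dividing by L requires L \<noteq> 0. For L = 0 a single coupling suffices, and
    one exists because the infimum over the empty set would be infinite instead of at most
    \<open>ennreal r\<close>.\<close>
  proof (cases "L = 0")
    case True
    obtain \<pi> where "\<pi> \<in> couplings \<mu> \<nu>"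
    proof (cases "couplings \<mu> \<nu> = {}")
      case True
      then show ?thesis using r by (auto simp: wasserstein1_def top_unique)
    qed auto
    from *[OF this] True show ?thesis by simp
  next
    case False
    then have L: "0 < L" using lip by auto
    have "ennreal (?D / L) \<le> wasserstein1 \<mu> \<nu>"
      unfolding wasserstein1_def
    proof (rule INF_greatest)
      fix \<pi> assume "\<pi> \<in> couplings \<mu> \<nu>"
      from *[OF this] have "ennreal ?D / ennreal L \<le> (\<integral>\<^sup>+z. ennreal \<bar>fst z - snd z\<bar> \<partial>\<pi>)"
        using L by (subst divide_le_posI_ennreal) (auto simp: mult.commute)
      then show "ennreal (?D / L) \<le> (\<integral>\<^sup>+z. ennreal \<bar>fst z - snd z\<bar> \<partial>\<pi>)"
        using L by (simp add: divide_ennreal)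
    qed
    also note r(1)
    finally have "?D / L \<le> r" using r(2) by simp
    then show ?thesis using L by (simp add: field_simps)
  qed
qed

section \<open>From conditional laws of events to integrals of bounded functions\<close>

lemma real_cond_exp_abs_diff_le:
  assumes "prob_space M" "subalgebra M F" and [measurable]: "f \<in> borel_measurable M" "g \<in> borel_measurable M"
    and B: "\<And>x. \<bar>f x\<bar> \<le> B" "\<And>x. \<bar>g x\<bar> \<le> B'" and e: "\<And>x. x \<in> space M \<Longrightarrow> \<bar>f x - g x\<bar> \<le> e"
  shows "AE x in M. \<bar>real_cond_exp M F f x - real_cond_exp M F g x\<bar> \<le> e"
proof -
  interpret prob_space M by fact
  interpret sigma_finite_subalgebra M F using assms(1,2) by (rule prob_space_finite_subalgebra)
  have i: "integrable M f" "integrable M g"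
    by (rule integrable_const_bound[where B=B] integrable_const_bound[where B=B'], use B in auto)+
  have c: "AE x in M. real_cond_exp M F (\<lambda>_. t) x = t" for t
    by (rule real_cond_exp_F_meas) auto
  have d: "AE x in M. real_cond_exp M F (\<lambda>x. f x - g x) x = real_cond_exp M F f x - real_cond_exp M F g x"
    using i by auto
  have 1: "AE x in M. real_cond_exp M F (\<lambda>x. f x - g x) x \<le> real_cond_exp M F (\<lambda>_. e) x"
    using i e by (intro real_cond_exp_mono AE_I2) (auto simp: abs_le_iff)
  have 2: "AE x in M. real_cond_exp M F (\<lambda>_. - e) x \<le> real_cond_exp M F (\<lambda>x. f x - g x) x"
    using i e by (intro real_cond_exp_mono AE_I2) (fastforce simp: abs_le_iff)+
  from c[of e] c[of "-e"] d 1 2 show ?thesis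
    by eventually_elim auto
qed

text \<open>\<open>has_cond_law\<close> speaks of one event at a time and does not make \<kappa>
  measurable in \<omega>. A bounded f is therefore approximated uniformly by step functions: each
  involves finitely many events, and the accuracies run over a countable set, so the null sets can
  be united.\<close>

lemma has_cond_law_integral:
  fixes f :: "'b \<Rightarrow> real"
  assumes M: "prob_space M" and sub: "subalgebra M F" and cl: "has_cond_law M F N Z \<kappa>"
    and \<kappa>: "AE \<omega> in M. prob_space (\<kappa> \<omega>) \<and> sets (\<kappa> \<omega>) = sets N"
    and f[measurable]: "f \<in> borel_measurable N" and B: "\<And>x. \<bar>f x\<bar> \<le> B"
  shows "AE \<omega> in M. real_cond_exp M F (\<lambda>\<omega>. f (Z \<omega>)) \<omega> = (\<integral>x. f x \<partial>\<kappa> \<omega>)"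
proof -
  interpret prob_space M by fact
  interpret sigma_finite_subalgebra M F using assms(1,2) by (rule prob_space_finite_subalgebra)
  have Z[measurable]: "Z \<in> M \<rightarrow>\<^sub>M N" using cl by (simp add: has_cond_law_def)
  \<comment> \<open>One half of the bound pays for replacing f by the step function under
    \<open>real_cond_exp\<close>, the other half for doing so under the integral against
    \<kappa>.\<close>
  have "AE \<omega> in M. \<bar>real_cond_exp M F (\<lambda>\<omega>. f (Z \<omega>)) \<omega> - (\<integral>x. f x \<partial>\<kappa> \<omega>)\<bar> \<le> 2 / real (Suc m)" for m
  proof -
    let ?m = "real (Suc m)"
    \<comment> \<open>Since |f| \<le> B, the integer part of \<open>?m * f x\<close> takes only
      values in this finite set.\<close>
    define S where "S = {\<lfloor>- ?m * B\<rfloor>..\<lfloor>?m * B\<rfloor>}"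
    define C where "C j = {x \<in> space N. \<lfloor>?m * f x\<rfloor> = j}" for j
    have [measurable]: "C j \<in> sets N" for j unfolding C_def by measurable
    define g where "g \<omega> = (\<Sum>j\<in>S. (j / ?m) * indicator {\<omega>\<in>space M. Z \<omega> \<in> C j} \<omega>)" for \<omega>
    define h where "h x = (\<Sum>j\<in>S. (j / ?m) * indicator (C j) x)" for x
    have [measurable]: "g \<in> borel_measurable M" "h \<in> borel_measurable N"
      unfolding g_def h_def by measurable
    have fh: "\<bar>f x - h x\<bar> \<le> 1 / ?m" if x: "x \<in> space N" for x
    proof -
      have "?m * (- B) \<le> ?m * f x" "?m * f x \<le> ?m * B"
        using abs_le_D1[OF B[of x]] abs_le_D2[OF B[of x]] by (intro mult_left_mono; linarith)+
      then have "- ?m * B \<le> ?m * f x" "?m * f x \<le> ?m * B" by (simp_all only: mult_minus_left mult_minus_right)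
      from this[THEN floor_mono] have "\<lfloor>?m * f x\<rfloor> \<in> S" unfolding S_def by simp
      moreover have "finite S" by (simp add: S_def)
      moreover have "(j / ?m) * indicator (C j) x = (if \<lfloor>?m * f x\<rfloor> = j then j / ?m else 0)" for j
        using x by (auto simp: C_def)
      ultimately have "h x = \<lfloor>?m * f x\<rfloor> / ?m"
        unfolding h_def by (simp only: sum.delta' if_True)
      moreover have "\<bar>f x - \<lfloor>?m * f x\<rfloor> / ?m\<bar> = \<bar>?m * f x - \<lfloor>?m * f x\<rfloor>\<bar> / ?m"
      proof -
        have "f x - \<lfloor>?m * f x\<rfloor> / ?m = (?m * f x - \<lfloor>?m * f x\<rfloor>) / ?m"
          by (simp add: diff_divide_distrib)
        then show ?thesis by (simp only: abs_divide abs_of_nat)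
      qed
      moreover have "\<bar>?m * f x - \<lfloor>?m * f x\<rfloor>\<bar> \<le> 1" by linarith
      ultimately show ?thesis by (simp add: divide_right_mono)
    qed
    have gh: "g \<omega> = h (Z \<omega>)" if "\<omega> \<in> space M" for \<omega>
      using that unfolding g_def h_def by (intro sum.cong) (auto simp: indicator_def)
    have bg: "\<bar>g \<omega>\<bar> \<le> (\<Sum>j\<in>S. \<bar>j / ?m\<bar>)" for \<omega>
      unfolding g_def by (intro order_trans[OF sum_abs] sum_mono) (auto simp: indicator_def)
    have bh: "\<bar>h \<omega>\<bar> \<le> (\<Sum>j\<in>S. \<bar>j / ?m\<bar>)" for \<omega>
      unfolding h_def by (intro order_trans[OF sum_abs] sum_mono) (auto simp: indicator_def)
    have fg: "\<bar>f (Z \<omega>) - g \<omega>\<bar> \<le> 1 / ?m" if "\<omega> \<in> space M" for \<omega>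
      unfolding gh[OF that] by (rule fh) (rule measurable_space[OF Z that])
    have 1: "AE \<omega> in M. \<bar>real_cond_exp M F (\<lambda>\<omega>. f (Z \<omega>)) \<omega> - real_cond_exp M F g \<omega>\<bar> \<le> 1 / ?m"
      by (rule real_cond_exp_abs_diff_le[OF M sub _ _ B bg fg]) measurable
    have int_ind: "integrable M (indicator {\<omega>\<in>space M. Z \<omega> \<in> C j} :: _ \<Rightarrow> real)" for j
      by (rule integrable_const_bound[where B=1]) auto
    have "AE \<omega> in M. real_cond_exp M F g \<omega> = (\<Sum>j\<in>S. real_cond_exp M F (\<lambda>\<omega>. (j / ?m) * indicator {\<omega>\<in>space M. Z \<omega> \<in> C j} \<omega>) \<omega>)"
      unfolding g_def by (intro real_cond_exp_sum integrable_mult_right int_ind)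
    moreover have "AE \<omega> in M. \<forall>j\<in>S. real_cond_exp M F (\<lambda>\<omega>. (j / ?m) * indicator {\<omega>\<in>space M. Z \<omega> \<in> C j} \<omega>) \<omega>
        = (j / ?m) * real_cond_exp M F (indicator {\<omega>\<in>space M. Z \<omega> \<in> C j}) \<omega>"
      by (intro AE_finite_allI real_cond_exp_cmult int_ind) (simp add: S_def)
    moreover have "AE \<omega> in M. \<forall>j\<in>S. real_cond_exp M F (indicator {\<omega>\<in>space M. Z \<omega> \<in> C j}) \<omega> = measure (\<kappa> \<omega>) (C j)"
      using cl unfolding has_cond_law_def by (intro AE_finite_allI) (auto simp: S_def)
    ultimately have 2: "AE \<omega> in M. real_cond_exp M F g \<omega> = (\<Sum>j\<in>S. (j / ?m) * measure (\<kappa> \<omega>) (C j))"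
      by eventually_elim simp
    show ?thesis using 1 2 \<kappa>
    proof eventually_elim
      case (elim \<omega>)
      interpret k: prob_space "\<kappa> \<omega>" using elim by auto
      have sk: "sets (\<kappa> \<omega>) = sets N" using elim by auto
      note [measurable_cong] = sk
      have i: "integrable (\<kappa> \<omega>) f" "integrable (\<kappa> \<omega>) h"
        by (rule k.integrable_const_bound[where B=B] k.integrable_const_bound[where B="\<Sum>j\<in>S. \<bar>j / ?m\<bar>"],
            use B bh in auto)+
      have "(\<integral>x. h x \<partial>\<kappa> \<omega>) = (\<Sum>j\<in>S. (j / ?m) * measure (\<kappa> \<omega>) (C j))"
      proof -
        have "integrable (\<kappa> \<omega>) (indicator (C j) :: _ \<Rightarrow> real)" for j
          by (rule integrable_real_indicator) (simp_all add: sk less_top[symmetric])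
        then have "(\<integral>x. h x \<partial>\<kappa> \<omega>) = (\<Sum>j\<in>S. \<integral>x. (j / ?m) * indicator (C j) x \<partial>\<kappa> \<omega>)"
          unfolding h_def by (intro Bochner_Integration.integral_sum integrable_mult_right)
        moreover have "C j \<inter> space (\<kappa> \<omega>) = C j" for j
          using sets_eq_imp_space_eq[OF sk] by (auto simp: C_def)
        ultimately show ?thesis by simp
      qed
      moreover have "\<bar>(\<integral>x. f x \<partial>\<kappa> \<omega>) - (\<integral>x. h x \<partial>\<kappa> \<omega>)\<bar> \<le> 1 / ?m"
      proof -
        have "\<bar>(\<integral>x. f x \<partial>\<kappa> \<omega>) - (\<integral>x. h x \<partial>\<kappa> \<omega>)\<bar> = \<bar>\<integral>x. f x - h x \<partial>\<kappa> \<omega>\<bar>" using i by simp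
        also have "\<dots> \<le> (\<integral>x. \<bar>f x - h x\<bar> \<partial>\<kappa> \<omega>)" by (rule integral_abs_bound)
        also have "\<dots> \<le> (\<integral>x. 1 / ?m \<partial>\<kappa> \<omega>)"
          using i fh sets_eq_imp_space_eq[OF sk] by (intro integral_mono) auto
        finally show ?thesis by (simp add: k.prob_space)
      qed
      ultimately have "\<bar>real_cond_exp M F (\<lambda>\<omega>. f (Z \<omega>)) \<omega> - (\<integral>x. f x \<partial>\<kappa> \<omega>)\<bar> \<le> 1 / ?m + 1 / ?m"
        using elim by linarith
      then show ?case by simp
    qed
  qed
  then have "AE \<omega> in M. \<forall>m. \<bar>real_cond_exp M F (\<lambda>\<omega>. f (Z \<omega>)) \<omega> - (\<integral>x. f x \<partial>\<kappa> \<omega>)\<bar> \<le> 2 / real (Suc m)"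
    by (simp add: AE_all_countable)
  then show ?thesis
  proof eventually_elim
    case (elim \<omega>)
    have "(\<lambda>m. 2 / real (Suc m)) \<longlonglongrightarrow> 0" by (rule LIMSEQ_Suc) (rule lim_const_over_n)
    then have "\<bar>real_cond_exp M F (\<lambda>\<omega>. f (Z \<omega>)) \<omega> - (\<integral>x. f x \<partial>\<kappa> \<omega>)\<bar> \<le> 0"
      by (rule LIMSEQ_le_const) (use elim in blast)
    then show ?case by linarith
  qed
qed

text \<open>Boxes generate the product \<sigma>-algebra, and the product measure of a box is a
  finite product of measurable functions of y.\<close>

lemma measurable_PiM_prob_algebra:
  assumes k: "\<And>i. k i \<in> N1 \<rightarrow>\<^sub>M prob_algebra N" and J: "finite J"
  shows "(\<lambda>y. Pi\<^sub>M J (\<lambda>i. k i y)) \<in> N1 \<rightarrow>\<^sub>M prob_algebra (Pi\<^sub>M J (\<lambda>_. N))"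
proof (rule measurable_prob_algebra_generated[OF sets_PiM Int_stable_prod_algebra prod_algebra_sets_into_space])
  fix y assume y: "y \<in> space N1"
  have ky: "prob_space (k i y)" "sets (k i y) = sets N" for i
    using measurable_space[OF k y] by (auto simp: space_prob_algebra)
  interpret product_prob_space "\<lambda>i. k i y" J by (intro product_prob_spaceI ky)
  show "prob_space (Pi\<^sub>M J (\<lambda>i. k i y))" by (rule prob_space_PiM) (rule ky)
  show "sets (Pi\<^sub>M J (\<lambda>i. k i y)) = sets (Pi\<^sub>M J (\<lambda>_. N))" by (intro sets_PiM_cong ky refl)
next
  fix A assume "A \<in> prod_algebra J (\<lambda>_. N)"
  then obtain E where A: "A = Pi\<^sub>E J E" "\<And>i. i \<in> J \<Longrightarrow> E i \<in> sets N"
    by (auto elim!: prod_algebraE_all)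
  have "emeasure (Pi\<^sub>M J (\<lambda>i. k i y)) A = (\<Prod>i\<in>J. emeasure (k i y) (E i))" if y: "y \<in> space N1" for y
  proof -
    have ky: "prob_space (k i y)" "sets (k i y) = sets N" for i
      using measurable_space[OF k y] by (auto simp: space_prob_algebra)
    interpret product_prob_space "\<lambda>i. k i y" J by (intro product_prob_spaceI ky)
    show ?thesis unfolding A(1) using A ky J by (intro emeasure_PiM) auto
  qed
  moreover have "(\<lambda>y. emeasure (k i y) (E i)) \<in> borel_measurable N1" if "i \<in> J" for i
    using A that by (intro measurable_emeasure_kernel[OF measurable_prob_algebraD[OF k]]) auto
  ultimately show "(\<lambda>y. emeasure (Pi\<^sub>M J (\<lambda>i. k i y)) A) \<in> borel_measurable N1"
    by (subst measurable_cong) (auto intro!: borel_measurable_prod)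
qed


text \<open>Upgrades conditional independence, which is stated for boxes, to the joint law of (Y, W)
  on {Y \<in> A}: there it is a mixture of product kernels, by uniqueness of finite measures that
  agree on the intersection-stable family of rectangles. The set A is there because, for a random
  index set, the factorization is known only where J is contained in it.\<close>

lemma cond_indep_integral:
  fixes f :: "'y \<times> ('i \<Rightarrow> 'b) \<Rightarrow> real"
  assumes M: "prob_space M" and Y[measurable]: "Y \<in> M \<rightarrow>\<^sub>M N1" and J: "finite J"
    and W[measurable]: "\<And>i. W i \<in> M \<rightarrow>\<^sub>M N" and k: "\<And>i. k i \<in> N1 \<rightarrow>\<^sub>M prob_algebra N"
    and A[measurable]: "A \<in> sets N1"
    and ci: "\<And>B. (\<forall>i\<in>J. B i \<in> sets N) \<Longrightarrow> AE \<omega> in M. Y \<omega> \<in> A \<longrightarrow>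
      real_cond_exp M (vimage_algebra (space M) Y N1) (indicator {\<omega>\<in>space M. \<forall>i\<in>J. W i \<omega> \<in> B i}) \<omega>
        = (\<Prod>i\<in>J. measure (k i (Y \<omega>)) (B i))"
    and f[measurable]: "f \<in> borel_measurable (N1 \<Otimes>\<^sub>M Pi\<^sub>M J (\<lambda>_. N))" and B: "\<And>x. \<bar>f x\<bar> \<le> C"
  shows "(\<integral>\<omega>. indicator A (Y \<omega>) * f (Y \<omega>, \<lambda>i\<in>J. W i \<omega>) \<partial>M)
    = (\<integral>\<omega>. indicator A (Y \<omega>) * (\<integral>w. f (Y \<omega>, w) \<partial>Pi\<^sub>M J (\<lambda>i. k i (Y \<omega>))) \<partial>M)"
proof -
  interpret prob_space M by fact
  define F where "F = vimage_algebra (space M) Y N1"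
  have sub: "subalgebra M F" unfolding F_def subalgebra_def
    by (auto simp: sets_vimage_algebra2 measurable_space[OF Y] measurable_sets[OF Y])
  have YF: "Y \<in> F \<rightarrow>\<^sub>M N1" unfolding F_def by (rule measurable_vimage_algebra1) (use measurable_space[OF Y] in auto)
  interpret sigma_finite_subalgebra M F using M sub by (rule prob_space_finite_subalgebra)
  let ?P = "Pi\<^sub>M J (\<lambda>_. N)"
  let ?K = "\<lambda>y. Pi\<^sub>M J (\<lambda>i. k i y)"
  have ky: "prob_space (k i y)" "sets (k i y) = sets N" if "y \<in> space N1" for i y
    using measurable_space[OF k that] by (auto simp: space_prob_algebra)
  have K: "?K \<in> N1 \<rightarrow>\<^sub>M prob_algebra ?P" by (rule measurable_PiM_prob_algebra[OF k J])
  have [measurable]: "?K \<in> N1 \<rightarrow>\<^sub>M subprob_algebra ?P" using K by (rule measurable_prob_algebraD)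
  \<comment> \<open>The product kernel with the point mass at y as first coordinate; mixing it over
    the law of Y gives the joint law expected of (Y, W).\<close>
  define K2 where "K2 y = distr (?K y) (N1 \<Otimes>\<^sub>M ?P) (Pair y)" for y
  have K2: "K2 \<in> N1 \<rightarrow>\<^sub>M subprob_algebra (N1 \<Otimes>\<^sub>M ?P)"
    unfolding K2_def by (rule measurable_distr2) measurable
  have K2Y: "(\<lambda>\<omega>. K2 (Y \<omega>)) \<in> M \<rightarrow>\<^sub>M subprob_algebra (N1 \<Otimes>\<^sub>M ?P)"
    by (rule measurable_compose[OF Y K2])
  \<comment> \<open>Restricting to Y \<in> A without normalizing avoids dividing by a probability
    that may be 0; the result is a finite measure.\<close>
  define M' where "M' = density M (\<lambda>\<omega>. indicator A (Y \<omega>))"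
  have sM': "space M' = space M" "sets M' = sets M" by (simp_all add: M'_def)
  have M'1: "emeasure M' (space M') \<le> 1"
  proof -
    have "emeasure M' (space M') = emeasure M {\<omega>\<in>space M. Y \<omega> \<in> A}"
      unfolding M'_def by (subst emeasure_density) (auto intro!: nn_integral_cong arg_cong[where f="emeasure M"] simp: nn_integral_indicator[symmetric] simp del: nn_integral_indicator split: split_indicator)
    then show ?thesis using emeasure_le_1 by simp
  qed
  have fM': "finite_measure M'"
    by (rule finite_measureI) (use M'1 in \<open>auto simp: top_unique\<close>)
  have K2Y': "(\<lambda>\<omega>. K2 (Y \<omega>)) \<in> M' \<rightarrow>\<^sub>M subprob_algebra (N1 \<Otimes>\<^sub>M ?P)"
    using K2Y by (simp add: measurable_cong_sets[OF sM'(2) refl])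
  define m1 where "m1 = distr M' (N1 \<Otimes>\<^sub>M ?P) (\<lambda>\<omega>. (Y \<omega>, \<lambda>i\<in>J. W i \<omega>))"
  define m2 where "m2 = M' \<bind> (\<lambda>\<omega>. K2 (Y \<omega>))"
  have YW[measurable]: "(\<lambda>\<omega>. (Y \<omega>, \<lambda>i\<in>J. W i \<omega>)) \<in> M \<rightarrow>\<^sub>M N1 \<Otimes>\<^sub>M ?P" by measurable
  have YW': "(\<lambda>\<omega>. (Y \<omega>, \<lambda>i\<in>J. W i \<omega>)) \<in> M' \<rightarrow>\<^sub>M N1 \<Otimes>\<^sub>M ?P" 
    using YW by (simp add: measurable_cong_sets[OF sM'(2) refl])
  have sets2: "sets m2 = sets (N1 \<Otimes>\<^sub>M ?P)" 
    unfolding m2_def by (rule sets_bind[OF sets_kernel[OF K2Y']]) (use not_empty sM' in auto)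
  let ?R = "{a \<times> b | a b. a \<in> sets N1 \<and> b \<in> prod_algebra J (\<lambda>_. N)}"
  have rect: "emeasure m1 (A' \<times> Pi\<^sub>E J E) = emeasure m2 (A' \<times> Pi\<^sub>E J E)"
    if A'[measurable]: "A' \<in> sets N1" and E: "\<And>i. i \<in> J \<Longrightarrow> E i \<in> sets N" for A' E
  proof -
    have PE[measurable]: "Pi\<^sub>E J E \<in> sets ?P" using E J by (intro sets_PiM_I_finite) auto
    have A'E: "A' \<times> Pi\<^sub>E J E \<in> sets (N1 \<Otimes>\<^sub>M ?P)" using A' PE by (rule pair_measureI)
    define D where "D = {\<omega>\<in>space M. \<forall>i\<in>J. W i \<omega> \<in> E i}"
    \<comment> \<open>On H the value of Y lies in A, so the hypothesis on conditional probabilities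
      applies; and H is determined by Y, so they can be integrated over it.\<close>
    define H where "H = {\<omega>\<in>space M. Y \<omega> \<in> A \<inter> A'}"
    have D[measurable]: "D \<in> sets M" unfolding D_def using J E by measurable
    have "Y -` (A \<inter> A') \<inter> space M \<in> sets F" unfolding F_def by (rule in_vimage_algebra) measurable
    moreover have "Y -` (A \<inter> A') \<inter> space M = H" by (auto simp: H_def)
    ultimately have HF: "H \<in> sets F" by simp
    then have H[measurable]: "H \<in> sets M" using sub by (auto simp: subalgebra_def)
    have km: "(\<lambda>\<omega>. measure (k i (Y \<omega>)) (E i)) \<in> borel_measurable M" if "i \<in> J" for i
      using E[OF that] by (intro measurable_compose[OF measurable_compose[OF Y k] measurable_measure_prob_algebra])
    have "emeasure m1 (A' \<times> Pi\<^sub>E J E) = emeasure M' ((\<lambda>\<omega>. (Y \<omega>, \<lambda>i\<in>J. W i \<omega>)) -` (A' \<times> Pi\<^sub>E J E) \<inter> space M)"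
      unfolding m1_def using YW' A'E by (subst emeasure_distr) (simp_all add: sM')
    also have "(\<lambda>\<omega>. (Y \<omega>, \<lambda>i\<in>J. W i \<omega>)) -` (A' \<times> Pi\<^sub>E J E) \<inter> space M = D \<inter> (Y -` A' \<inter> space M)"
      by (auto simp: D_def)
    also have "emeasure M' \<dots> = (\<integral>\<^sup>+\<omega>. indicator A (Y \<omega>) * indicator (D \<inter> (Y -` A' \<inter> space M)) \<omega> \<partial>M)"
      unfolding M'_def by (rule emeasure_density) measurable
    also have "\<dots> = (\<integral>\<^sup>+\<omega>. indicator (H \<inter> D) \<omega> \<partial>M)"
      by (intro nn_integral_cong) (auto simp: H_def indicator_def)
    also have "\<dots> = ennreal (measure M (H \<inter> D))" by (simp add: emeasure_eq_measure)
    also have "measure M (H \<inter> D) = (\<integral>\<omega>\<in>H. real_cond_exp M F (indicator D) \<omega> \<partial>M)"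
      by (rule measure_eq_cond_exp(1)[OF M sub D HF])
    also have "\<dots> = (\<integral>\<omega>\<in>H. (\<Prod>i\<in>J. measure (k i (Y \<omega>)) (E i)) \<partial>M)"
      unfolding set_lebesgue_integral_def
    proof (rule integral_cong_AE)
      show "(\<lambda>x. indicat_real H x *\<^sub>R (\<Prod>i\<in>J. measure (k i (Y x)) (E i))) \<in> borel_measurable M"
        using km by (intro borel_measurable_scaleR borel_measurable_prod) auto
      have "\<forall>i\<in>J. E i \<in> sets N" using E by blast
      from ci[OF this]
      show "AE x in M. indicat_real H x *\<^sub>R real_cond_exp M F (indicat_real D) x =
         indicat_real H x *\<^sub>R (\<Prod>i\<in>J. measure (k i (Y x)) (E i))"
        unfolding F_def[symmetric] D_def[symmetric]
        by eventually_elim (auto simp: H_def indicator_def)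
    qed measurable
    also have "ennreal \<dots> = (\<integral>\<^sup>+\<omega>. ennreal (indicator H \<omega> * (\<Prod>i\<in>J. measure (k i (Y \<omega>)) (E i))) \<partial>M)"
      unfolding set_lebesgue_integral_def
    proof (subst nn_integral_eq_integral)
      have "(\<Prod>i\<in>J. measure (k i (Y \<omega>)) (E i)) \<le> 1" if "\<omega> \<in> space M" for \<omega>
        using prob_space.prob_le_1[OF ky(1)[OF measurable_space[OF Y that]]] by (intro prod_le_1) auto
      then show "integrable M (\<lambda>\<omega>. indicator H \<omega> * (\<Prod>i\<in>J. measure (k i (Y \<omega>)) (E i)))"
        using km by (intro integrable_const_bound[where B=1] AE_I2 borel_measurable_times borel_measurable_prod)
           (auto simp: indicator_def prod_nonneg)
    qed (auto simp: prod_nonneg)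
    also have "\<dots> = (\<integral>\<^sup>+\<omega>. indicator A (Y \<omega>) * emeasure (K2 (Y \<omega>)) (A' \<times> Pi\<^sub>E J E) \<partial>M)"
    proof (rule nn_integral_cong)
      fix \<omega> assume w: "\<omega> \<in> space M"
      then have y: "Y \<omega> \<in> space N1" using measurable_space[OF Y] by auto
      interpret product_prob_space "\<lambda>i. k i (Y \<omega>)" J by (intro product_prob_spaceI ky y)
      have sK: "sets (?K (Y \<omega>)) = sets ?P" by (intro sets_PiM_cong ky refl y)
      have "emeasure (K2 (Y \<omega>)) (A' \<times> Pi\<^sub>E J E) = emeasure (?K (Y \<omega>)) (Pair (Y \<omega>) -` (A' \<times> Pi\<^sub>E J E) \<inter> space (?K (Y \<omega>)))"
        unfolding K2_def using A'E y by (intro emeasure_distr) (simp_all add: measurable_cong_sets[OF sK refl])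
      also have "Pair (Y \<omega>) -` (A' \<times> Pi\<^sub>E J E) \<inter> space (?K (Y \<omega>)) = (if Y \<omega> \<in> A' then Pi\<^sub>E J E else {})"
        using sets.sets_into_space[OF PE] sets_eq_imp_space_eq[OF sK] by auto
      also have "emeasure (?K (Y \<omega>)) \<dots> = indicator A' (Y \<omega>) * (\<Prod>i\<in>J. emeasure (k i (Y \<omega>)) (E i))"
        using E y ky J by (auto simp: indicator_def intro!: emeasure_PiM)
      also have "(\<Prod>i\<in>J. emeasure (k i (Y \<omega>)) (E i)) = ennreal (\<Prod>i\<in>J. measure (k i (Y \<omega>)) (E i))"
        by (simp add: M.emeasure_eq_measure prod_ennreal)
      finally show "ennreal (indicator H \<omega> * (\<Prod>i\<in>J. measure (k i (Y \<omega>)) (E i))) =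
          indicator A (Y \<omega>) * emeasure (K2 (Y \<omega>)) (A' \<times> Pi\<^sub>E J E)"
        using w by (auto simp: H_def indicator_def)
    qed
    also have "\<dots> = (\<integral>\<^sup>+\<omega>. emeasure (K2 (Y \<omega>)) (A' \<times> Pi\<^sub>E J E) \<partial>M')"
      unfolding M'_def using A'E by (subst nn_integral_density) (auto intro!: measurable_emeasure_kernel[OF K2Y])
    also have "\<dots> = emeasure m2 (A' \<times> Pi\<^sub>E J E)"
      unfolding m2_def using not_empty sM' K2Y' A'E by (subst emeasure_bind) auto
    finally show ?thesis .
  qed
  have "m1 = m2"
  proof (rule measure_eqI_generator_eq[where E="?R" and \<Omega>="space N1 \<times> space ?P" and A="\<lambda>_. space N1 \<times> space ?P"])
    show "Int_stable ?R"
    proof (rule Int_stableI)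
      fix x y assume "x \<in> ?R" "y \<in> ?R"
      then obtain a b a' b' where "x = a \<times> b" "y = a' \<times> b'" "a \<in> sets N1" "a' \<in> sets N1"
        "b \<in> prod_algebra J (\<lambda>_. N)" "b' \<in> prod_algebra J (\<lambda>_. N)" by auto
      then show "x \<inter> y \<in> ?R"
        using Int_stableD[OF Int_stable_prod_algebra, of b J "\<lambda>_. N" b']
        by (auto simp: Times_Int_Times)
    qed
    show "?R \<subseteq> Pow (space N1 \<times> space ?P)"
      using sets.sets_into_space prod_algebra_sets_into_space[of J "\<lambda>_. N"] by (fastforce simp: space_PiM)
    show "emeasure m1 X = emeasure m2 X" if "X \<in> ?R" for X
      using that by (auto elim!: prod_algebraE_all intro!: rect)
    have "sets (N1 \<Otimes>\<^sub>M ?P) = sets (sigma (space N1 \<times> space ?P) ?R)"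
    proof (rule sets_pair_eq[where Ca="{space N1}" and Cb="{space ?P}"])
      have "space ?P = (\<Pi>\<^sub>E i\<in>J. space N)" by (simp add: space_PiM)
      then show "{space ?P} \<subseteq> prod_algebra J (\<lambda>_. N)" using J
        by (auto simp: prod_algebra_eq_finite)
      show "prod_algebra J (\<lambda>_. N) \<subseteq> Pow (space ?P)"
        using prod_algebra_sets_into_space[of J "\<lambda>_. N"] by (simp add: space_PiM)
    qed (auto simp: sets.sigma_sets_eq sets_PiM space_PiM sets.space_closed)
    moreover have "?R \<subseteq> Pow (space N1 \<times> space ?P)" by fact
    ultimately show "sets m1 = sigma_sets (space N1 \<times> space ?P) ?R" "sets m2 = sigma_sets (space N1 \<times> space ?P) ?R"
      by (simp_all add: m1_def sets2)
    show "range (\<lambda>_. space N1 \<times> space ?P) \<subseteq> ?R" using J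
      by (auto simp: prod_algebra_eq_finite space_PiM)
    show "emeasure m1 (space N1 \<times> space ?P) \<noteq> \<infinity>" for i :: nat
    proof -
      interpret finite_measure m1 unfolding m1_def using YW' by (intro finite_measure.finite_measure_distr fM')
      show ?thesis by simp
    qed
  qed auto
  then have "(\<integral>x. f x \<partial>m1) = (\<integral>x. f x \<partial>m2)" by simp
  also have "(\<integral>x. f x \<partial>m1) = (\<integral>\<omega>. f (Y \<omega>, \<lambda>i\<in>J. W i \<omega>) \<partial>M')"
    unfolding m1_def by (rule integral_distr[OF YW' f])
  also have "\<dots> = (\<integral>\<omega>. indicator A (Y \<omega>) * f (Y \<omega>, \<lambda>i\<in>J. W i \<omega>) \<partial>M)"
    unfolding M'_def ennreal_indicator[symmetric] by (subst integral_density) auto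
  also have "(\<integral>x. f x \<partial>m2) = (\<integral>\<omega>. (\<integral>x. f x \<partial>K2 (Y \<omega>)) \<partial>M')"
    unfolding m2_def
  proof (rule integral_bind[OF f B K2Y' fM'])
    show "AE x in M'. emeasure (K2 (Y x)) (space (K2 (Y x))) \<le> ennreal 1"
      using subprob_space_kernel[OF K2Y'] by (intro AE_I2) (simp add: subprob_space.emeasure_space_le_1)
  qed
  also have "\<dots> = (\<integral>\<omega>. indicator A (Y \<omega>) * (\<integral>x. f x \<partial>K2 (Y \<omega>)) \<partial>M)"
    unfolding M'_def ennreal_indicator[symmetric]
    by (subst integral_density) (auto intro!: measurable_compose[OF K2Y integral_measurable_subprob_algebra])
  also have "\<dots> = (\<integral>\<omega>. indicator A (Y \<omega>) * (\<integral>w. f (Y \<omega>, w) \<partial>?K (Y \<omega>)) \<partial>M)"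
  proof (rule Bochner_Integration.integral_cong[OF refl])
    fix \<omega> assume w: "\<omega> \<in> space M"
    then have y: "Y \<omega> \<in> space N1" using measurable_space[OF Y] by auto
    have sK: "sets (?K (Y \<omega>)) = sets ?P" by (intro sets_PiM_cong ky refl y)
    have "(\<integral>x. f x \<partial>K2 (Y \<omega>)) = (\<integral>w. f (Y \<omega>, w) \<partial>?K (Y \<omega>))"
      unfolding K2_def using y by (intro integral_distr f) (simp add: measurable_cong_sets[OF sK refl])
    then show "indicator A (Y \<omega>) * (\<integral>x. f x \<partial>K2 (Y \<omega>)) = indicator A (Y \<omega>) * (\<integral>w. f (Y \<omega>, w) \<partial>?K (Y \<omega>))"
      by simp
  qed
  finally show ?thesis .
qed

section \<open>Measurability on the space of marked graphs\<close>

lemma space_mgraph_space [simp]: "space mgraph_space = UNIV"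
  by (simp add: mgraph_space_def)

lemma measurable_mgraph_space_components:
  "(\<lambda>G. ((\<lambda>v. v \<in> verts G), inn G, mark G)) \<in> mgraph_space \<rightarrow>\<^sub>M
     (Pi\<^sub>M UNIV (\<lambda>_. count_space UNIV) \<Otimes>\<^sub>M
      (Pi\<^sub>M UNIV (\<lambda>_. Pi\<^sub>M UNIV (\<lambda>_. count_space UNIV)) \<Otimes>\<^sub>M Pi\<^sub>M UNIV (\<lambda>_. borel)))"
  unfolding mgraph_space_def by (rule measurable_vimage_algebra1) (auto simp: space_pair_measure space_PiM)

context
  fixes M :: "'w measure" and G :: "'w \<Rightarrow> ('v, 'a::polish_space) mgraph"
  assumes G: "G \<in> M \<rightarrow>\<^sub>M mgraph_space"
begin

lemma measurable_verts [measurable (raw)]: "Measurable.pred M (\<lambda>x. v \<in> verts (G x))"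
proof -
  have "(\<lambda>x. fst ((\<lambda>v. v \<in> verts (G x)), inn (G x), mark (G x)) v) \<in> M \<rightarrow>\<^sub>M count_space UNIV"
    using measurable_compose[OF G measurable_mgraph_space_components] 
    by (intro measurable_compose[OF measurable_compose[OF _ measurable_fst] measurable_component_singleton]) auto
  then show ?thesis by simp
qed

lemma measurable_inn [measurable (raw)]: "(\<lambda>x. inn (G x) v r) \<in> M \<rightarrow>\<^sub>M count_space UNIV"
proof -
  have "(\<lambda>x. fst (snd ((\<lambda>v. v \<in> verts (G x)), inn (G x), mark (G x))) v) \<in> M \<rightarrow>\<^sub>M Pi\<^sub>M UNIV (\<lambda>_. count_space UNIV)"
    using measurable_compose[OF G measurable_mgraph_space_components] 
    by (intro measurable_compose[OF measurable_compose[OF measurable_compose[OF _ measurable_snd] 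
      measurable_fst] measurable_component_singleton]) auto
  then have "(\<lambda>x. inn (G x) v) \<in> M \<rightarrow>\<^sub>M Pi\<^sub>M UNIV (\<lambda>_. count_space UNIV)" by simp
  then show ?thesis by (rule measurable_compose[OF _ measurable_component_singleton]) simp
qed

lemma measurable_mark [measurable (raw)]: "(\<lambda>x. mark (G x) v) \<in> M \<rightarrow>\<^sub>M borel"
proof -
  have "(\<lambda>x. snd (snd ((\<lambda>v. v \<in> verts (G x)), inn (G x), mark (G x))) v) \<in> M \<rightarrow>\<^sub>M borel"
    using measurable_compose[OF G measurable_mgraph_space_components] 
    by (intro measurable_compose[OF measurable_compose[OF measurable_compose[OF _ measurable_snd] 
      measurable_snd] measurable_component_singleton]) auto
  then show ?thesis by simp
qed

end

lemma mark_projections: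
  "mdeg x = fst (snd (snd (snd x)))" "mweight x = snd (snd (snd (snd x)))"
  "mattr x = (fst x, fst (snd x), fst (snd (snd x)))"
  by (cases x; simp)+

lemma measurable_mdeg [measurable (raw)]:
  assumes "f \<in> M \<rightarrow>\<^sub>M (borel :: 'a::polish_space mark measure)"
  shows "(\<lambda>x. mdeg (f x)) \<in> M \<rightarrow>\<^sub>M count_space UNIV"
proof -
  have "(mdeg :: 'a mark \<Rightarrow> nat) \<in> borel \<rightarrow>\<^sub>M borel"
    unfolding mark_projections by (intro borel_measurable_continuous_onI continuous_intros)
  then show ?thesis
    using assms by (auto intro: measurable_compose simp: measurable_cong_sets[OF refl sets_borel_eq_count_space])
qed

lemma measurable_mweight [measurable (raw)]:
  assumes "f \<in> M \<rightarrow>\<^sub>M (borel :: 'a::polish_space mark measure)"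
  shows "(\<lambda>x. mweight (f x) j) \<in> M \<rightarrow>\<^sub>M borel"
proof -
  have "(\<lambda>m::'a mark. mweight m j) \<in> borel \<rightarrow>\<^sub>M borel"
    unfolding mark_projections
    by (rule borel_measurable_continuous_onI, rule continuous_on_product_then_coordinatewise) (intro continuous_intros)
  then show ?thesis using assms by (rule measurable_compose[rotated])
qed

lemma measurable_mattr [measurable (raw)]:
  assumes "f \<in> M \<rightarrow>\<^sub>M (borel :: 'a::polish_space mark measure)"
  shows "(\<lambda>x. mattr (f x)) \<in> M \<rightarrow>\<^sub>M borel"
proof -
  have "(mattr :: 'a mark \<Rightarrow> _) \<in> borel \<rightarrow>\<^sub>M borel"
    unfolding mark_projections by (intro borel_measurable_continuous_onI continuous_intros)
  then show ?thesis using assms by (rule measurable_compose[rotated])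
qed

lemma measurable_indeg [measurable (raw)]:
  assumes [measurable]: "G \<in> M \<rightarrow>\<^sub>M (mgraph_space :: ('v, 'a::polish_space) mgraph measure)"
  shows "(\<lambda>x. indeg (G x) v) \<in> M \<rightarrow>\<^sub>M count_space UNIV"
  unfolding indeg_def by measurable

lemma sets_mark_space [measurable]: "(mark_space :: 'a::polish_space mark set) \<in> sets borel"
proof -
  have "closed {w::nat \<Rightarrow> real. \<forall>j. w j \<in> {0..1}}"
    unfolding atLeastAtMost_iff
    by (intro closed_Collect_all closed_Collect_conj closed_Collect_le continuous_on_const
        continuous_on_product_coordinates)
  then show ?thesis
    unfolding mark_space_def by (intro borel_closed closed_Times) (auto intro: finite_imp_closed)
qed

lemma subalgebra_attr_algebra:
  assumes [measurable]: "G \<in> M \<rightarrow>\<^sub>M mgraph_space"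
  shows "subalgebra M (attr_algebra n M G)"
proof -
  have m: "(\<lambda>\<omega>. \<lambda>i\<in>{1..n}. mattr (mark (G \<omega>) i)) \<in> M \<rightarrow>\<^sub>M Pi\<^sub>M {1..n} (\<lambda>_. borel)" by measurable
  then show ?thesis
    unfolding subalgebra_def attr_algebra_def
    using measurable_sets[OF m] measurable_space[OF m] by (auto simp: sets_vimage_algebra2)
qed

lemma subalgebra_vimage_mgraph:
  assumes "G \<in> M \<rightarrow>\<^sub>M mgraph_space"
  shows "subalgebra M (vimage_algebra (space M) G mgraph_space)"
  unfolding subalgebra_def
  using measurable_sets[OF assms] by (auto simp: sets_vimage_algebra2)

text \<open>A countable type has only countably many finite subsets, so the random set can be
  treated as a discrete random variable. Infinite values are sent to {}, in agreement with the value
  of sums and products over infinite sets.\<close>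

lemma measurable_random_set:
  fixes A :: "'w \<Rightarrow> 'i::countable set"
  assumes A[measurable]: "\<And>i. Measurable.pred M (\<lambda>x. i \<in> A x)" and f: "\<And>S. finite S \<Longrightarrow> f S \<in> M \<rightarrow>\<^sub>M N"
  shows "(\<lambda>x. f (if finite (A x) then A x else {}) x) \<in> M \<rightarrow>\<^sub>M N"
proof (rule measurable_compose_countable'[where I="{S. finite S}" and g="\<lambda>x. if finite (A x) then A x else {}"])
  show cf: "countable {S::'i set. finite S}" by (rule countable_Collect_finite)
  have eq: "Measurable.pred M (\<lambda>x. A x = S)" for S
    unfolding set_eq_iff by measurable
  have "finite (A x) \<longleftrightarrow> (\<exists>xs. A x = set xs)" for x by (metis finite_list finite_set)
  then have fin: "Measurable.pred M (\<lambda>x. finite (A x))"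
    by (simp add: pred_intros_countable eq)
  show "(\<lambda>x. if finite (A x) then A x else {}) \<in> M \<rightarrow>\<^sub>M count_space {S. finite S}"
    unfolding measurable_count_space_eq_countable[OF cf]
  proof safe
    fix S :: "'i set" assume "finite S"
    have "Measurable.pred M (\<lambda>x. A x = S \<or> \<not> finite (A x) \<and> S = {})"
      by (intro pred_intros_logic eq fin) simp
    also have "(\<lambda>x. A x = S \<or> \<not> finite (A x) \<and> S = {}) = (\<lambda>x. (if finite (A x) then A x else {}) = S)"
      using \<open>finite S\<close> by auto
    finally have "{x\<in>space M. (if finite (A x) then A x else {}) = S} \<in> sets M" by measurable
    also have "{x\<in>space M. (if finite (A x) then A x else {}) = S} = (\<lambda>x. if finite (A x) then A x else {}) -` {S} \<inter> space M"
      by blast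
    finally show "(\<lambda>x. if finite (A x) then A x else {}) -` {S} \<inter> space M \<in> sets M" .
  qed auto
qed (use f in auto)

lemma measurable_sum_random_set:
  fixes f :: "'i::countable \<Rightarrow> 'w \<Rightarrow> real"
  assumes "\<And>i. Measurable.pred M (\<lambda>x. i \<in> A x)" "\<And>i. f i \<in> borel_measurable M"
  shows "(\<lambda>x. \<Sum>i\<in>A x. f i x) \<in> borel_measurable M"
proof -
  have "(\<Sum>i\<in>A x. f i x) = (\<Sum>i\<in>(if finite (A x) then A x else {}). f i x)" for x by simp
  then show ?thesis
    using measurable_random_set[OF assms(1), where f="\<lambda>S x. \<Sum>i\<in>S. f i x" and N=borel] assms(2) by simp
qed

lemma measurable_prod_random_set:
  fixes f :: "'i::countable \<Rightarrow> 'w \<Rightarrow> complex"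
  assumes "\<And>i. Measurable.pred M (\<lambda>x. i \<in> A x)" "\<And>i. f i \<in> borel_measurable M"
  shows "(\<lambda>x. \<Prod>i\<in>A x. f i x) \<in> borel_measurable M"
proof -
  have "(\<Prod>i\<in>A x. f i x) = (\<Prod>i\<in>(if finite (A x) then A x else {}). f i x)" for x by simp
  then show ?thesis
    using measurable_random_set[OF assms(1), where f="\<lambda>S x. \<Prod>i\<in>S. f i x" and N=borel] assms(2) by simp
qed

text \<open>The value is the Fourier integral at frequency 1 of the image of \<open>k x\<close>
  under multiplication by \<open>a x\<close>: this moves the parameter from the integrand into the
  kernel.\<close>

lemma measurable_char [measurable (raw)]:
  assumes k: "k \<in> M \<rightarrow>\<^sub>M prob_algebra borel" and a[measurable]: "a \<in> borel_measurable M"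
  shows "(\<lambda>x. char (k x) (a x)) \<in> borel_measurable M"
proof -
  have [measurable]: "k \<in> M \<rightarrow>\<^sub>M subprob_algebra borel" using k by (rule measurable_prob_algebraD)
  have "(\<lambda>x. distr (k x) borel (\<lambda>w. a x * w)) \<in> M \<rightarrow>\<^sub>M subprob_algebra borel"
    by (rule measurable_distr2) measurable
  then have "(\<lambda>x. \<integral>w. iexp w \<partial>distr (k x) borel (\<lambda>w. a x * w)) \<in> borel_measurable M"
    by (rule measurable_compose[OF _ integral_measurable_subprob_algebra]) measurable
  also have "(\<lambda>x. \<integral>w. iexp w \<partial>distr (k x) borel (\<lambda>w. a x * w)) \<in> borel_measurable M
    \<longleftrightarrow> (\<lambda>x. char (k x) (a x)) \<in> borel_measurable M"
  proof (rule measurable_cong)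
    fix x assume "x \<in> space M"
    then have s: "sets (k x) = sets borel" using measurable_space[OF k] by (auto simp: space_prob_algebra)
    have "(\<lambda>w. a x * w) \<in> k x \<rightarrow>\<^sub>M borel" by (simp add: measurable_cong_sets[OF s refl])
    then show "(\<integral>w. iexp w \<partial>distr (k x) borel (\<lambda>w. a x * w)) = char (k x) (a x)"
      unfolding char_def by (subst integral_distr) auto
  qed
  finally show ?thesis .
qed

text \<open>Marks of labels outside the vertex set are \<open>undefined\<close>, so the signal kernel is made total.\<close>

definition total_kernel :: "('a mark \<Rightarrow> real measure) \<Rightarrow> 'a mark \<Rightarrow> real measure" where
  "total_kernel \<nu> x = (if x \<in> mark_space then \<nu> x else return borel 0)"

lemma total_kernel_eq [simp]: "x \<in> mark_space \<Longrightarrow> total_kernel \<nu> x = \<nu> x"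
  by (simp add: total_kernel_def)

lemma measurable_total_kernel:
  fixes \<nu> :: "'a::polish_space mark \<Rightarrow> real measure"
  assumes "\<nu> \<in> restrict_space borel mark_space \<rightarrow>\<^sub>M prob_algebra borel"
  shows "total_kernel \<nu> \<in> borel \<rightarrow>\<^sub>M prob_algebra borel"
  unfolding total_kernel_def
proof (subst measurable_If_restrict_space_iff)
  have "return borel (0::real) \<in> space (prob_algebra borel)"
    by (simp add: space_prob_algebra prob_space_return)
  then show "\<nu> \<in> restrict_space borel {x. x \<in> mark_space} \<rightarrow>\<^sub>M prob_algebra borel \<and>
    (\<lambda>x. return borel 0) \<in> restrict_space borel {x. x \<notin> mark_space} \<rightarrow>\<^sub>M prob_algebra borel"
    using assms by simp
qed auto

lemma real_distribution_total_kernel: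
  fixes \<nu> :: "'a::polish_space mark \<Rightarrow> real measure"
  assumes "\<nu> \<in> restrict_space borel mark_space \<rightarrow>\<^sub>M prob_algebra borel"
  shows "real_distribution (total_kernel \<nu> x)"
proof -
  have "prob_space (total_kernel \<nu> x)" "sets (total_kernel \<nu> x) = sets borel"
    using measurable_space[OF measurable_total_kernel[OF assms], of x] by (auto simp: space_prob_algebra)
  then show ?thesis
    by (auto simp: real_distribution_def real_distribution_axioms_def dest: sets_eq_imp_space_eq)
qed

text \<open>The transpose of the matrix of the opinion process, see \<open>pull_back_adjoint\<close>.\<close>

definition pull_back :: "real \<Rightarrow> real \<Rightarrow> ('v, 'a) mgraph \<Rightarrow> ('v \<Rightarrow> real) \<Rightarrow> 'v \<Rightarrow> real" where
  "pull_back c d g v k = (1 - c - d) * v k +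
     (\<Sum>j\<in>verts g. \<Sum>r<indeg g j. mweight (mark g j) r * v j * of_bool (inn g j r = k))"

definition dual_vec :: "real \<Rightarrow> real \<Rightarrow> ('v, 'a) mgraph \<Rightarrow> real \<Rightarrow> 'v \<Rightarrow> nat \<Rightarrow> 'v \<Rightarrow> real" where
  "dual_vec c d g u i s = (pull_back c d g ^^ s) (\<lambda>k. u * of_bool (k = i))"

text \<open>The contribution of the last t rounds of signals, s counting rounds backwards from the
  present. Given the marks, signals of different rounds are independent with the same laws, so the
  reversed numbering is invisible in law and matches the index s of the series.\<close>

definition graph_char ::
  "real \<Rightarrow> real \<Rightarrow> ('a mark \<Rightarrow> real measure) \<Rightarrow> real \<Rightarrow> nat \<Rightarrow> ('v, 'a) mgraph \<Rightarrow> 'v \<Rightarrow> complex" where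
  "graph_char c d \<nu> u t g i = (\<Prod>s<t. \<Prod>j\<in>verts g. char (\<nu> (mark g j)) (dual_vec c d g u i s j))"

definition depth_verts :: "(nat list, 'a) mgraph \<Rightarrow> nat \<Rightarrow> nat list set" where
  "depth_verts g k = {x \<in> verts g. length x \<le> k}"

text \<open>All s share the node set of depth t. A node deeper than s has \<open>acoef\<close> 0 and
  contributes a characteristic function at 0, which is 1.\<close>

definition tree_char ::
  "real \<Rightarrow> real \<Rightarrow> ('a mark \<Rightarrow> real measure) \<Rightarrow> real \<Rightarrow> nat \<Rightarrow> (nat list, 'a) mgraph \<Rightarrow> complex" where
  "tree_char c d \<nu> u t g =
     (\<Prod>s<t. \<Prod>x\<in>depth_verts g t. char (\<nu> (mark g x)) (u * path_weight g x * acoef c d (length x) s))"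

lemma dual_vec_Suc: "dual_vec c d g u i (Suc s) = pull_back c d g (dual_vec c d g u i s)"
  by (simp add: dual_vec_def)

lemma measurable_dual_vec [measurable]:
  "(\<lambda>g. dual_vec c d g u i s k) \<in> borel_measurable (mgraph_space :: ('v::countable, 'a::polish_space) mgraph measure)"
proof (induction s arbitrary: k)
  case (Suc s)
  note [measurable] = Suc
  show ?case unfolding dual_vec_Suc pull_back_def
    by (intro borel_measurable_add measurable_sum_random_set) measurable
qed (simp add: dual_vec_def)

lemma measurable_graph_char [measurable]:
  assumes "\<nu> \<in> restrict_space borel mark_space \<rightarrow>\<^sub>M prob_algebra borel"
  shows "(\<lambda>g. graph_char c d (total_kernel \<nu>) u t g i)
    \<in> borel_measurable (mgraph_space :: ('v::countable, 'a::polish_space) mgraph measure)"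
  unfolding graph_char_def
  by (intro borel_measurable_prod measurable_prod_random_set measurable_char
      measurable_compose[OF _ measurable_total_kernel[OF assms]]) measurable

lemma measurable_path_weight [measurable (raw)]:
  assumes [measurable]: "G \<in> M \<rightarrow>\<^sub>M (mgraph_space :: (nat list, 'a::polish_space) mgraph measure)"
  shows "(\<lambda>x. path_weight (G x) i) \<in> borel_measurable M"
  unfolding path_weight_def by measurable

lemma measurable_tree_char [measurable]:
  fixes \<nu> :: "'a::polish_space mark \<Rightarrow> real measure"
  assumes "\<nu> \<in> restrict_space borel mark_space \<rightarrow>\<^sub>M prob_algebra borel"
  shows "tree_char c d (total_kernel \<nu>) u t \<in> borel_measurable mgraph_space"
  unfolding tree_char_def depth_verts_def
  by (intro borel_measurable_prod measurable_prod_random_set measurable_char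
      measurable_compose[OF _ measurable_total_kernel[OF assms]]) measurable

lemma measurable_opinion_term:
  fixes \<G> :: "'t \<Rightarrow> (nat list, 'a::polish_space) mgraph"
  assumes [measurable]: "\<G> \<in> T \<rightarrow>\<^sub>M mgraph_space" "\<And>j. W j s \<in> borel_measurable T"
  shows "(\<lambda>\<omega>. opinion_term c d (\<G> \<omega>) (\<lambda>j s. W j s \<omega>) s) \<in> borel_measurable T"
  unfolding opinion_term_def
  by (intro borel_measurable_sum measurable_sum_random_set) measurable

section \<open>Stationary opinions and characteristic functions\<close>

lemma norm_iexp_diff_le: "norm (iexp x - iexp y) \<le> \<bar>x - y\<bar>"
proof -
  have *: "norm (iexp t - 1) \<le> \<bar>t\<bar>" for t
    using iexp_approx1[of t 0] by simp
  have "iexp x - iexp y = iexp y * (iexp (x - y) - 1)"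
    by (simp add: right_diff_distrib mult_exp_exp)
  then have "norm (iexp x - iexp y) = norm (iexp (x - y) - 1)"
    by (simp add: norm_mult)
  then show ?thesis using *[of "x - y"] by simp
qed

lemma integral_bind_complex:
  fixes f :: "'b \<Rightarrow> complex"
  assumes f[measurable]: "f \<in> borel_measurable K" and B: "\<And>x. norm (f x) \<le> B"
    and N: "N \<in> M \<rightarrow>\<^sub>M subprob_algebra K" and M: "finite_measure M"
  shows "(\<integral>x. f x \<partial>(M \<bind> N)) = (\<integral>x. (\<integral>y. f y \<partial>N x) \<partial>M)"
proof -
  interpret finite_measure M by fact
  have subN: "AE x in M. emeasure (N x) (space (N x)) \<le> ennreal 1"
    using subprob_space_kernel[OF N] by (intro AE_I2) (simp add: subprob_space.emeasure_space_le_1)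
  have Re: "\<bar>Re (f x)\<bar> \<le> B" and Im: "\<bar>Im (f x)\<bar> \<le> B" for x
    using B[of x] abs_Re_le_cmod[of "f x"] abs_Im_le_cmod[of "f x"] by linarith+
  have iN: "integrable (N x) f" "norm (\<integral>y. f y \<partial>N x) \<le> B" if x: "x \<in> space M" for x
  proof -
    interpret subprob_space "N x" by (rule subprob_space_kernel[OF N x])
    show i: "integrable (N x) f"
      using B f by (intro integrable_const_bound[where B=B])
        (auto simp: measurable_cong_sets[OF sets_kernel[OF N x] refl])
    have "0 \<le> B" using B[of undefined] norm_ge_zero order_trans by blast
    have "norm (\<integral>y. f y \<partial>N x) \<le> (\<integral>y. norm (f y) \<partial>N x)" by (rule integral_norm_bound)
    also have "\<dots> \<le> (\<integral>y. B \<partial>N x)" using i B by (intro integral_mono) auto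
    also have "\<dots> \<le> B" using subprob_measure_le_1[of "space (N x)"] \<open>0 \<le> B\<close> 
      by (simp add: mult_left_le_one_le)
    finally show "norm (\<integral>y. f y \<partial>N x) \<le> B" .
  qed
  have g: "integrable M (\<lambda>x. \<integral>y. f y \<partial>N x)"
    using iN by (intro integrable_const_bound[where B=B] AE_I2 measurable_compose[OF N integral_measurable_subprob_algebra]) auto
  have ib: "integrable (M \<bind> N) f"
  proof -
    have "integrable (M \<bind> N) (\<lambda>x. Re (f x))" "integrable (M \<bind> N) (\<lambda>x. Im (f x))"
      by (rule integrable_bind[OF _ _ N M subN, where B=B]; use Re Im in simp)+
    then have "integrable (M \<bind> N) (\<lambda>x. of_real (Re (f x)) + \<i> * of_real (Im (f x)))"
      by (intro Bochner_Integration.integrable_add integrable_mult_right integrable_of_real)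
    then show ?thesis by (simp add: complex_eq[symmetric])
  qed
  have part: "h (\<integral>x. f x \<partial>(M \<bind> N)) = h (\<integral>x. (\<integral>y. f y \<partial>N x) \<partial>M)"
    if h: "bounded_linear h" "\<And>x. \<bar>h (f x)\<bar> \<le> B" for h :: "complex \<Rightarrow> real"
  proof -
    have [measurable]: "h \<in> borel_measurable borel"
      by (intro borel_measurable_continuous_onI linear_continuous_on h)
    have "h (\<integral>x. f x \<partial>(M \<bind> N)) = (\<integral>x. h (f x) \<partial>(M \<bind> N))"
      by (rule integral_bounded_linear[OF h(1) ib, symmetric])
    also have "\<dots> = (\<integral>x. (\<integral>y. h (f y) \<partial>N x) \<partial>M)"
      by (rule integral_bind[OF _ h(2) N M subN]) measurable
    also have "\<dots> = (\<integral>x. h (\<integral>y. f y \<partial>N x) \<partial>M)"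
      by (intro Bochner_Integration.integral_cong refl integral_bounded_linear[OF h(1)] iN)
    also have "\<dots> = h (\<integral>x. (\<integral>y. f y \<partial>N x) \<partial>M)" by (rule integral_bounded_linear[OF h(1) g])
    finally show ?thesis .
  qed
  show ?thesis
    using part[OF bounded_linear_Re Re] part[OF bounded_linear_Im Im] by (simp add: complex_eq_iff)
qed

lemma norm_prod_char_le:
  assumes "\<And>i. i \<in> A \<Longrightarrow> real_distribution (\<mu> i)"
  shows "norm (\<Prod>i\<in>A. char (\<mu> i) (x i)) \<le> 1"
  unfolding prod_norm[symmetric]
  by (intro prod_le_1 conjI norm_ge_zero real_distribution.cmod_char_le_1 assms)

text \<open>Row sums are bounded by c instead of being equal to it, since a vertex without inbound
  edges has row sum 0.\<close>

definition substochastic_graph :: "real \<Rightarrow> ('v, 'a) mgraph \<Rightarrow> bool" where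
  "substochastic_graph c g \<longleftrightarrow>
     (\<forall>i\<in>verts g. mark g i \<in> mark_space \<and> (\<forall>r<indeg g i. inn g i r \<in> verts g) \<and>
        (\<Sum>r<indeg g i. mweight (mark g i) r) \<le> c)"

lemma mark_space_mweight: "x \<in> mark_space \<Longrightarrow> 0 \<le> mweight x r"
  by (cases x) (auto simp: mark_space_def)

lemma norm_graph_char_le:
  assumes "\<And>j. j \<in> verts g \<Longrightarrow> real_distribution (\<nu> (mark g j))"
  shows "norm (graph_char c d \<nu> u t g i) \<le> 1"
  unfolding graph_char_def prod_norm[symmetric]
  by (intro prod_le_1 conjI prod_nonneg ballI norm_ge_zero real_distribution.cmod_char_le_1 assms)

lemma norm_tree_char_le:
  assumes "\<And>x. real_distribution (\<nu> x)"
  shows "norm (tree_char c d \<nu> u t g) \<le> 1"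
  unfolding tree_char_def prod_norm[symmetric]
  by (intro prod_le_1 conjI prod_nonneg ballI norm_ge_zero real_distribution.cmod_char_le_1 assms)

text \<open>The double sum over heads j and edge numbers r is regrouped by the tail k; as
  \<open>inn\<close> stays inside \<open>verts g\<close>, every tail occurs among the k.\<close>

lemma pull_back_adjoint:
  assumes fin: "finite (verts g)" and g: "substochastic_graph c' g"
  shows "(\<Sum>j\<in>verts g. v j * opinion_update c d g x w j)
    = (\<Sum>k\<in>verts g. pull_back c d g v k * x k) + (\<Sum>j\<in>verts g. v j * w j)"
proof -
  let ?V = "verts g"
  let ?m = "\<lambda>j r. mweight (mark g j) r"
  have "(\<Sum>k\<in>?V. (\<Sum>j\<in>?V. \<Sum>r<indeg g j. ?m j r * v j * of_bool (inn g j r = k)) * x k)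
     = (\<Sum>k\<in>?V. \<Sum>j\<in>?V. \<Sum>r<indeg g j. ?m j r * v j * (of_bool (inn g j r = k) * x k))"
    by (simp add: sum_distrib_right mult.assoc)
  also have "\<dots> = (\<Sum>j\<in>?V. \<Sum>k\<in>?V. \<Sum>r<indeg g j. ?m j r * v j * (of_bool (inn g j r = k) * x k))"
    by (rule sum.swap)
  also have "\<dots> = (\<Sum>j\<in>?V. \<Sum>r<indeg g j. \<Sum>k\<in>?V. ?m j r * v j * (of_bool (inn g j r = k) * x k))"
    by (intro sum.cong refl sum.swap)
  also have "\<dots> = (\<Sum>j\<in>?V. \<Sum>r<indeg g j. ?m j r * v j * x (inn g j r))"
  proof (intro sum.cong refl)
    fix j r assume j: "j \<in> ?V" "r \<in> {..<indeg g j}"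
    then have "inn g j r \<in> ?V" using g by (auto simp: substochastic_graph_def)
    then have "(\<Sum>k\<in>?V. of_bool (inn g j r = k) * x k) = x (inn g j r)"
      using fin sum.delta'[of ?V "inn g j r" x] by (simp add: of_bool_def if_distrib[of "\<lambda>a. a * _"] cong: if_cong)
    then show "(\<Sum>k\<in>?V. ?m j r * v j * (of_bool (inn g j r = k) * x k)) = ?m j r * v j * x (inn g j r)"
      by (simp add: sum_distrib_left[symmetric])
  qed
  finally have 1: "(\<Sum>k\<in>?V. (\<Sum>j\<in>?V. \<Sum>r<indeg g j. ?m j r * v j * of_bool (inn g j r = k)) * x k)
    = (\<Sum>j\<in>?V. \<Sum>r<indeg g j. ?m j r * v j * x (inn g j r))" .
  have "(\<Sum>j\<in>?V. v j * opinion_update c d g x w j)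
      = (\<Sum>j\<in>?V. (\<Sum>r<indeg g j. ?m j r * v j * x (inn g j r)) + v j * w j + (1 - c - d) * v j * x j)"
    by (intro sum.cong refl) (simp add: opinion_update_def algebra_simps sum_distrib_left)
  then show ?thesis
    unfolding pull_back_def by (simp only: distrib_right sum.distrib 1)
qed

text \<open>The mass |v j| at a vertex goes to j itself, with factor 1 - c - d, and to the tails of
  its inbound edges, with total factor at most c; together 1 - d. All factors are nonnegative, so
  absolute values pass into the sums.\<close>

lemma pull_back_contracts:
  assumes fin: "finite (verts g)" and g: "substochastic_graph c g" and cd: "c + d \<le> 1"
  shows "(\<Sum>k\<in>verts g. \<bar>pull_back c d g v k\<bar>) \<le> (1 - d) * (\<Sum>k\<in>verts g. \<bar>v k\<bar>)"
proof -
  let ?V = "verts g"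
  let ?m = "\<lambda>j r. mweight (mark g j) r"
  have m0: "0 \<le> ?m j r" if "j \<in> ?V" for j r
    using g that by (auto simp: substochastic_graph_def intro: mark_space_mweight)
  have "(\<Sum>k\<in>?V. \<bar>pull_back c d g v k\<bar>)
     \<le> (\<Sum>k\<in>?V. (1 - c - d) * \<bar>v k\<bar> + (\<Sum>j\<in>?V. \<Sum>r<indeg g j. ?m j r * \<bar>v j\<bar> * of_bool (inn g j r = k)))"
  proof (rule sum_mono)
    fix k
    have "\<bar>pull_back c d g v k\<bar> \<le> \<bar>(1 - c - d) * v k\<bar> + \<bar>\<Sum>j\<in>?V. \<Sum>r<indeg g j. ?m j r * v j * of_bool (inn g j r = k)\<bar>"
      unfolding pull_back_def by (rule abs_triangle_ineq)
    also have "\<bar>\<Sum>j\<in>?V. \<Sum>r<indeg g j. ?m j r * v j * of_bool (inn g j r = k)\<bar>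
      \<le> (\<Sum>j\<in>?V. \<bar>\<Sum>r<indeg g j. ?m j r * v j * of_bool (inn g j r = k)\<bar>)" by (rule sum_abs)
    also have "\<dots> \<le> (\<Sum>j\<in>?V. \<Sum>r<indeg g j. \<bar>?m j r * v j * of_bool (inn g j r = k)\<bar>)"
      by (intro sum_mono sum_abs)
    also have "\<dots> = (\<Sum>j\<in>?V. \<Sum>r<indeg g j. ?m j r * \<bar>v j\<bar> * of_bool (inn g j r = k))"
      by (intro sum.cong refl) (simp add: abs_mult m0)
    finally show "\<bar>pull_back c d g v k\<bar>
      \<le> (1 - c - d) * \<bar>v k\<bar> + (\<Sum>j\<in>?V. \<Sum>r<indeg g j. ?m j r * \<bar>v j\<bar> * of_bool (inn g j r = k))"
      using cd by (simp add: abs_mult)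
  qed
  also have "\<dots> = (1 - c - d) * (\<Sum>k\<in>?V. \<bar>v k\<bar>) +
      (\<Sum>k\<in>?V. \<Sum>j\<in>?V. \<Sum>r<indeg g j. ?m j r * \<bar>v j\<bar> * of_bool (inn g j r = k))"
    by (simp add: sum.distrib sum_distrib_left)
  also have "(\<Sum>k\<in>?V. \<Sum>j\<in>?V. \<Sum>r<indeg g j. ?m j r * \<bar>v j\<bar> * of_bool (inn g j r = k))
    = (\<Sum>j\<in>?V. \<Sum>k\<in>?V. \<Sum>r<indeg g j. ?m j r * \<bar>v j\<bar> * of_bool (inn g j r = k))"
    by (rule sum.swap)
  also have "\<dots> = (\<Sum>j\<in>?V. \<Sum>r<indeg g j. \<Sum>k\<in>?V. ?m j r * \<bar>v j\<bar> * of_bool (inn g j r = k))"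
    by (intro sum.cong refl sum.swap)
  also have "\<dots> \<le> (\<Sum>j\<in>?V. \<Sum>r<indeg g j. ?m j r * \<bar>v j\<bar>)"
  proof (intro sum_mono)
    fix j r assume j: "j \<in> ?V"
    have "(\<Sum>k\<in>?V. of_bool (inn g j r = k) :: real) \<le> 1"
      using fin sum.delta'[of ?V "inn g j r" "\<lambda>_. 1::real"] by (simp add: of_bool_def)
    then have "(?m j r * \<bar>v j\<bar>) * (\<Sum>k\<in>?V. of_bool (inn g j r = k)) \<le> (?m j r * \<bar>v j\<bar>) * 1"
      using m0[OF j] by (intro mult_left_mono) auto
    then show "(\<Sum>k\<in>?V. ?m j r * \<bar>v j\<bar> * of_bool (inn g j r = k)) \<le> ?m j r * \<bar>v j\<bar>"
      by (simp add: sum_distrib_left)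
  qed
  also have "\<dots> = (\<Sum>j\<in>?V. (\<Sum>r<indeg g j. ?m j r) * \<bar>v j\<bar>)"
    by (simp add: sum_distrib_right)
  also have "\<dots> \<le> (\<Sum>j\<in>?V. c * \<bar>v j\<bar>)"
    using g by (intro sum_mono mult_right_mono) (auto simp: substochastic_graph_def)
  finally show ?thesis by (simp add: sum_distrib_left[symmetric] algebra_simps)
qed

lemma dual_vec_bound:
  assumes "finite (verts g)" "substochastic_graph c g" "c + d \<le> 1" "d \<le> 1"
  shows "(\<Sum>k\<in>verts g. \<bar>dual_vec c d g u i s k\<bar>) \<le> \<bar>u\<bar> * (1 - d) ^ s"
proof (induction s)
  case 0
  have "(\<Sum>k\<in>verts g. \<bar>u * of_bool (k = i)\<bar>) = (\<Sum>k\<in>verts g. if k = i then \<bar>u\<bar> else 0)"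
    by (intro sum.cong) auto
  then show ?case using assms(1) by (simp add: dual_vec_def)
next
  case (Suc s)
  have "(\<Sum>k\<in>verts g. \<bar>dual_vec c d g u i (Suc s) k\<bar>) \<le> (1 - d) * (\<Sum>k\<in>verts g. \<bar>dual_vec c d g u i s k\<bar>)"
    unfolding dual_vec_Suc by (rule pull_back_contracts[OF assms(1-3)])
  also have "\<dots> \<le> (1 - d) * (\<bar>u\<bar> * (1 - d) ^ s)" using Suc assms by (intro mult_left_mono) auto
  finally show ?case by (simp add: mult_ac)
qed

section \<open>Iterating stationarity on a fixed finite graph\<close>

context
  fixes c d :: real and \<nu> :: "'a mark \<Rightarrow> real measure" and g :: "('v, 'a) mgraph" and \<mu> :: "('v \<Rightarrow> real) measure"
  assumes fin: "finite (verts g)" and g: "substochastic_graph c g"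
    and \<nu>: "\<And>j. j \<in> verts g \<Longrightarrow> real_distribution (\<nu> (mark g j))"
    and \<mu>: "stationary_opinion_law c d \<nu> g \<mu>"
begin

text \<open>One application of stationarity: given the current opinions x, the next vector is affine
  in independent signals, so its Fourier transform is a phase depending on x times a product that
  does not depend on x.\<close>

lemma stationary_char_step:
  "(\<integral>x. iexp (\<Sum>j\<in>verts g. v j * x j) \<partial>\<mu>) =
     (\<integral>x. iexp (\<Sum>k\<in>verts g. pull_back c d g v k * x k) \<partial>\<mu>) * (\<Prod>j\<in>verts g. char (\<nu> (mark g j)) (v j))"
proof -
  let ?V = "verts g"
  let ?P = "Pi\<^sub>M ?V (\<lambda>_. borel :: real measure)"
  \<comment> \<open>A family of probability measures over all indices, as the locale for product
    spaces demands; it agrees with the signal laws on \<open>?V\<close>.\<close>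
  define k where "k j = (if j \<in> ?V then \<nu> (mark g j) else return borel 0)" for j
  have k: "prob_space (k j)" "sets (k j) = sets borel" for j
    using \<nu>[of j] by (auto simp: k_def real_distribution_def real_distribution_axioms_def prob_space_return)
  let ?Q = "Pi\<^sub>M ?V (\<lambda>j. \<nu> (mark g j))"
  have Q: "?Q = Pi\<^sub>M ?V k" by (rule PiM_cong) (auto simp: k_def)
  have sQ: "sets ?Q = sets ?P" unfolding Q by (intro sets_PiM_cong k refl)
  interpret product_prob_space k ?V by (intro product_prob_spaceI k)
  interpret \<mu>: prob_space \<mu> using \<mu> by (simp add: stationary_opinion_law_def)
  interpret Q: prob_space ?Q unfolding Q by (rule prob_space_PiM) (rule k)
  have s\<mu>: "sets \<mu> = sets ?P" using \<mu> by (simp add: stationary_opinion_law_def)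
  note [measurable_cong] = s\<mu>
  have up: "case_prod (opinion_update c d g) \<in> ?P \<Otimes>\<^sub>M ?P \<rightarrow>\<^sub>M ?P"
  proof -
    have "(\<lambda>z. \<lambda>i\<in>?V. (\<Sum>r<indeg g i. mweight (mark g i) r * fst z (inn g i r)) + snd z i + (1 - c - d) * fst z i)
      \<in> ?P \<Otimes>\<^sub>M ?P \<rightarrow>\<^sub>M ?P"
    proof (rule measurable_restrict)
      fix i assume i: "i \<in> ?V"
      have comp: "(\<lambda>z. fst z j) \<in> borel_measurable (?P \<Otimes>\<^sub>M ?P)" "(\<lambda>z. snd z j) \<in> borel_measurable (?P \<Otimes>\<^sub>M ?P)"
        if "j \<in> ?V" for j
        using that by measurable
      show "(\<lambda>z. (\<Sum>r<indeg g i. mweight (mark g i) r * fst z (inn g i r)) + snd z i + (1 - c - d) * fst z i)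
        \<in> borel_measurable (?P \<Otimes>\<^sub>M ?P)"
        using i g by (intro borel_measurable_add borel_measurable_sum borel_measurable_times comp borel_measurable_const)
          (auto simp: substochastic_graph_def)
    qed
    then show ?thesis by (simp add: opinion_update_def case_prod_beta')
  qed
  have kern: "opinion_kernel c d \<nu> g \<in> \<mu> \<rightarrow>\<^sub>M subprob_algebra ?P"
    unfolding opinion_kernel_def
  proof (rule measurable_distr2[where M="?P"])
    show "case_prod (opinion_update c d g) \<in> \<mu> \<Otimes>\<^sub>M ?P \<rightarrow>\<^sub>M ?P"
      using up by (simp add: measurable_cong_sets[OF sets_pair_measure_cong[OF s\<mu> refl] refl])
    show "(\<lambda>x. ?Q) \<in> \<mu> \<rightarrow>\<^sub>M subprob_algebra ?P"
      by (rule measurable_const) (use sQ in \<open>auto simp: space_subprob_algebra intro: prob_space_imp_subprob_space Q.prob_space_axioms\<close>)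
  qed
  let ?f = "\<lambda>x. iexp (\<Sum>j\<in>?V. v j * x j)"
  have f: "?f \<in> borel_measurable ?P" by measurable
  have "(\<integral>x. ?f x \<partial>\<mu>) = (\<integral>x. ?f x \<partial>(\<mu> \<bind> opinion_kernel c d \<nu> g))"
    using \<mu> by (simp add: stationary_opinion_law_def)
  also have "\<dots> = (\<integral>x. (\<integral>y. ?f y \<partial>opinion_kernel c d \<nu> g x) \<partial>\<mu>)"
    by (rule integral_bind_complex[OF f _ kern, where B=1]) (auto intro: \<mu>.finite_measure_axioms)
  also have "\<dots> = (\<integral>x. iexp (\<Sum>k\<in>?V. pull_back c d g v k * x k) * (\<Prod>j\<in>?V. char (\<nu> (mark g j)) (v j)) \<partial>\<mu>)"
  proof (rule Bochner_Integration.integral_cong[OF refl])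
    fix x assume "x \<in> space \<mu>"
    then have x: "x \<in> space ?P" using sets_eq_imp_space_eq[OF s\<mu>] by simp
    have "opinion_update c d g x \<in> ?P \<rightarrow>\<^sub>M ?P" using measurable_Pair2[OF up x] by simp
    then have "opinion_update c d g x \<in> ?Q \<rightarrow>\<^sub>M ?P" by (simp add: measurable_cong_sets[OF sQ refl])
    then have "(\<integral>y. ?f y \<partial>opinion_kernel c d \<nu> g x) = (\<integral>w. ?f (opinion_update c d g x w) \<partial>?Q)"
      unfolding opinion_kernel_def by (rule integral_distr[OF _ f])
    also have "\<dots> = (\<integral>w. iexp (\<Sum>k\<in>?V. pull_back c d g v k * x k) * (\<Prod>j\<in>?V. iexp (v j * w j)) \<partial>?Q)"
      by (simp only: pull_back_adjoint[OF fin g] of_real_add of_real_sum distrib_left exp_add sum_distrib_left exp_sum[OF fin])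
    also have "\<dots> = iexp (\<Sum>k\<in>?V. pull_back c d g v k * x k) * (\<integral>w. (\<Prod>j\<in>?V. iexp (v j * w j)) \<partial>Pi\<^sub>M ?V k)"
      unfolding Q by (rule integral_mult_right_zero)
    also have "(\<integral>w. (\<Prod>j\<in>?V. iexp (v j * w j)) \<partial>Pi\<^sub>M ?V k) = (\<Prod>j\<in>?V. \<integral>w. iexp (v j * w) \<partial>k j)"
    proof (rule product_integral_prod[OF fin])
      fix j
      show "integrable (k j) (\<lambda>w. iexp (v j * w))"
        by (rule M.integrable_const_bound[where B=1]) (auto simp: measurable_cong_sets[OF k(2) refl])
    qed
    also have "\<dots> = (\<Prod>j\<in>?V. char (\<nu> (mark g j)) (v j))"
      by (intro prod.cong refl) (simp add: k_def char_def)
    finally show "(\<integral>y. ?f y \<partial>opinion_kernel c d \<nu> g x) =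
      iexp (\<Sum>k\<in>?V. pull_back c d g v k * x k) * (\<Prod>j\<in>?V. char (\<nu> (mark g j)) (v j))" .
  qed
  also have "\<dots> = (\<integral>x. iexp (\<Sum>k\<in>?V. pull_back c d g v k * x k) \<partial>\<mu>) * (\<Prod>j\<in>?V. char (\<nu> (mark g j)) (v j))"
    by (rule integral_mult_left_zero)
  finally show ?thesis .
qed

lemma stationary_char_iterate:
  "(\<integral>x. iexp (\<Sum>j\<in>verts g. dual_vec c d g u i 0 j * x j) \<partial>\<mu>) =
     (\<integral>x. iexp (\<Sum>k\<in>verts g. dual_vec c d g u i t k * x k) \<partial>\<mu>) * graph_char c d \<nu> u t g i"
proof (induction t)
  case (Suc t)
  then show ?case
    unfolding stationary_char_step[of "dual_vec c d g u i t"] dual_vec_Suc graph_char_def by simp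
qed (simp add: graph_char_def)

text \<open>The signals of t rounds factor out. What is left is the transform of the opinions at
  \<open>dual_vec c d g u i t\<close>; it is near 1 because opinions are bounded by 1 and this
  vector has small 1-norm.\<close>

lemma stationary_char_approx:
  assumes cd: "c + d \<le> 1" "d \<le> 1" and i: "i \<in> verts g"
  shows "norm ((\<integral>x. iexp (u * x i) \<partial>\<mu>) - graph_char c d \<nu> u t g i) \<le> \<bar>u\<bar> * (1 - d) ^ t"
proof -
  let ?V = "verts g"
  let ?v = "dual_vec c d g u i t"
  let ?f = "\<lambda>x. iexp (\<Sum>k\<in>?V. ?v k * x k)"
  interpret \<mu>: prob_space \<mu> using \<mu> by (simp add: stationary_opinion_law_def)
  have s\<mu>: "sets \<mu> = sets (Pi\<^sub>M ?V (\<lambda>_. borel :: real measure))" using \<mu> by (simp add: stationary_opinion_law_def)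
  note [measurable_cong] = s\<mu>
  have f: "integrable \<mu> ?f" by (rule \<mu>.integrable_const_bound[where B=1]) auto
  have "(\<Sum>j\<in>?V. dual_vec c d g u i 0 j * x j) = u * x i" for x :: "'v \<Rightarrow> real"
  proof -
    have "(\<Sum>j\<in>?V. dual_vec c d g u i 0 j * x j) = (\<Sum>j\<in>?V. if j = i then u * x j else 0)"
      by (intro sum.cong) (auto simp: dual_vec_def)
    then show ?thesis using fin i by simp
  qed
  then have "(\<integral>x. iexp (u * x i) \<partial>\<mu>) - graph_char c d \<nu> u t g i = (\<integral>x. ?f x - 1 \<partial>\<mu>) * graph_char c d \<nu> u t g i"
    using stationary_char_iterate[of u i t] f by (simp add: left_diff_distrib \<mu>.prob_space)
  then have "norm ((\<integral>x. iexp (u * x i) \<partial>\<mu>) - graph_char c d \<nu> u t g i) \<le> norm (\<integral>x. ?f x - 1 \<partial>\<mu>)"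
    using norm_graph_char_le[of g \<nu> c d u t i, OF \<nu>] by (simp add: norm_mult mult_left_le)
  also have "\<dots> \<le> (\<integral>x. norm (?f x - 1) \<partial>\<mu>)" by (rule integral_norm_bound)
  also have "\<dots> \<le> (\<integral>x. \<bar>u\<bar> * (1 - d) ^ t \<partial>\<mu>)"
  proof (rule integral_mono_AE)
    have "AE x in \<mu>. \<forall>i\<in>?V. x i \<in> {-1..1}" using \<mu> by (simp add: stationary_opinion_law_def)
    then show "AE x in \<mu>. norm (?f x - 1) \<le> \<bar>u\<bar> * (1 - d) ^ t"
    proof eventually_elim
      case (elim x)
      have "norm (?f x - 1) \<le> \<bar>\<Sum>k\<in>?V. ?v k * x k\<bar>"
        using norm_iexp_diff_le[of "\<Sum>k\<in>?V. ?v k * x k" 0] by simp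
      also have "\<dots> \<le> (\<Sum>k\<in>?V. \<bar>?v k * x k\<bar>)" by (rule sum_abs)
      also have "\<dots> \<le> (\<Sum>k\<in>?V. \<bar>?v k\<bar>)"
        using elim by (intro sum_mono) (auto simp: abs_mult abs_le_iff intro!: mult_left_le)
      also have "\<dots> \<le> \<bar>u\<bar> * (1 - d) ^ t" by (rule dual_vec_bound[OF fin g cd])
      finally show ?case .
    qed
    show "integrable \<mu> (\<lambda>x. norm (?f x - 1))"
      using f by (intro integrable_norm Bochner_Integration.integrable_diff) auto
  qed auto
  finally show ?thesis by (simp add: \<mu>.prob_space)
qed

end

section \<open>Trees and their embeddings into graphs\<close>

text \<open>In-degrees are integers, so a distance below 1 forces them to agree. The weight
  differences are then terms of the series in \<open>mark_dist\<close>, which has only finitely many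
  nonzero terms.\<close>

lemma mark_dist_weights:
  fixes x y :: "'a::metric_space mark"
  assumes "mark_dist x y < 1"
  shows "mdeg x = mdeg y" "(\<Sum>j<mdeg y. \<bar>mweight x j - mweight y j\<bar>) \<le> mark_dist x y"
proof -
  obtain a q s m w where x: "x = (a, q, s, m, w)" by (cases x)
  obtain a' q' s' m' w' where y: "y = (a', q', s', m', w')" by (cases y)
  let ?h = "\<lambda>j. \<bar>w j * of_bool (j < m) - w' j * of_bool (j < m')\<bar>"
  have sm: "summable ?h" by (rule summable_finite[of "{..<max m m'}"]) auto
  have d0: "0 \<le> dist a a'" by simp
  have h0: "0 \<le> suminf ?h" by (rule suminf_nonneg[OF sm]) simp
  have "\<bar>real m - real m'\<bar> < 1" using assms h0 d0 unfolding x y mark_dist.simps by linarith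
  then have m: "m = m'" by linarith
  then show "mdeg x = mdeg y" by (simp add: x y)
  have "(\<Sum>j<m'. ?h j) \<le> suminf ?h" by (rule sum_le_suminf[OF sm]) auto
  moreover have "(\<Sum>j<m'. ?h j) = (\<Sum>j<m'. \<bar>w j - w' j\<bar>)" by (intro sum.cong) (auto simp: m)
  ultimately show "(\<Sum>j<mdeg y. \<bar>mweight x j - mweight y j\<bar>) \<le> mark_dist x y"
    using d0 unfolding x y mark_dist.simps mdeg.simps mweight.simps by linarith
qed

section \<open>The binomial coefficients of the series\<close>

lemma acoef_nonneg: "c + d \<le> 1 \<Longrightarrow> 0 \<le> acoef c d l s"
  by (simp add: acoef_def)

lemma acoef_eq_0 [simp]: "s < l \<Longrightarrow> acoef c d l s = 0"
  by (simp add: acoef_def)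

lemma acoef_0_Suc: "acoef c d 0 (Suc s) = (1 - c - d) * acoef c d 0 s"
  by (simp add: acoef_def)

text \<open>Pascal's rule, read as a walk that at each step either stays, with factor 1 - c - d, or
  moves one edge further; the weight of that edge is kept in the path weight, hence the coefficient
  1.\<close>

lemma acoef_Suc_Suc: "acoef c d (Suc l) (Suc s) = (1 - c - d) * acoef c d (Suc l) s + acoef c d l s"
proof (cases "l < s")
  case True
  then have "s - l = Suc (s - Suc l)" by simp
  then show ?thesis by (simp add: acoef_def algebra_simps)
qed (auto simp: acoef_def binomial_eq_0)

text \<open>The binomial theorem for c + (1 - c - d) = 1 - d. It gives the geometric rate at which
  the terms of the series decay.\<close>

lemma sum_acoef_power: "(\<Sum>l=0..s. acoef c d l s * c ^ l) = (1 - d) ^ s"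
  using binomial_ring[of c "1 - c - d" s] by (simp add: acoef_def mult_ac atLeast0AtMost)

definition tree_shape :: "(nat list, 'a) mgraph \<Rightarrow> bool" where
  "tree_shape g \<longleftrightarrow> [] \<in> verts g \<and>
     (\<forall>i j. i @ [j] \<in> verts g \<longleftrightarrow> i \<in> verts g \<and> j < indeg g i) \<and>
     (\<forall>i\<in>verts g. (\<forall>j<indeg g i. inn g i j = i @ [j]) \<and> mark g i \<in> mark_space)"

lemma labelled_tree_shape: "labelled_tree g \<Longrightarrow> tree_shape g"
  by (auto simp: labelled_tree_def tree_shape_def mgraph_wf_def)

definition level :: "(nat list, 'a) mgraph \<Rightarrow> nat \<Rightarrow> nat list set" where
  "level g l = {x \<in> verts g. length x = l}"

section \<open>Levels and weighted sums on a fixed tree\<close>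

context
  fixes T :: "(nat list, 'a) mgraph"
  assumes T: "tree_shape T"
begin

lemma tree_snoc: "x @ [j] \<in> verts T \<longleftrightarrow> x \<in> verts T \<and> j < indeg T x"
  using T by (simp add: tree_shape_def)

lemma tree_inn: "x \<in> verts T \<Longrightarrow> j < indeg T x \<Longrightarrow> inn T x j = x @ [j]"
  using T by (simp add: tree_shape_def)

lemma tree_mark: "x \<in> verts T \<Longrightarrow> mark T x \<in> mark_space"
  using T by (simp add: tree_shape_def)

lemma level_0: "level T 0 = {[]}"
  using T by (auto simp: level_def tree_shape_def)

lemma level_Suc: "level T (Suc l) = (\<lambda>(x, j). x @ [j]) ` (SIGMA x:level T l. {..<indeg T x})"
proof (intro equalityI subsetI)
  fix z assume z: "z \<in> level T (Suc l)"
  then obtain x j where "z = x @ [j]" by (cases z rule: rev_cases) (auto simp: level_def)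
  with z show "z \<in> (\<lambda>(x, j). x @ [j]) ` (SIGMA x:level T l. {..<indeg T x})"
    by (auto simp: level_def tree_snoc image_iff)
qed (auto simp: level_def tree_snoc)

lemma finite_level: "finite (level T l)"
  by (induction l) (auto simp: level_0 level_Suc)

lemma sum_level_Suc:
  fixes f :: "nat list \<Rightarrow> real"
  shows "sum f (level T (Suc l)) = (\<Sum>x\<in>level T l. \<Sum>j<indeg T x. f (x @ [j]))"
proof -
  have "sum f (level T (Suc l)) = (\<Sum>(x, j)\<in>(SIGMA x:level T l. {..<indeg T x}). f (x @ [j]))"
    unfolding level_Suc by (subst sum.reindex) (auto simp: inj_on_def case_prod_beta' intro!: sum.cong)
  also have "\<dots> = (\<Sum>x\<in>level T l. \<Sum>j<indeg T x. f (x @ [j]))"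
    by (subst sum.Sigma) (auto simp: finite_level)
  finally show ?thesis .
qed

lemma depth_verts_levels: "depth_verts T k = (\<Union>l\<in>{0..k}. level T l)"
  by (auto simp: depth_verts_def level_def)

lemma finite_depth_verts: "finite (depth_verts T k)"
  by (simp add: depth_verts_levels finite_level)

lemma sum_depth_verts:
  fixes f :: "nat list \<Rightarrow> real"
  shows "sum f (depth_verts T k) = (\<Sum>l=0..k. sum f (level T l))"
  unfolding depth_verts_levels by (rule sum.UNION_disjoint) (auto simp: finite_level, auto simp: level_def)

text \<open>Levels beyond s have coefficient 0, so one index set of depth k serves all terms with s
  \<le> k at once.\<close>

lemma opinion_term_depth_verts:
  assumes "s \<le> k"
  shows "opinion_term c d T W s = (\<Sum>x\<in>depth_verts T k. path_weight T x * acoef c d (length x) s * W x s)"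
proof -
  have "(\<Sum>x\<in>depth_verts T k. path_weight T x * acoef c d (length x) s * W x s)
     = (\<Sum>l=0..k. \<Sum>x\<in>level T l. path_weight T x * acoef c d (length x) s * W x s)"
    by (rule sum_depth_verts)
  also have "\<dots> = (\<Sum>l=0..s. \<Sum>x\<in>level T l. path_weight T x * acoef c d (length x) s * W x s)"
    using assms by (intro sum.mono_neutral_right) (auto simp: level_def intro!: sum.neutral)
  finally show ?thesis
    by (auto simp: opinion_term_def level_def intro!: sum.cong)
qed

lemma path_weight_nonneg: "x \<in> verts T \<Longrightarrow> 0 \<le> path_weight T x"
  by (induction x rule: rev_induct) (auto simp: tree_snoc intro!: mult_nonneg_nonneg mark_space_mweight tree_mark)

lemma tree_arcs_relpow: "(u, []) \<in> arcs T ^^ m \<longleftrightarrow> u \<in> level T m"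
proof (induction m arbitrary: u)
  case (Suc m)
  \<comment> \<open>The arc farthest from the root is split off, because \<open>level_Suc\<close>
    extends words at their end.\<close>
  have "(u, []) \<in> arcs T ^^ Suc m \<longleftrightarrow> (\<exists>z. (u, z) \<in> arcs T \<and> (z, []) \<in> arcs T ^^ m)"
    by (simp add: relpow_commute[symmetric]) blast
  also have "\<dots> \<longleftrightarrow> (\<exists>z\<in>level T m. \<exists>r<indeg T z. u = z @ [r])"
  proof -
    have "(u, z) \<in> arcs T \<longleftrightarrow> (\<exists>r<indeg T z. u = z @ [r])" if "z \<in> level T m" for z
    proof -
      have "(u, z) \<in> arcs T \<longleftrightarrow> (\<exists>r<indeg T z. u = inn T z r)"
        using that by (auto simp: arcs_def level_def)
      also have "\<dots> \<longleftrightarrow> (\<exists>r<indeg T z. u = z @ [r])"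
        using that by (intro ex_cong1 conj_cong refl) (simp add: tree_inn level_def)
      finally show ?thesis .
    qed
    then show ?thesis unfolding Suc by blast
  qed
  also have "\<dots> \<longleftrightarrow> u \<in> level T (Suc m)"
    by (auto simp: level_Suc image_iff)
  finally show ?case .
qed (auto simp: level_0)

lemma in_comp_root: "in_comp T [] k = depth_verts T k"
  by (auto simp: in_comp_def tree_arcs_relpow depth_verts_levels)

context
  fixes c :: real
  assumes sub: "\<And>x. x \<in> verts T \<Longrightarrow> (\<Sum>j<indeg T x. mweight (mark T x) j) \<le> c" and c: "0 \<le> c"
begin

text \<open>A node hands on to its children, in total, at most the fraction c of its own path
  weight.\<close>

lemma sum_path_weight_level: "(\<Sum>x\<in>level T l. path_weight T x) \<le> c ^ l"
proof (induction l)
  case (Suc l)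
  have "(\<Sum>x\<in>level T (Suc l). path_weight T x)
     = (\<Sum>x\<in>level T l. path_weight T x * (\<Sum>j<indeg T x. mweight (mark T x) j))"
    unfolding sum_level_Suc by (simp add: sum_distrib_left)
  also have "\<dots> \<le> (\<Sum>x\<in>level T l. path_weight T x * c)"
    by (intro sum_mono mult_left_mono) (auto simp: level_def sub path_weight_nonneg)
  also have "\<dots> \<le> c ^ l * c"
    unfolding sum_distrib_right[symmetric] using Suc c by (rule mult_right_mono)
  finally show ?case by (simp add: mult_ac)
qed (simp add: level_0)

text \<open>Level l contributes at most \<open>acoef c d l s * c ^ l\<close>, and the binomial
  theorem sums these bounds.\<close>

lemma opinion_term_bound:
  assumes "c + d \<le> 1" and W: "\<And>x. x \<in> verts T \<Longrightarrow> \<bar>W x s\<bar> \<le> 1"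
  shows "\<bar>opinion_term c d T W s\<bar> \<le> (1 - d) ^ s"
proof -
  have "\<bar>opinion_term c d T W s\<bar> = \<bar>\<Sum>l=0..s. \<Sum>x\<in>level T l. path_weight T x * acoef c d l s * W x s\<bar>"
    by (simp add: opinion_term_def level_def)
  also have "\<dots> \<le> (\<Sum>l=0..s. \<Sum>x\<in>level T l. \<bar>path_weight T x * acoef c d l s * W x s\<bar>)"
    by (intro order_trans[OF sum_abs] sum_mono sum_abs)
  also have "\<dots> \<le> (\<Sum>l=0..s. \<Sum>x\<in>level T l. path_weight T x * acoef c d l s)"
    using assms by (intro sum_mono)
      (auto simp: abs_mult level_def acoef_nonneg path_weight_nonneg intro!: mult_left_le)
  also have "\<dots> = (\<Sum>l=0..s. acoef c d l s * (\<Sum>x\<in>level T l. path_weight T x))"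
    by (simp add: sum_distrib_left mult_ac)
  also have "\<dots> \<le> (\<Sum>l=0..s. acoef c d l s * c ^ l)"
    using assms by (intro sum_mono mult_left_mono sum_path_weight_level acoef_nonneg)
  finally show ?thesis by (simp add: sum_acoef_power)
qed

end

end

text \<open>Turns the isomorphism into a map from tree labels to vertices. In-degrees agree even at
  depth k, because the in-degree is part of the mark and \<epsilon> < 1. Inbound neighbours
  correspond only for nodes of depth less than k, since the children of nodes of depth k lie outside
  the component.\<close>

lemma close_in_comp_embedding:
  fixes T :: "(nat list, 'a::metric_space) mgraph"
  assumes T: "tree_shape T" and g: "substochastic_graph c g" and i: "i \<in> verts g"
    and close: "close_in_comp k \<epsilon> T [] g i" and \<epsilon>: "\<epsilon> < 1"
  obtains \<theta> where "\<theta> [] = i" "inj_on \<theta> (depth_verts T k)" "\<theta> ` depth_verts T k \<subseteq> verts g"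
    "\<And>x. x \<in> depth_verts T k \<Longrightarrow> indeg g (\<theta> x) = indeg T x"
    "\<And>x. x \<in> depth_verts T k \<Longrightarrow> mark_dist (mark g (\<theta> x)) (mark T x) \<le> \<epsilon>"
    "\<And>x r. x \<in> verts T \<Longrightarrow> length x < k \<Longrightarrow> r < indeg T x \<Longrightarrow> inn g (\<theta> x) r = \<theta> (x @ [r])"
proof -
  from close obtain \<theta> where \<theta>: "bij_betw \<theta> (depth_verts T k) (in_comp g i k)" "\<theta> [] = i"
    "\<forall>v\<in>depth_verts T k. mark_dist (mark g (\<theta> v)) (mark T v) \<le> \<epsilon>"
    "\<forall>v\<in>depth_verts T k. \<forall>r<indeg T v. inn T v r \<in> depth_verts T k \<longrightarrow>
          r < indeg g (\<theta> v) \<and> inn g (\<theta> v) r = \<theta> (inn T v r)"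
    unfolding close_in_comp_def in_comp_root[OF T] by blast
  \<comment> \<open>A member of the in-component is either i itself or the tail of an arc, and tails
    are vertices of g.\<close>
  have "u \<in> verts g" if "(u, i) \<in> arcs g ^^ m" for u m
  proof (cases m)
    case (Suc m')
    then have "(u, i) \<in> arcs g O arcs g ^^ m'" using that by (simp add: relpow_commute)
    then obtain z where "(u, z) \<in> arcs g" by blast
    then show ?thesis using g by (auto simp: arcs_def substochastic_graph_def)
  qed (use that i in auto)
  then have "in_comp g i k \<subseteq> verts g" by (auto simp: in_comp_def)
  show ?thesis
  proof
    show "\<theta> [] = i" "inj_on \<theta> (depth_verts T k)" using \<theta> by (auto simp: bij_betw_def)
    show "\<theta> ` depth_verts T k \<subseteq> verts g" using \<theta>(1) \<open>in_comp g i k \<subseteq> verts g\<close> by (auto simp: bij_betw_def)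
    fix x
    show md: "mark_dist (mark g (\<theta> x)) (mark T x) \<le> \<epsilon>" if "x \<in> depth_verts T k" using \<theta>(3) that by blast
    show "indeg g (\<theta> x) = indeg T x" if "x \<in> depth_verts T k"
      unfolding indeg_def by (rule mark_dist_weights) (use md[OF that] \<epsilon> in simp)
    fix r assume x: "x \<in> verts T" "length x < k" "r < indeg T x"
    then have "x \<in> depth_verts T k" "x @ [r] \<in> depth_verts T k" "inn T x r = x @ [r]"
      using tree_snoc[OF T] tree_inn[OF T] by (auto simp: depth_verts_def)
    then show "inn g (\<theta> x) r = \<theta> (x @ [r])" using \<theta>(4) x by metis
  qed
qed

text \<open>First the argument changes from x to y under \<mu>, which is supported in [-1,1]; then
  the law changes from \<mu> to \<nu> at the fixed argument y, where the integrand is |y|-Lipschitz.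
  In the application \<mu> is the signal law on the graph.\<close>

lemma norm_char_diff_le:
  assumes \<mu>: "real_distribution \<mu>" and \<nu>: "real_distribution \<nu>" and b: "AE w in \<mu>. \<bar>w\<bar> \<le> 1"
    and r: "wasserstein1 \<mu> \<nu> \<le> ennreal r" "0 \<le> r"
  shows "norm (char \<mu> x - char \<nu> y) \<le> \<bar>x - y\<bar> + \<bar>y\<bar> * r"
proof -
  interpret \<mu>: real_distribution \<mu> by fact
  interpret \<nu>: real_distribution \<nu> by fact
  have i: "integrable \<mu> (\<lambda>w. iexp (t * w))" for t
    by (rule \<mu>.integrable_const_bound[where B=1]) auto
  have "norm (char \<mu> x - char \<mu> y) = norm (\<integral>w. iexp (x * w) - iexp (y * w) \<partial>\<mu>)"
    unfolding char_def using i by simp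
  also have "\<dots> \<le> (\<integral>w. norm (iexp (x * w) - iexp (y * w)) \<partial>\<mu>)" by (rule integral_norm_bound)
  also have "\<dots> \<le> (\<integral>w. \<bar>x - y\<bar> \<partial>\<mu>)"
  proof (rule integral_mono_AE)
    show "AE w in \<mu>. norm (iexp (x * w) - iexp (y * w)) \<le> \<bar>x - y\<bar>"
      using b
    proof eventually_elim
      case (elim w)
      have "norm (iexp (x * w) - iexp (y * w)) \<le> \<bar>x * w - y * w\<bar>" by (rule norm_iexp_diff_le)
      also have "\<dots> = \<bar>x - y\<bar> * \<bar>w\<bar>" by (simp add: left_diff_distrib[symmetric] abs_mult)
      also have "\<dots> \<le> \<bar>x - y\<bar>" using elim by (intro mult_left_le) auto
      finally show ?case .
    qed
    show "integrable \<mu> (\<lambda>w. norm (iexp (x * w) - iexp (y * w)))"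
      by (intro integrable_norm Bochner_Integration.integrable_diff i)
  qed auto
  finally have 1: "norm (char \<mu> x - char \<mu> y) \<le> \<bar>x - y\<bar>" using \<mu>.prob_space by simp
  have 2: "norm (char \<mu> y - char \<nu> y) \<le> \<bar>y\<bar> * r"
    unfolding char_def
  proof (rule wasserstein1_lipschitz[where B=1 and f="\<lambda>w. iexp (y * w)", OF _ _ _ _ _ _ _ _ r])
    fix a b :: real
    have "norm (iexp (y * a) - iexp (y * b)) \<le> \<bar>y * a - y * b\<bar>" by (rule norm_iexp_diff_le)
    then show "norm (iexp (y * a) - iexp (y * b)) \<le> \<bar>y\<bar> * \<bar>a - b\<bar>"
      by (simp add: right_diff_distrib[symmetric] abs_mult)
  qed (auto intro: \<mu>.prob_space_axioms \<nu>.prob_space_axioms)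
  show ?thesis using norm_triangle_ineq[of "char \<mu> x - char \<mu> y" "char \<mu> y - char \<nu> y"] 1 2 by simp
qed

section \<open>Comparing a graph with a tree embedded in it\<close>

context
  fixes T :: "(nat list, 'a::metric_space) mgraph" and g :: "('v, 'a) mgraph" and c d \<epsilon> u :: real and k i \<theta>
  assumes T: "tree_shape T" 
    and subT: "\<And>x. x \<in> verts T \<Longrightarrow> (\<Sum>j<indeg T x. mweight (mark T x) j) \<le> c"
    and g: "substochastic_graph c g" and fin: "finite (verts g)"
    and c: "0 \<le> c" "c \<le> 1" and d: "c + d \<le> 1" and \<epsilon>: "0 \<le> \<epsilon>" "\<epsilon> < 1"
    and \<theta>: "\<theta> [] = i" "inj_on \<theta> (depth_verts T k)" "\<theta> ` depth_verts T k \<subseteq> verts g"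
    "\<And>x. x \<in> depth_verts T k \<Longrightarrow> indeg g (\<theta> x) = indeg T x"
    "\<And>x. x \<in> depth_verts T k \<Longrightarrow> mark_dist (mark g (\<theta> x)) (mark T x) \<le> \<epsilon>"
    "\<And>x r. x \<in> verts T \<Longrightarrow> length x < k \<Longrightarrow> r < indeg T x \<Longrightarrow> inn g (\<theta> x) r = \<theta> (x @ [r])"
begin

private definition image_weight :: "nat list \<Rightarrow> real" where
  "image_weight x = (\<Prod>m<length x. mweight (mark g (\<theta> (take m x))) (x ! m))"

private lemma image_weight_simps [simp]:
  "image_weight [] = 1" "image_weight (x @ [j]) = image_weight x * mweight (mark g (\<theta> x)) j"
  by (auto simp: image_weight_def nth_append intro!: prod.cong)

text \<open>From one level to the next, the old error is multiplied by row sums of the graph, which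
  are at most c \<le> 1. The new weight errors, at most \<epsilon> per node, are weighted by path
  weights of total at most 1. So each level adds at most \<epsilon>.\<close>

private lemma image_weight_close: "l \<le> k \<Longrightarrow> (\<Sum>x\<in>level T l. \<bar>image_weight x - path_weight T x\<bar>) \<le> l * \<epsilon>"
proof (induction l)
  case (Suc l)
  let ?wg = "\<lambda>x j. mweight (mark g (\<theta> x)) j" and ?wT = "\<lambda>x j. mweight (mark T x) j"
  let ?D = "\<lambda>x. \<bar>image_weight x - path_weight T x\<bar>"
  have "(\<Sum>x\<in>level T (Suc l). ?D x)
    = (\<Sum>x\<in>level T l. \<Sum>j<indeg T x. \<bar>image_weight x * ?wg x j - path_weight T x * ?wT x j\<bar>)"
    unfolding sum_level_Suc[OF T] by simp
  also have "\<dots> \<le> (\<Sum>x\<in>level T l. ?D x + path_weight T x * \<epsilon>)"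
  proof (rule sum_mono)
    fix x assume x: "x \<in> level T l"
    then have xD: "x \<in> depth_verts T k" "x \<in> verts T" using Suc by (auto simp: level_def depth_verts_def)
    have xg: "\<theta> x \<in> verts g" using \<theta>(3) xD by auto
    have P0: "0 \<le> path_weight T x" by (rule path_weight_nonneg[OF T xD(2)])
    have w0: "0 \<le> ?wg x j" for j using g xg by (auto simp: substochastic_graph_def intro: mark_space_mweight)
    have "(\<Sum>j<indeg T x. \<bar>image_weight x * ?wg x j - path_weight T x * ?wT x j\<bar>)
       \<le> (\<Sum>j<indeg T x. ?D x * ?wg x j + path_weight T x * \<bar>?wg x j - ?wT x j\<bar>)"
    proof (rule sum_mono)
      fix j
      have "image_weight x * ?wg x j - path_weight T x * ?wT x j
        = (image_weight x - path_weight T x) * ?wg x j + path_weight T x * (?wg x j - ?wT x j)"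
        by (simp add: algebra_simps)
      then show "\<bar>image_weight x * ?wg x j - path_weight T x * ?wT x j\<bar>
         \<le> ?D x * ?wg x j + path_weight T x * \<bar>?wg x j - ?wT x j\<bar>"
        using abs_triangle_ineq[of "(image_weight x - path_weight T x) * ?wg x j" "path_weight T x * (?wg x j - ?wT x j)"]
          w0 P0 by (simp add: abs_mult)
    qed
    also have "\<dots> = ?D x * (\<Sum>j<indeg T x. ?wg x j) + path_weight T x * (\<Sum>j<indeg T x. \<bar>?wg x j - ?wT x j\<bar>)"
      by (simp add: sum.distrib sum_distrib_left)
    also have "\<dots> \<le> ?D x * 1 + path_weight T x * \<epsilon>"
    proof (intro add_mono mult_left_mono P0)
      show "(\<Sum>j<indeg T x. ?wg x j) \<le> 1"
        using g xg c \<theta>(4)[OF xD(1)] unfolding substochastic_graph_def by fastforce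
      show "(\<Sum>j<indeg T x. \<bar>?wg x j - ?wT x j\<bar>) \<le> \<epsilon>"
        using \<theta>(5)[OF xD(1)] \<epsilon> mark_dist_weights(2)[of "mark g (\<theta> x)" "mark T x"]
        unfolding indeg_def by linarith
    qed simp
    finally show "(\<Sum>j<indeg T x. \<bar>image_weight x * ?wg x j - path_weight T x * ?wT x j\<bar>) \<le> ?D x + path_weight T x * \<epsilon>"
      by simp
  qed
  also have "\<dots> = (\<Sum>x\<in>level T l. ?D x) + (\<Sum>x\<in>level T l. path_weight T x) * \<epsilon>"
    by (simp add: sum.distrib sum_distrib_right)
  also have "\<dots> \<le> l * \<epsilon> + 1 * \<epsilon>"
  proof (intro add_mono mult_right_mono \<epsilon>(1))
    show "(\<Sum>x\<in>level T l. ?D x) \<le> l * \<epsilon>" using Suc by simp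
    show "(\<Sum>x\<in>level T l. path_weight T x) \<le> 1"
      using sum_path_weight_level[OF T subT c(1), of l] power_le_one[OF c, of l] by simp
  qed
  finally show ?case by (simp add: algebra_simps)
qed (simp add: level_0[OF T])

text \<open>Mass starting at the image of the root moves at most one edge per step, so up to time k
  it stays on embedded nodes. There the recursion of the pulled-back vector is that of
  \<open>acoef\<close>, with the edge weights multiplied along the path.\<close>

private lemma dual_vec_embedding:
  assumes "s \<le> k"
  shows "(\<forall>x\<in>depth_verts T k. dual_vec c d g u i s (\<theta> x) = u * image_weight x * acoef c d (length x) s) \<and>
    (\<forall>j. j \<notin> \<theta> ` depth_verts T k \<longrightarrow> dual_vec c d g u i s j = 0)"
  using assms
proof (induction s)
  case 0
  have "[] \<in> depth_verts T k" using T by (auto simp: depth_verts_def tree_shape_def)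
  then have "\<theta> x = i \<longleftrightarrow> x = []" if "x \<in> depth_verts T k" for x
    using \<theta>(1) inj_onD[OF \<theta>(2), of x "[]"] that by auto
  moreover have "i \<in> \<theta> ` depth_verts T k" using \<open>[] \<in> depth_verts T k\<close> \<theta>(1) by auto
  ultimately show ?case by (auto simp: dual_vec_def acoef_def)
next
  case (Suc s)
  let ?D = "depth_verts T k"
  let ?v = "dual_vec c d g u i s"
  let ?F = "\<lambda>y r. mweight (mark g (\<theta> y)) r * (u * image_weight y * acoef c d (length y) s)"
  have IH: "\<And>x. x \<in> ?D \<Longrightarrow> ?v (\<theta> x) = u * image_weight x * acoef c d (length x) s"
    "\<And>j. j \<notin> \<theta> ` ?D \<Longrightarrow> ?v j = 0" using Suc by auto
  have pull: "dual_vec c d g u i (Suc s) j = (1 - c - d) * ?v j + (\<Sum>y\<in>?D. \<Sum>r<indeg T y. ?F y r * of_bool (length y < k \<and> \<theta> (y @ [r]) = j))" for j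
  proof -
    have "(\<Sum>j'\<in>verts g. \<Sum>r<indeg g j'. mweight (mark g j') r * ?v j' * of_bool (inn g j' r = j))
      = (\<Sum>j'\<in>\<theta> ` ?D. \<Sum>r<indeg g j'. mweight (mark g j') r * ?v j' * of_bool (inn g j' r = j))"
      using \<theta>(3) fin IH(2) by (intro sum.mono_neutral_right) auto
    also have "\<dots> = (\<Sum>y\<in>?D. \<Sum>r<indeg g (\<theta> y). mweight (mark g (\<theta> y)) r * ?v (\<theta> y) * of_bool (inn g (\<theta> y) r = j))"
      by (simp add: sum.reindex[OF \<theta>(2)])
    also have "\<dots> = (\<Sum>y\<in>?D. \<Sum>r<indeg T y. ?F y r * of_bool (length y < k \<and> \<theta> (y @ [r]) = j))"
    proof (intro sum.cong)
      fix y r assume y: "y \<in> ?D" "r \<in> {..<indeg T y}"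
      show "mweight (mark g (\<theta> y)) r * ?v (\<theta> y) * of_bool (inn g (\<theta> y) r = j) = ?F y r * of_bool (length y < k \<and> \<theta> (y @ [r]) = j)"
      proof (cases "length y < k")
        case True
        then show ?thesis using y \<theta>(6)[of y r] IH(1)[of y] by (simp add: depth_verts_def)
      next
        \<comment> \<open>At depth k the inbound neighbours are not controlled by the embedding, but
          since s < k no mass has arrived there yet.\<close>
        case False
        then have "acoef c d (length y) s = 0" using Suc by simp
        then show ?thesis using IH(1)[of y] y by simp
      qed
    qed (auto simp: \<theta>(4))
    finally show ?thesis by (simp add: dual_vec_Suc pull_back_def)
  qed
  have snocD: "y @ [r] \<in> ?D" if "y \<in> ?D" "r < indeg T y" "length y < k" for y r
    using that tree_snoc[OF T] by (auto simp: depth_verts_def)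
  show ?case
  proof (intro conjI ballI allI impI)
    fix j assume j: "j \<notin> \<theta> ` ?D"
    then have "of_bool (length y < k \<and> \<theta> (y @ [r]) = j) = (0::real)" if "y \<in> ?D" "r < indeg T y" for y r
      using snocD[OF that] by auto
    then have "(\<Sum>y\<in>?D. \<Sum>r<indeg T y. ?F y r * of_bool (length y < k \<and> \<theta> (y @ [r]) = j)) = 0"
      by (intro sum.neutral ballI) (simp only: lessThan_iff mult_zero_right)
    then show "dual_vec c d g u i (Suc s) j = 0"
      unfolding pull using IH(2)[OF j] by simp
  next
    fix x assume x: "x \<in> ?D"
    have "(\<Sum>y\<in>?D. \<Sum>r<indeg T y. ?F y r * of_bool (length y < k \<and> \<theta> (y @ [r]) = \<theta> x))
      = (\<Sum>y\<in>?D. \<Sum>r<indeg T y. ?F y r * of_bool (y @ [r] = x))"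
    proof (intro sum.cong refl)
      fix y r assume y: "y \<in> ?D" "r \<in> {..<indeg T y}"
      have "length y < k \<and> \<theta> (y @ [r]) = \<theta> x \<longleftrightarrow> y @ [r] = x"
        using x y snocD[of y r] inj_onD[OF \<theta>(2), of "y @ [r]" x] by (auto simp: depth_verts_def)
      then show "?F y r * of_bool (length y < k \<and> \<theta> (y @ [r]) = \<theta> x) = ?F y r * of_bool (y @ [r] = x)"
        by simp
    qed
    \<comment> \<open>In a tree the only edge leaving a node goes to its parent. The root therefore
      keeps only its retained mass, and any other node also receives what its parent z sends back
      along that edge.\<close>
    also have "(1 - c - d) * ?v (\<theta> x) + \<dots> = u * image_weight x * acoef c d (length x) (Suc s)"
    proof (cases x rule: rev_cases)
      case Nil
      then show ?thesis using IH(1)[OF x] by (simp add: acoef_0_Suc)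
    next
      case (snoc z q)
      have z: "z \<in> ?D" "q < indeg T z" using x tree_snoc[OF T, of z q] unfolding snoc by (auto simp: depth_verts_def)
      have "(\<Sum>r<indeg T y. ?F y r * of_bool (y @ [r] = x)) = (if y = z then ?F z q else 0)" for y
      proof -
        have "(\<Sum>r<indeg T y. ?F y r * of_bool (y @ [r] = x)) = (\<Sum>r<indeg T y. if r = q then (if y = z then ?F z q else 0) else 0)"
          by (intro sum.cong) (auto simp: snoc)
        then show ?thesis using z(2) by (auto)
      qed
      then have "(\<Sum>y\<in>?D. \<Sum>r<indeg T y. ?F y r * of_bool (y @ [r] = x)) = ?F z q"
        using z(1) finite_depth_verts[OF T] by simp
      then show ?thesis using IH(1)[OF x] by (simp add: snoc acoef_Suc_Suc algebra_simps)
    qed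
    finally show "dual_vec c d g u i (Suc s) (\<theta> x) = u * image_weight x * acoef c d (length x) (Suc s)"
      unfolding pull .
  qed
qed

text \<open>Products of factors of modulus at most 1 differ by no more than the sum of the
  differences of the factors. These differences are linear in path weights and their errors, so
  level sums bound them, and the factor of \<epsilon> depends neither on the graph nor on the number
  of nodes. Its l comes from the weights, its K from the signal laws.\<close>

lemma graph_char_close_tree_char:
  fixes K :: real
  assumes \<nu>: "\<And>x. real_distribution (\<nu> x)" and b: "\<And>j. j \<in> verts g \<Longrightarrow> AE w in \<nu> (mark g j). \<bar>w\<bar> \<le> 1"
    and W: "\<And>x. x \<in> depth_verts T k \<Longrightarrow> wasserstein1 (\<nu> (mark g (\<theta> x))) (\<nu> (mark T x)) \<le> ennreal (K * \<epsilon>)"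
    and K: "0 \<le> K"
  shows "norm (graph_char c d \<nu> u k g i - tree_char c d \<nu> u k T)
    \<le> \<epsilon> * (\<bar>u\<bar> * (\<Sum>s<k. \<Sum>l=0..k. acoef c d l s * (l + K)))"
proof -
  let ?D = "depth_verts T k"
  let ?x = "\<lambda>s x. u * image_weight x * acoef c d (length x) s"
  let ?y = "\<lambda>s x. u * path_weight T x * acoef c d (length x) s"
  have prod: "(\<Prod>j\<in>verts g. char (\<nu> (mark g j)) (dual_vec c d g u i s j)) = (\<Prod>x\<in>?D. char (\<nu> (mark g (\<theta> x))) (?x s x))"
    if "s < k" for s
  proof -
    note emb = dual_vec_embedding[OF less_imp_le[OF that]]
    \<comment> \<open>Vertices outside the image carry the argument 0, where every characteristic
      function is 1.\<close>
    have "(\<Prod>j\<in>verts g. char (\<nu> (mark g j)) (dual_vec c d g u i s j)) = (\<Prod>j\<in>\<theta> ` ?D. char (\<nu> (mark g j)) (dual_vec c d g u i s j))"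
      using fin \<theta>(3) emb by (intro prod.mono_neutral_right) (auto simp: real_distribution.char_zero[OF \<nu>])
    then show ?thesis using emb by (simp add: prod.reindex[OF \<theta>(2)])
  qed
  have "norm (graph_char c d \<nu> u k g i - tree_char c d \<nu> u k T)
    \<le> (\<Sum>s<k. norm ((\<Prod>x\<in>?D. char (\<nu> (mark g (\<theta> x))) (?x s x)) - (\<Prod>x\<in>?D. char (\<nu> (mark T x)) (?y s x))))"
    unfolding graph_char_def tree_char_def by (simp add: prod) (intro norm_prod_diff norm_prod_char_le \<nu>)
  also have "\<dots> \<le> (\<Sum>s<k. \<Sum>x\<in>?D. norm (char (\<nu> (mark g (\<theta> x))) (?x s x) - char (\<nu> (mark T x)) (?y s x)))"
    by (intro sum_mono norm_prod_diff real_distribution.cmod_char_le_1 \<nu>)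
  also have "\<dots> \<le> (\<Sum>s<k. \<Sum>x\<in>?D. \<bar>?x s x - ?y s x\<bar> + \<bar>?y s x\<bar> * (K * \<epsilon>))"
    using \<theta>(3) K \<epsilon> by (intro sum_mono norm_char_diff_le \<nu> b W mult_nonneg_nonneg) auto
  also have "\<dots> = (\<Sum>s<k. \<Sum>l=0..k. \<Sum>x\<in>level T l. \<bar>u\<bar> * acoef c d l s * (\<bar>image_weight x - path_weight T x\<bar> + path_weight T x * (K * \<epsilon>)))"
    unfolding sum_depth_verts[OF T]
  proof (intro sum.cong refl)
    fix s l x assume x: "x \<in> level T l"
    have P0: "0 \<le> path_weight T x" using x by (intro path_weight_nonneg[OF T]) (auto simp: level_def)
    have a0: "0 \<le> acoef c d l s" by (rule acoef_nonneg[OF d])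
    have "?x s x - ?y s x = u * acoef c d l s * (image_weight x - path_weight T x)"
      using x by (simp add: level_def algebra_simps)
    then have "\<bar>?x s x - ?y s x\<bar> = \<bar>u\<bar> * acoef c d l s * \<bar>image_weight x - path_weight T x\<bar>"
      using a0 by (simp add: abs_mult)
    moreover have "\<bar>?y s x\<bar> = \<bar>u\<bar> * acoef c d l s * path_weight T x"
      using x a0 P0 by (simp add: level_def abs_mult)
    ultimately show "\<bar>?x s x - ?y s x\<bar> + \<bar>?y s x\<bar> * (K * \<epsilon>)
      = \<bar>u\<bar> * acoef c d l s * (\<bar>image_weight x - path_weight T x\<bar> + path_weight T x * (K * \<epsilon>))"
      by (simp add: algebra_simps)
  qed
  also have "\<dots> = (\<Sum>s<k. \<Sum>l=0..k. \<bar>u\<bar> * acoef c d l s * ((\<Sum>x\<in>level T l. \<bar>image_weight x - path_weight T x\<bar>) + (\<Sum>x\<in>level T l. path_weight T x) * (K * \<epsilon>)))"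
    by (simp add: sum_distrib_left[symmetric] sum.distrib sum_distrib_right[symmetric])
  also have "\<dots> \<le> (\<Sum>s<k. \<Sum>l=0..k. \<bar>u\<bar> * acoef c d l s * (l * \<epsilon> + 1 * (K * \<epsilon>)))"
  proof (intro sum_mono mult_left_mono add_mono mult_right_mono)
    fix l assume "l \<in> {0..k}"
    then show "(\<Sum>x\<in>level T l. \<bar>image_weight x - path_weight T x\<bar>) \<le> l * \<epsilon>" by (intro image_weight_close) simp
    show "(\<Sum>x\<in>level T l. path_weight T x) \<le> 1"
      using sum_path_weight_level[OF T subT c(1), of l] power_le_one[OF c, of l] by simp
  qed (use K \<epsilon> acoef_nonneg[OF d] in auto)
  also have "\<dots> = \<epsilon> * (\<bar>u\<bar> * (\<Sum>s<k. \<Sum>l=0..k. acoef c d l s * (l + K)))"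
    by (simp add: sum_distrib_left algebra_simps)
  finally show ?thesis .
qed

end

section \<open>Transfer along the strong coupling\<close>

lemma mark_dist_nonneg: "0 \<le> mark_dist x (y :: 'a::metric_space mark)"
proof (cases "mark_dist x y < 1")
  case True
  have "0 \<le> (\<Sum>j<mdeg y. \<bar>mweight x j - mweight y j\<bar>)" by (rule sum_nonneg) simp
  with mark_dist_weights(2)[OF True] show ?thesis by linarith
qed simp

lemma distr_pair_snd:
  assumes "prob_space M" "sigma_finite_measure N"
  shows "distr (M \<Otimes>\<^sub>M N) N snd = N"
proof (rule measure_eqI)
  interpret M: prob_space M by fact
  interpret N: sigma_finite_measure N by fact
  fix A assume "A \<in> sets (distr (M \<Otimes>\<^sub>M N) N snd)"
  then have A: "A \<in> sets N" by simp
  have "emeasure (distr (M \<Otimes>\<^sub>M N) N snd) A = emeasure (M \<Otimes>\<^sub>M N) (space M \<times> A)"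
    using A sets.sets_into_space[OF A]
    by (subst emeasure_distr) (auto simp: space_pair_measure intro!: arg_cong[where f="emeasure (M \<Otimes>\<^sub>M N)"])
  also have "\<dots> = emeasure N A"
    using A by (subst N.emeasure_pair_measure_Times) (auto simp: M.emeasure_space_1)
  finally show "emeasure (distr (M \<Otimes>\<^sub>M N) N snd) A = emeasure N A" .
qed simp

text \<open>The bound on the signals is expressed as mass 1 of [-1,1], a measurable function of the
  mark, so that the whole property is an event.\<close>

definition good_graph :: "real \<Rightarrow> ('a mark \<Rightarrow> real measure) \<Rightarrow> nat \<Rightarrow> (nat, 'a) mgraph \<Rightarrow> bool" where
  "good_graph c \<nu> n g \<longleftrightarrow> verts g = {1..n} \<and> substochastic_graph c g \<and>
     (\<forall>i\<in>verts g. measure (total_kernel \<nu> (mark g i)) {-1..1} = 1)"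

definition good_tree :: "real \<Rightarrow> ('a mark \<Rightarrow> real measure) \<Rightarrow> (nat list, 'a) mgraph \<Rightarrow> bool" where
  "good_tree c \<nu> g \<longleftrightarrow> tree_shape g \<and>
     (\<forall>x\<in>verts g. (\<Sum>r<indeg g x. mweight (mark g x) r) \<le> c \<and> measure (total_kernel \<nu> (mark g x)) {-1..1} = 1)"

lemma measurable_sum_mweight [measurable]:
  "(\<lambda>g. \<Sum>r<indeg g i. mweight (mark g i) r) \<in> borel_measurable (mgraph_space :: ('v, 'a::polish_space) mgraph measure)"
  by (intro measurable_sum_random_set) measurable

lemma measurable_graph_char_vertex:
  fixes \<gamma> :: "(nat, 'a::polish_space) mgraph measure"
  assumes \<nu>: "\<nu> \<in> restrict_space borel mark_space \<rightarrow>\<^sub>M prob_algebra borel" and \<gamma>: "sets \<gamma> = sets mgraph_space"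
  shows "(\<lambda>z. graph_char c d (total_kernel \<nu>) u t (fst z) (snd z)) \<in> borel_measurable (\<gamma> \<Otimes>\<^sub>M measure_pmf p)"
proof (rule measurable_compose_countable[where f="\<lambda>i z. graph_char c d (total_kernel \<nu>) u t (fst z) i" and g=snd])
  fix i
  have "(\<lambda>g. graph_char c d (total_kernel \<nu>) u t g i) \<in> borel_measurable \<gamma>"
    using measurable_graph_char[OF \<nu>] by (simp add: measurable_cong_sets[OF \<gamma> refl])
  then show "(\<lambda>z. graph_char c d (total_kernel \<nu>) u t (fst z) i) \<in> borel_measurable (\<gamma> \<Otimes>\<^sub>M measure_pmf p)"
    by (rule measurable_compose[OF measurable_fst])
qed (auto simp: measurable_cong_sets[OF refl sets_measure_pmf_count_space, symmetric])

lemma measurable_inn_verts [measurable]: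
  "Measurable.pred (mgraph_space :: ('v::countable, 'a::polish_space) mgraph measure) (\<lambda>g. inn g i r \<in> verts g)"
proof -
  have "Measurable.pred (mgraph_space :: ('v, 'a) mgraph measure) (\<lambda>g. \<exists>v. inn g i r = v \<and> v \<in> verts g)"
    by measurable
  then show ?thesis by simp
qed

section \<open>Almost sure properties of the graphs as measurable events\<close>

context
  fixes c :: real and \<nu> :: "'a::polish_space mark \<Rightarrow> real measure"
  assumes \<nu>: "\<nu> \<in> restrict_space borel mark_space \<rightarrow>\<^sub>M prob_algebra borel"
begin

lemma measurable_kernel_mark:
  "(\<lambda>g. measure (total_kernel \<nu> (mark g i)) {-1..1}) \<in> borel_measurable (mgraph_space :: ('v, 'a) mgraph measure)"
  by (rule measurable_compose[OF _ measurable_compose[OF measurable_total_kernel[OF \<nu>] measurable_measure_prob_algebra]])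
    measurable

lemma measurable_good_graph: "Measurable.pred mgraph_space (good_graph c \<nu> n)"
proof -
  note [measurable] = measurable_kernel_mark
  have "good_graph c \<nu> n = (\<lambda>g. (\<forall>v. v \<in> verts g \<longleftrightarrow> v \<in> {1..n}) \<and>
     (\<forall>i. i \<in> verts g \<longrightarrow> mark g i \<in> mark_space \<and> (\<forall>r. r < indeg g i \<longrightarrow> inn g i r \<in> verts g) \<and>
        (\<Sum>r<indeg g i. mweight (mark g i) r) \<le> c \<and> measure (total_kernel \<nu> (mark g i)) {-1..1} = 1))"
    by (auto simp: good_graph_def substochastic_graph_def fun_eq_iff)
  also have "Measurable.pred mgraph_space \<dots>" by measurable
  finally show ?thesis .
qed

lemma measurable_tree_shape: "Measurable.pred mgraph_space (tree_shape :: (nat list, 'a) mgraph \<Rightarrow> bool)"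
proof -
  have "(tree_shape :: (nat list, 'a) mgraph \<Rightarrow> bool) = (\<lambda>g. [] \<in> verts g \<and>
     (\<forall>i j. i @ [j] \<in> verts g \<longleftrightarrow> i \<in> verts g \<and> j < indeg g i) \<and>
     (\<forall>i. i \<in> verts g \<longrightarrow> (\<forall>j. j < indeg g i \<longrightarrow> inn g i j = i @ [j]) \<and> mark g i \<in> mark_space))"
    by (auto simp: tree_shape_def fun_eq_iff)
  also have "Measurable.pred mgraph_space \<dots>" by measurable
  finally show ?thesis .
qed

lemma measurable_good_tree: "Measurable.pred mgraph_space (good_tree c \<nu>)"
proof -
  note [measurable] = measurable_kernel_mark measurable_tree_shape
  have "good_tree c \<nu> = (\<lambda>g. tree_shape g \<and> (\<forall>x. x \<in> verts g \<longrightarrow> (\<Sum>r<indeg g x. mweight (mark g x) r) \<le> c \<and>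
       measure (total_kernel \<nu> (mark g x)) {-1..1} = 1))"
    by (auto simp: good_tree_def fun_eq_iff)
  also have "Measurable.pred mgraph_space \<dots>" by measurable
  finally show ?thesis .
qed

lemma total_kernel_AE_bounded:
  assumes "measure (total_kernel \<nu> x) {-1..1} = 1"
  shows "AE w in total_kernel \<nu> x. \<bar>w\<bar> \<le> 1"
proof -
  interpret real_distribution "total_kernel \<nu> x" by (rule real_distribution_total_kernel[OF \<nu>])
  have "AE w in total_kernel \<nu> x. w \<in> {-1..1}" using assms by (subst AE_in_set_eq_1) auto
  then show ?thesis by eventually_elim auto
qed

text \<open>Weights are nonnegative, so the bound on a signal is at most d + c \<le> 1. A vertex
  without inbound edges has an empty weight sum, for which 0 \<le> c is used.\<close>

lemma AE_good_graph:
  fixes G :: "'w \<Rightarrow> (nat, 'a) mgraph"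
  assumes wrd: "weighted_random_digraph c n M G"
    and cd: "0 \<le> c" "c + d \<le> 1"
    and bd: "AE \<omega> in M. \<forall>i\<in>{1..n}. AE w in \<nu> (mark (G \<omega>) i).
           \<bar>w\<bar> \<le> d + c - (\<Sum>r<indeg (G \<omega>) i. mweight (mark (G \<omega>) i) r)"
  shows "AE \<omega> in M. good_graph c \<nu> n (G \<omega>)"
proof -
  have "AE \<omega> in M. mgraph_wf (G \<omega>) \<and> verts (G \<omega>) = {1..n} \<and>
        (\<forall>i\<in>{1..n}. 0 < indeg (G \<omega>) i \<longrightarrow>
           (\<Sum>r<indeg (G \<omega>) i. mweight (mark (G \<omega>) i) r) = c)"
    using wrd by (simp add: weighted_random_digraph_def)
  then show ?thesis using bd
  proof eventually_elim
    case (elim \<omega>)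
    let ?g = "G \<omega>"
    have "(\<Sum>r<indeg ?g i. mweight (mark ?g i) r) \<le> c" if "i \<in> {1..n}" for i
    proof (cases "indeg ?g i = 0")
      case False
      then show ?thesis using elim that by auto
    qed (use cd in simp)
    moreover have "measure (total_kernel \<nu> (mark ?g i)) {-1..1} = 1" if i: "i \<in> {1..n}" for i
    proof -
      have ms: "mark ?g i \<in> mark_space" using elim i by (auto simp: mgraph_wf_def)
      have "0 \<le> (\<Sum>r<indeg ?g i. mweight (mark ?g i) r)"
        by (intro sum_nonneg mark_space_mweight ms)
      then have *: "\<bar>w\<bar> \<le> 1" if "\<bar>w\<bar> \<le> d + c - (\<Sum>r<indeg ?g i. mweight (mark ?g i) r)" for w
        using that cd by linarith
      have "AE w in \<nu> (mark ?g i). \<bar>w\<bar> \<le> d + c - (\<Sum>r<indeg ?g i. mweight (mark ?g i) r)"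
        using elim i by blast
      then have "AE w in total_kernel \<nu> (mark ?g i). w \<in> {-1..1}"
        unfolding total_kernel_eq[OF ms] by eventually_elim (use * in \<open>force simp: abs_le_iff\<close>)
      moreover interpret real_distribution "total_kernel \<nu> (mark ?g i)" by (rule real_distribution_total_kernel[OF \<nu>])
      show ?thesis using calculation by (subst (asm) AE_in_set_eq_1) auto
    qed
    ultimately show ?case
      using elim by (auto simp: good_graph_def substochastic_graph_def mgraph_wf_def)
  qed
qed

end

definition coupled_event ::
  "nat \<Rightarrow> real \<Rightarrow> 'v \<Rightarrow> (((nat, 'a::metric_space) mgraph \<times> nat) \<times> ('v, 'a) mgraph) measure \<Rightarrow>
   (((nat, 'a) mgraph \<times> nat) \<times> ('v, 'a) mgraph) set" where
  "coupled_event k \<epsilon> rt \<pi> = {z \<in> space \<pi>. close_in_comp k \<epsilon> (snd z) rt (fst (fst z)) (snd (fst z))}"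

text \<open>Removes the conditioning on the attributes: conditional probabilities that tend to 1 in
  probability have expectations tending to 1.\<close>

lemma strong_coupling_event:
  fixes \<gamma> :: "nat \<Rightarrow> (nat, 'a::polish_space) mgraph measure"
  assumes sc: "strong_coupling \<gamma> \<tau> rt" and k: "1 \<le> k" and \<epsilon>: "0 < \<epsilon>"
    and \<gamma>: "\<And>n. n \<ge> 1 \<Longrightarrow> prob_space (\<gamma> n)"
  obtains \<pi> where "\<And>n. n \<ge> 1 \<Longrightarrow> \<pi> n \<in> couplings (\<gamma> n \<Otimes>\<^sub>M measure_pmf (pmf_of_set {1..n})) \<tau>"
    "\<And>\<delta>. 0 < \<delta> \<Longrightarrow> \<forall>\<^sub>F n in sequentially.
       coupled_event k \<epsilon> rt (\<pi> n) \<in> sets (\<pi> n) \<and>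
       1 - \<delta> \<le> measure (\<pi> n) (coupled_event k \<epsilon> rt (\<pi> n))"
proof -
  from sc k \<epsilon> obtain \<pi> where \<pi>: "\<forall>n\<ge>1. \<pi> n \<in> couplings (\<gamma> n \<Otimes>\<^sub>M measure_pmf (pmf_of_set {1..n})) \<tau>"
    and lim: "tendsto_in_prob \<pi> (\<lambda>n. real_cond_exp (\<pi> n) (attr_algebra n (\<pi> n) (\<lambda>((g, i), t). g))
          (indicator {((g, i), t). ((g, i), t) \<in> space (\<pi> n) \<and> close_in_comp k \<epsilon> t rt g i})) 1"
    unfolding strong_coupling_def by blast
  have eq: "{((g, i), t). ((g, i), t) \<in> space (\<pi> n) \<and> close_in_comp k \<epsilon> t rt g i}
    = coupled_event k \<epsilon> rt (\<pi> n)" for n by (auto simp: coupled_event_def)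
  have "prob_space (\<pi> n)" if "n \<ge> 1" for n
  proof -
    interpret pair_prob_space "\<gamma> n" "measure_pmf (pmf_of_set {1..n})"
      using \<gamma>[OF that] by (auto simp: pair_prob_space_def pair_sigma_finite_def prob_space_imp_sigma_finite measure_pmf.prob_space_axioms)
    show ?thesis using couplingsD(6) \<pi> that prob_space_axioms by blast
  qed
  from tendsto_in_prob_event[OF lim[unfolded eq] this] show ?thesis
    using \<pi> by (intro that) (auto simp: coupled_event_def)
qed

section \<open>Passing from the coupled graphs to the limiting tree\<close>

context
  fixes c d K :: real and \<nu> :: "'a::polish_space mark \<Rightarrow> real measure"
    and \<gamma> :: "nat \<Rightarrow> (nat, 'a) mgraph measure" and \<tau> :: "(nat list, 'a) mgraph measure"
  assumes c: "0 \<le> c" "c \<le> 1" and d: "c + d \<le> 1"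
    and \<nu>: "\<nu> \<in> restrict_space borel mark_space \<rightarrow>\<^sub>M prob_algebra borel"
    and lip: "\<And>x y. x \<in> mark_space \<Longrightarrow> y \<in> mark_space \<Longrightarrow>
           wasserstein1 (\<nu> x) (\<nu> y) \<le> ennreal (K * mark_dist x y)"
    and \<gamma>: "\<And>n. n \<ge> 1 \<Longrightarrow> prob_space (\<gamma> n)" "\<And>n. n \<ge> 1 \<Longrightarrow> sets (\<gamma> n) = sets mgraph_space"
    and good: "\<And>n. n \<ge> 1 \<Longrightarrow> AE g in \<gamma> n. good_graph c \<nu> n g"
    and \<tau>: "prob_space \<tau>" "sets \<tau> = sets mgraph_space"
    and tree: "AE t in \<tau>. tree_shape t"
    and sc: "strong_coupling \<gamma> \<tau> []"
begin

lemma wasserstein_close: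
  assumes "x \<in> mark_space" "y \<in> mark_space" "mark_dist x y \<le> \<epsilon>"
  shows "wasserstein1 (total_kernel \<nu> x) (total_kernel \<nu> y) \<le> ennreal (\<bar>K\<bar> * \<epsilon>)"
proof -
  \<comment> \<open>The absolute value makes the bound monotone in the distance whatever the sign of
    K.\<close>
  have "K * mark_dist x y \<le> \<bar>K\<bar> * mark_dist x y" by (intro mult_right_mono mark_dist_nonneg) simp
  also have "\<dots> \<le> \<bar>K\<bar> * \<epsilon>" using assms(3) by (intro mult_left_mono) auto
  finally show ?thesis using lip[OF assms(1,2)] assms by (auto intro: order_trans ennreal_leI)
qed

lemma coupling_AE_good:
  assumes n: "n \<ge> 1" and \<pi>: "\<pi> \<in> couplings (\<gamma> n \<Otimes>\<^sub>M measure_pmf (pmf_of_set {1..n})) \<tau>"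
  shows "AE z in \<pi>. good_graph c \<nu> n (fst (fst z)) \<and> snd (fst z) \<in> {1..n} \<and> tree_shape (snd z)"
proof -
  let ?u = "measure_pmf (pmf_of_set {1..n})"
  have "AE g in distr (\<gamma> n \<Otimes>\<^sub>M ?u) (\<gamma> n) fst. good_graph c \<nu> n g"
    unfolding measure_pmf.distr_pair_fst by (rule good[OF n])
  from AE_distrD[OF measurable_fst this]
  have "AE z in \<gamma> n \<Otimes>\<^sub>M ?u. good_graph c \<nu> n (fst z)" .
  moreover have "AE i in distr (\<gamma> n \<Otimes>\<^sub>M ?u) ?u snd. i \<in> {1..n}"
    unfolding distr_pair_snd[OF \<gamma>(1)[OF n] measure_pmf.sigma_finite_measure_axioms] using n by (simp add: AE_measure_pmf_iff)
  from AE_distrD[OF measurable_snd this] have "AE z in \<gamma> n \<Otimes>\<^sub>M ?u. snd z \<in> {1..n}" .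
  ultimately have "AE z in distr \<pi> (\<gamma> n \<Otimes>\<^sub>M ?u) fst. good_graph c \<nu> n (fst z) \<and> snd z \<in> {1..n}"
    unfolding couplingsD(2)[OF \<pi>] by eventually_elim simp
  from AE_distrD[OF couplingsD(4)[OF \<pi>] this]
  have 1: "AE z in \<pi>. good_graph c \<nu> n (fst (fst z)) \<and> snd (fst z) \<in> {1..n}" .
  have "AE t in distr \<pi> \<tau> snd. tree_shape t" unfolding couplingsD(3)[OF \<pi>] by (rule tree)
  from AE_distrD[OF couplingsD(5)[OF \<pi>] this] have 2: "AE z in \<pi>. tree_shape (snd z)" .
  from 1 2 show ?thesis by eventually_elim simp
qed

lemma prob_space_coupling:
  assumes n: "n \<ge> 1" and \<pi>: "\<pi> \<in> couplings (\<gamma> n \<Otimes>\<^sub>M measure_pmf (pmf_of_set {1..n})) \<tau>"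
  shows "prob_space \<pi>"
proof -
  interpret pair_prob_space "\<gamma> n" "measure_pmf (pmf_of_set {1..n})"
    using \<gamma>(1)[OF n] by (auto simp: pair_prob_space_def pair_sigma_finite_def prob_space_imp_sigma_finite measure_pmf.prob_space_axioms)
  show ?thesis using couplingsD(6)[OF \<pi>] prob_space_axioms by blast
qed

text \<open>The probability of P under \<tau> does not depend on n, and the coupling at a single
  suitable n shows that it is at least 1 - \<delta>. Thus a property forced by closeness to a good
  graph holds almost surely on the tree.\<close>

lemma AE_limit_tree:
  assumes k: "1 \<le> k" and \<epsilon>: "0 < \<epsilon>"
    and P[measurable]: "Measurable.pred mgraph_space P"
    and imp: "\<And>n g i t. good_graph c \<nu> n g \<Longrightarrow> i \<in> {1..n} \<Longrightarrow> tree_shape t \<Longrightarrow> close_in_comp k \<epsilon> t [] g i \<Longrightarrow> P t"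
  shows "AE t in \<tau>. P t"
proof -
  interpret \<tau>: prob_space \<tau> by (rule \<tau>)
  obtain \<pi> where \<pi>: "\<And>n. n \<ge> 1 \<Longrightarrow> \<pi> n \<in> couplings (\<gamma> n \<Otimes>\<^sub>M measure_pmf (pmf_of_set {1..n})) \<tau>"
    and ev: "\<And>\<delta>. 0 < \<delta> \<Longrightarrow> \<forall>\<^sub>F n in sequentially.
       coupled_event k \<epsilon> [] (\<pi> n) \<in> sets (\<pi> n) \<and>
       1 - \<delta> \<le> measure (\<pi> n) (coupled_event k \<epsilon> [] (\<pi> n))"
    by (rule strong_coupling_event[OF sc k \<epsilon> \<gamma>(1)]) (assumption, blast)
  have sp: "space \<tau> = UNIV" using sets_eq_imp_space_eq[OF \<tau>(2)] by simp
  have Ps: "{t. P t} \<in> sets \<tau>" using \<tau>(2) P by (simp add: pred_def)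
  have "1 - \<delta> \<le> measure \<tau> {t. P t}" if \<delta>: "0 < \<delta>" for \<delta>
  proof -
    obtain n where n: "n \<ge> 1" and
      E: "coupled_event k \<epsilon> [] (\<pi> n) \<in> sets (\<pi> n)" (is "?E \<in> _")
      "1 - \<delta> \<le> measure (\<pi> n) (coupled_event k \<epsilon> [] (\<pi> n))"
      using eventually_conj[OF ev[OF \<delta>] eventually_ge_at_top[of 1]] by (auto dest!: eventually_happens)
    interpret \<pi>: prob_space "\<pi> n" by (rule prob_space_coupling[OF n \<pi>[OF n]])
    note E(2)
    also have "measure (\<pi> n) ?E \<le> measure (\<pi> n) (snd -` {t. P t} \<inter> space (\<pi> n))"
    proof (rule \<pi>.finite_measure_mono_AE)
      show "AE z in \<pi> n. z \<in> ?E \<longrightarrow> z \<in> snd -` {t. P t} \<inter> space (\<pi> n)"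
        using coupling_AE_good[OF n \<pi>[OF n]] by eventually_elim (use imp in \<open>auto simp: coupled_event_def\<close>)
      show "snd -` {t. P t} \<inter> space (\<pi> n) \<in> sets (\<pi> n)"
        by (rule measurable_sets[OF couplingsD(5)[OF \<pi>[OF n]] Ps])
    qed
    also have "\<dots> = measure (distr (\<pi> n) \<tau> snd) {t. P t}"
      by (rule measure_distr[symmetric, OF couplingsD(5)[OF \<pi>[OF n]] Ps])
    also have "\<dots> = measure \<tau> {t. P t}" by (simp only: couplingsD(3)[OF \<pi>[OF n]])
    finally show ?thesis .
  qed
  then have "1 \<le> measure \<tau> {t. P t}"
    using field_le_epsilon[of 1 "measure \<tau> {t. P t}"] by (simp add: field_simps)
  then have "measure \<tau> {t. P t} = 1" by (rule antisym[OF \<tau>.prob_le_1])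
  then have "AE t in \<tau>. t \<in> {t. P t}" using Ps by (subst \<tau>.AE_in_set_eq_1) auto
  then show ?thesis by simp
qed

text \<open>Both bounds are inherited from the graphs. A node x is compared with its image in a good
  graph at every accuracy \<open>?e m\<close>, which gives the bounds up to an error of order
  \<open>?e m\<close>; as nodes and accuracies are countable, m may tend to infinity outside one
  null set.\<close>

lemma AE_good_tree: "AE t in \<tau>. good_tree c \<nu> t"
proof -
  \<comment> \<open>A bounded 1-Lipschitz function that vanishes exactly on [-1,1]: its integral
    detects mass outside this interval and is controlled by the Wasserstein distance.\<close>
  let ?f = "\<lambda>w::real. min 1 (max 0 (\<bar>w\<bar> - 1))"
  \<comment> \<open>Below 1 for every m, as the comparison of in-degrees requires.\<close>
  let ?e = "\<lambda>m::nat. 1 / (real m + 2)"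
  have sub: "total_kernel \<nu> \<in> borel \<rightarrow>\<^sub>M subprob_algebra borel"
    by (rule measurable_prob_algebraD[OF measurable_total_kernel[OF \<nu>]])
  have lipf: "\<bar>?f x - ?f y\<bar> \<le> \<bar>x - y\<bar>" for x y by (auto simp: min_def max_def abs_if)
  have fm: "?f \<in> borel_measurable borel" by measurable
  have [measurable]: "(\<lambda>t::(nat list, 'a) mgraph. \<integral>w. ?f w \<partial>total_kernel \<nu> (mark t x)) \<in> borel_measurable mgraph_space" for x
    by (rule measurable_compose[OF _ measurable_compose[OF sub integral_measurable_subprob_algebra[OF fm]]]) measurable
  note [measurable] = measurable_tree_shape
  define P where "P x m t \<longleftrightarrow> (x \<in> verts t \<longrightarrow> (\<Sum>r<indeg t x. mweight (mark t x) r) \<le> c + ?e m \<and>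
     (\<integral>w. ?f w \<partial>total_kernel \<nu> (mark t x)) \<le> \<bar>K\<bar> * ?e m)" for x m and t :: "(nat list, 'a) mgraph"
  have "AE t in \<tau>. P x m t" for x m
  \<comment> \<open>The component has to contain x. The strong coupling is given for depths at least
    1, so for the root the depth is raised to 1.\<close>
  proof (rule AE_limit_tree[where k="max 1 (length x)" and \<epsilon>="?e m"])
    show "Measurable.pred mgraph_space (P x m)" unfolding P_def by measurable
    fix n g i and t :: "(nat list, 'a) mgraph"
    assume g: "good_graph c \<nu> n g" and i: "i \<in> {1..n}" and t: "tree_shape t"
      and close: "close_in_comp (max 1 (length x)) (?e m) t [] g i"
    have e: "?e m < 1" "0 \<le> ?e m" by auto
    have sg: "substochastic_graph c g" and ig: "i \<in> verts g" using g i by (auto simp: good_graph_def)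
    obtain \<theta> where \<theta>: "\<theta> ` depth_verts t (max 1 (length x)) \<subseteq> verts g"
      "\<And>x'. x' \<in> depth_verts t (max 1 (length x)) \<Longrightarrow> indeg g (\<theta> x') = indeg t x'"
      "\<And>x'. x' \<in> depth_verts t (max 1 (length x)) \<Longrightarrow> mark_dist (mark g (\<theta> x')) (mark t x') \<le> ?e m"
      by (rule close_in_comp_embedding[OF t sg ig close e(1)]) blast
    show "P x m t" unfolding P_def
    proof (intro impI conjI)
      assume x: "x \<in> verts t"
      then have xD: "x \<in> depth_verts t (max 1 (length x))" by (simp add: depth_verts_def)
      let ?y = "\<theta> x"
      have y: "?y \<in> verts g" using \<theta>(1) xD by blast
      have md: "mark_dist (mark g ?y) (mark t x) \<le> ?e m" by (rule \<theta>(3)[OF xD])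
      then have wd: "(\<Sum>r<indeg t x. \<bar>mweight (mark g ?y) r - mweight (mark t x) r\<bar>) \<le> ?e m"
        using mark_dist_weights(2)[of "mark g ?y" "mark t x"] e(1) unfolding indeg_def by linarith
      have "(\<Sum>r<indeg t x. mweight (mark t x) r)
        \<le> (\<Sum>r<indeg t x. mweight (mark g ?y) r + \<bar>mweight (mark g ?y) r - mweight (mark t x) r\<bar>)"
        by (intro sum_mono) linarith
      also have "\<dots> \<le> c + ?e m"
        unfolding sum.distrib using sg y \<theta>(2)[OF xD] wd
        by (intro add_mono) (auto simp: substochastic_graph_def)
      finally show "(\<Sum>r<indeg t x. mweight (mark t x) r) \<le> c + ?e m" .
      interpret g: real_distribution "total_kernel \<nu> (mark g ?y)" by (rule real_distribution_total_kernel[OF \<nu>])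
      interpret t: real_distribution "total_kernel \<nu> (mark t x)" by (rule real_distribution_total_kernel[OF \<nu>])
      have "AE w in total_kernel \<nu> (mark g ?y). \<bar>w\<bar> \<le> 1"
        using g y by (intro total_kernel_AE_bounded[OF \<nu>]) (auto simp: good_graph_def)
      then have "AE w in total_kernel \<nu> (mark g ?y). ?f w = 0" by eventually_elim simp
      then have "(\<integral>w. ?f w \<partial>total_kernel \<nu> (mark g ?y)) = 0" by (rule integral_eq_zero_AE)
      moreover have "norm ((\<integral>w. ?f w \<partial>total_kernel \<nu> (mark g ?y)) - (\<integral>w. ?f w \<partial>total_kernel \<nu> (mark t x))) \<le> 1 * (\<bar>K\<bar> * ?e m)"
      proof (rule wasserstein1_lipschitz[where B=1])
        show "wasserstein1 (total_kernel \<nu> (mark g ?y)) (total_kernel \<nu> (mark t x)) \<le> ennreal (\<bar>K\<bar> * ?e m)"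
          using sg y tree_mark[OF t x] by (intro wasserstein_close md) (auto simp: substochastic_graph_def)
      qed (use fm lipf in \<open>auto intro: g.prob_space_axioms t.prob_space_axioms\<close>)
      ultimately show "(\<integral>w. ?f w \<partial>total_kernel \<nu> (mark t x)) \<le> \<bar>K\<bar> * ?e m" by simp
    qed
  qed simp_all
  then have "AE t in \<tau>. \<forall>x m. P x m t" by (simp add: AE_all_countable)
  then show ?thesis using tree
  proof eventually_elim
    case (elim t)
    have lim: "?e \<longlonglongrightarrow> 0" by real_asymp
    show ?case unfolding good_tree_def
    proof (intro conjI ballI elim)
      fix x assume x: "x \<in> verts t"
      have P: "(\<Sum>r<indeg t x. mweight (mark t x) r) \<le> c + ?e m"
         "(\<integral>w. ?f w \<partial>total_kernel \<nu> (mark t x)) \<le> \<bar>K\<bar> * ?e m" for m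
        using elim(1) x by (auto simp: P_def)
      have "(\<lambda>m. c + ?e m) \<longlonglongrightarrow> c + 0" by (intro tendsto_intros lim)
      then have "(\<Sum>r<indeg t x. mweight (mark t x) r) \<le> c + 0"
        by (rule LIMSEQ_le_const) (use P in blast)
      then show "(\<Sum>r<indeg t x. mweight (mark t x) r) \<le> c" by simp
      have "(\<lambda>m. \<bar>K\<bar> * ?e m) \<longlonglongrightarrow> \<bar>K\<bar> * 0" by (intro tendsto_intros lim)
      then have le: "(\<integral>w. ?f w \<partial>total_kernel \<nu> (mark t x)) \<le> \<bar>K\<bar> * 0"
        by (rule LIMSEQ_le_const) (use P in blast)
      interpret t: real_distribution "total_kernel \<nu> (mark t x)" by (rule real_distribution_total_kernel[OF \<nu>])
      have i: "integrable (total_kernel \<nu> (mark t x)) ?f"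
        by (rule t.integrable_const_bound[where B=1]) auto
      have "0 \<le> (\<integral>w. ?f w \<partial>total_kernel \<nu> (mark t x))" by (rule Bochner_Integration.integral_nonneg) simp
      with le have "(\<integral>w. ?f w \<partial>total_kernel \<nu> (mark t x)) = 0" by simp
      then have "AE w in total_kernel \<nu> (mark t x). ?f w = 0"
        using integral_nonneg_eq_0_iff_AE[OF i] by simp
      then have "AE w in total_kernel \<nu> (mark t x). w \<in> {-1..1}"
        by eventually_elim (auto simp: min_def max_def abs_if split: if_splits)
      then show "measure (total_kernel \<nu> (mark t x)) {-1..1} = 1"
        by (subst t.AE_in_set_eq_1[symmetric]) auto
    qed
  qed
qed

text \<open>On the coupled event the two products differ by at most \<epsilon> C, elsewhere by at
  most 2. As C does not depend on \<epsilon>, it can be fixed first, and the coupling is then taken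
  for the resulting \<epsilon>.\<close>

lemma graph_char_tendsto_tree_char:
  assumes k: "1 \<le> k"
  shows "(\<lambda>n. \<integral>z. graph_char c d (total_kernel \<nu>) u k (fst z) (snd z) \<partial>(\<gamma> n \<Otimes>\<^sub>M measure_pmf (pmf_of_set {1..n})))
    \<longlonglongrightarrow> (\<integral>t. tree_char c d (total_kernel \<nu>) u k t \<partial>\<tau>)"
proof (rule tendstoI)
  fix \<eta> :: real assume \<eta>: "0 < \<eta>"
  let ?gc = "graph_char c d (total_kernel \<nu>) u k" and ?tc = "tree_char c d (total_kernel \<nu>) u k"
  define C where "C = \<bar>u\<bar> * (\<Sum>s<k. \<Sum>l=0..k. acoef c d l s * (real l + \<bar>K\<bar>))"
  have C: "0 \<le> C" unfolding C_def
    by (intro mult_nonneg_nonneg sum_nonneg acoef_nonneg[OF d]) auto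
  \<comment> \<open>The embedding requires \<epsilon> < 1; C + 1 avoids a division by 0 and still
    gives \<epsilon> C \<le> \<eta> / 3.\<close>
  define \<epsilon> where "\<epsilon> = min (1/2) (\<eta> / (3 * (C + 1)))"
  have \<epsilon>: "0 < \<epsilon>" "\<epsilon> < 1" using \<eta> C by (auto simp: \<epsilon>_def)
  have "\<epsilon> * C \<le> \<eta> / (3 * (C + 1)) * C" using C by (intro mult_right_mono) (auto simp: \<epsilon>_def)
  also have "\<dots> \<le> \<eta> / 3" using C \<eta> by (simp add: field_simps)
  finally have \<epsilon>C: "\<epsilon> * C \<le> \<eta> / 3" .
  note rd = real_distribution_total_kernel[OF \<nu>]
  obtain \<pi> where \<pi>: "\<And>n. n \<ge> 1 \<Longrightarrow> \<pi> n \<in> couplings (\<gamma> n \<Otimes>\<^sub>M measure_pmf (pmf_of_set {1..n})) \<tau>"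
    and ev: "\<And>\<delta>. 0 < \<delta> \<Longrightarrow> \<forall>\<^sub>F n in sequentially.
       coupled_event k \<epsilon> [] (\<pi> n) \<in> sets (\<pi> n) \<and>
       1 - \<delta> \<le> measure (\<pi> n) (coupled_event k \<epsilon> [] (\<pi> n))"
    by (rule strong_coupling_event[OF sc k \<epsilon>(1) \<gamma>(1)]) (assumption, blast)
  \<comment> \<open>The exceptional event costs twice its probability, at most \<eta> / 6, and
    \<eta> / 3 + \<eta> / 6 < \<eta>.\<close>
  have "0 < \<eta> / 12" using \<eta> by simp
  from ev[OF this] eventually_ge_at_top[of 1]
  show "\<forall>\<^sub>F n in sequentially. dist (\<integral>z. ?gc (fst z) (snd z) \<partial>(\<gamma> n \<Otimes>\<^sub>M measure_pmf (pmf_of_set {1..n}))) (\<integral>t. ?tc t \<partial>\<tau>) < \<eta>"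
  proof eventually_elim
    case (elim n)
    let ?u = "measure_pmf (pmf_of_set {1..n})"
    let ?E = "coupled_event k \<epsilon> [] (\<pi> n)"
    note [simp] = coupled_event_def
    note \<pi>n = \<pi>[OF elim(2)]
    interpret \<pi>: prob_space "\<pi> n" by (rule prob_space_coupling[OF elim(2) \<pi>n])
    have gm: "(\<lambda>z. ?gc (fst z) (snd z)) \<in> borel_measurable (\<gamma> n \<Otimes>\<^sub>M ?u)"
      by (rule measurable_graph_char_vertex[OF \<nu> \<gamma>(2)[OF elim(2)]])
    have tm: "?tc \<in> borel_measurable \<tau>"
      using measurable_tree_char[OF \<nu>] by (simp add: measurable_cong_sets[OF \<tau>(2) refl])
    have n1: "norm (?gc g i) \<le> 1" "norm (?tc t) \<le> 1" for g i t
      by (intro norm_graph_char_le norm_tree_char_le rd)+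
    have m: "(\<lambda>z. ?gc (fst (fst z)) (snd (fst z))) \<in> borel_measurable (\<pi> n)" "(\<lambda>z. ?tc (snd z)) \<in> borel_measurable (\<pi> n)"
      using measurable_compose[OF couplingsD(4)[OF \<pi>n] gm] measurable_compose[OF couplingsD(5)[OF \<pi>n] tm] by simp_all
    have i: "integrable (\<pi> n) (\<lambda>z. ?gc (fst (fst z)) (snd (fst z)))" "integrable (\<pi> n) (\<lambda>z. ?tc (snd z))"
      using m by (auto intro!: \<pi>.integrable_const_bound[where B=1] n1)
    have E: "?E \<in> sets (\<pi> n)" using elim by blast
    have AE: "AE z in \<pi> n. norm (?gc (fst (fst z)) (snd (fst z)) - ?tc (snd z)) \<le> \<epsilon> * C + 2 * indicator (space (\<pi> n) - ?E) z"
    proof -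
      have "AE t in distr (\<pi> n) \<tau> snd. good_tree c \<nu> t" unfolding couplingsD(3)[OF \<pi>n] by (rule AE_good_tree)
      from AE_distrD[OF couplingsD(5)[OF \<pi>n] this] coupling_AE_good[OF elim(2) \<pi>n] AE_space
      show ?thesis
      proof eventually_elim
        case (elim z)
        show ?case
        proof (cases "z \<in> ?E")
          case True
          let ?g = "fst (fst z)" and ?i = "snd (fst z)" and ?t = "snd z"
          have t: "tree_shape ?t" using elim by simp
          have sg: "substochastic_graph c ?g" and ig: "?i \<in> verts ?g" and fin: "finite (verts ?g)"
            using elim by (auto simp: good_graph_def)
          have close: "close_in_comp k \<epsilon> ?t [] ?g ?i" using True by simp
          obtain \<theta> where \<theta>: "\<theta> [] = ?i" "inj_on \<theta> (depth_verts ?t k)" "\<theta> ` depth_verts ?t k \<subseteq> verts ?g"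
            "\<And>x. x \<in> depth_verts ?t k \<Longrightarrow> indeg ?g (\<theta> x) = indeg ?t x"
            "\<And>x. x \<in> depth_verts ?t k \<Longrightarrow> mark_dist (mark ?g (\<theta> x)) (mark ?t x) \<le> \<epsilon>"
            "\<And>x r. x \<in> verts ?t \<Longrightarrow> length x < k \<Longrightarrow> r < indeg ?t x \<Longrightarrow> inn ?g (\<theta> x) r = \<theta> (x @ [r])"
            by (rule close_in_comp_embedding[OF t sg ig close \<epsilon>(2)]) blast
          have "norm (?gc ?g ?i - ?tc ?t) \<le> \<epsilon> * (\<bar>u\<bar> * (\<Sum>s<k. \<Sum>l=0..k. acoef c d l s * (l + \<bar>K\<bar>)))"
          proof (rule graph_char_close_tree_char[OF t _ sg fin c d less_imp_le[OF \<epsilon>(1)] \<epsilon>(2) \<theta> rd])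
            show "(\<Sum>j<indeg ?t x. mweight (mark ?t x) j) \<le> c" if "x \<in> verts ?t" for x
              using elim that by (auto simp: good_tree_def)
            show "AE w in total_kernel \<nu> (mark ?g j). \<bar>w\<bar> \<le> 1" if "j \<in> verts ?g" for j
              using elim that by (intro total_kernel_AE_bounded[OF \<nu>]) (auto simp: good_graph_def)
            show "wasserstein1 (total_kernel \<nu> (mark ?g (\<theta> x))) (total_kernel \<nu> (mark ?t x)) \<le> ennreal (\<bar>K\<bar> * \<epsilon>)"
              if "x \<in> depth_verts ?t k" for x
              using that \<theta>(3) sg tree_mark[OF t, of x]
              by (intro wasserstein_close \<theta>(5)) (auto simp: substochastic_graph_def depth_verts_def)
          qed auto
          then show ?thesis using True by (simp add: C_def)
        next
          case False
          have "norm (?gc (fst (fst z)) (snd (fst z)) - ?tc (snd z)) \<le> 1 + 1"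
            by (rule order_trans[OF norm_triangle_ineq4]) (intro add_mono n1)
          then show ?thesis using False elim \<epsilon>(1) C
            by (simp add: add_increasing)
        qed
      qed
    qed
    have "(\<integral>z. ?gc (fst z) (snd z) \<partial>(\<gamma> n \<Otimes>\<^sub>M ?u)) - (\<integral>t. ?tc t \<partial>\<tau>)
      = (\<integral>z. ?gc (fst (fst z)) (snd (fst z)) - ?tc (snd z) \<partial>\<pi> n)"
      using i coupling_integral(1)[OF \<pi>n gm] coupling_integral(2)[OF \<pi>n tm] by simp
    then have "dist (\<integral>z. ?gc (fst z) (snd z) \<partial>(\<gamma> n \<Otimes>\<^sub>M ?u)) (\<integral>t. ?tc t \<partial>\<tau>)
      \<le> (\<integral>z. norm (?gc (fst (fst z)) (snd (fst z)) - ?tc (snd z)) \<partial>\<pi> n)"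
      by (simp only: dist_norm integral_norm_bound)
    also have "\<dots> \<le> (\<integral>z. \<epsilon> * C + 2 * indicator (space (\<pi> n) - ?E) z \<partial>\<pi> n)"
      using i E AE by (intro integral_mono_AE Bochner_Integration.integrable_add integrable_norm Bochner_Integration.integrable_diff integrable_mult_right
          integrable_real_indicator) (auto simp: less_top[symmetric])
    also have "\<dots> = \<epsilon> * C + 2 * measure (\<pi> n) (space (\<pi> n) - ?E)"
      using E by (subst Bochner_Integration.integral_add) (auto simp: \<pi>.prob_space less_top[symmetric] intro!: integrable_mult_right integrable_real_indicator)
    also have "\<dots> \<le> \<eta> / 3 + 2 * (\<eta> / 12)"
      using \<epsilon>C elim(1) \<pi>.prob_compl[OF E] by (intro add_mono mult_left_mono) auto
    also have "\<dots> < \<eta>" using \<eta> by simp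
    finally show ?case .
  qed
qed

end

section \<open>The signals on the limiting tree\<close>

text \<open>Given Y, the phase is a product of functions of the separate signals, so its conditional
  expectation is a product of characteristic functions. \<open>cond_indep_integral\<close> is about
  real functions and is applied to the real and the imaginary part.\<close>

lemma cond_indep_char:
  fixes \<theta> :: "'i \<Rightarrow> 'y \<Rightarrow> real" and W :: "'i \<Rightarrow> 'w \<Rightarrow> real"
  assumes M: "prob_space M" and Y[measurable]: "Y \<in> M \<rightarrow>\<^sub>M N1" and J: "finite J"
    and W[measurable]: "\<And>i. W i \<in> M \<rightarrow>\<^sub>M borel" and k: "\<And>i. k i \<in> N1 \<rightarrow>\<^sub>M prob_algebra borel"
    and A[measurable]: "A \<in> sets N1"
    and ci: "\<And>B. (\<forall>i\<in>J. B i \<in> sets borel) \<Longrightarrow> AE \<omega> in M. Y \<omega> \<in> A \<longrightarrow>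
      real_cond_exp M (vimage_algebra (space M) Y N1) (indicator {\<omega>\<in>space M. \<forall>i\<in>J. W i \<omega> \<in> B i}) \<omega>
        = (\<Prod>i\<in>J. measure (k i (Y \<omega>)) (B i))"
    and \<theta>[measurable]: "\<And>i. \<theta> i \<in> borel_measurable N1"
  shows "(\<integral>\<omega>. indicator A (Y \<omega>) *\<^sub>R iexp (\<Sum>i\<in>J. \<theta> i (Y \<omega>) * W i \<omega>) \<partial>M)
    = (\<integral>\<omega>. indicator A (Y \<omega>) *\<^sub>R (\<Prod>i\<in>J. char (k i (Y \<omega>)) (\<theta> i (Y \<omega>))) \<partial>M)"
proof -
  interpret prob_space M by fact
  let ?f = "\<lambda>z. iexp (\<Sum>i\<in>J. \<theta> i (fst z) * snd z i)"
  let ?L = "\<lambda>\<omega>. indicator A (Y \<omega>) *\<^sub>R iexp (\<Sum>i\<in>J. \<theta> i (Y \<omega>) * W i \<omega>)"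
  let ?R = "\<lambda>\<omega>. indicator A (Y \<omega>) *\<^sub>R (\<Prod>i\<in>J. char (k i (Y \<omega>)) (\<theta> i (Y \<omega>)))"
  have f[measurable]: "?f \<in> borel_measurable (N1 \<Otimes>\<^sub>M Pi\<^sub>M J (\<lambda>_. borel))" by measurable
  have rd: "real_distribution (k i y)" if "y \<in> space N1" for i y
    using measurable_space[OF k that]
    by (auto simp: space_prob_algebra real_distribution_def real_distribution_axioms_def dest: sets_eq_imp_space_eq)
  have inner: "(\<integral>w. ?f (y, w) \<partial>Pi\<^sub>M J (\<lambda>i. k i y)) = (\<Prod>i\<in>J. char (k i y) (\<theta> i y))"
    "integrable (Pi\<^sub>M J (\<lambda>i. k i y)) (\<lambda>w. ?f (y, w))" if y: "y \<in> space N1" for y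
  proof -
    have ky: "prob_space (k i y)" "sets (k i y) = sets borel" for i
      using measurable_space[OF k y] by (auto simp: space_prob_algebra)
    interpret product_prob_space "\<lambda>i. k i y" J by (intro product_prob_spaceI ky)
    have i: "integrable (k i y) (\<lambda>w. iexp (\<theta> i y * w))" for i
      by (rule M.integrable_const_bound[where B=1]) (auto simp: measurable_cong_sets[OF ky(2) refl])
    have eq: "?f (y, w) = (\<Prod>i\<in>J. iexp (\<theta> i y * w i))" for w
      by (simp add: of_real_sum sum_distrib_left exp_sum[OF J])
    show "(\<integral>w. ?f (y, w) \<partial>Pi\<^sub>M J (\<lambda>i. k i y)) = (\<Prod>i\<in>J. char (k i y) (\<theta> i y))"
      unfolding eq char_def by (rule product_integral_prod[OF J i])
    show "integrable (Pi\<^sub>M J (\<lambda>i. k i y)) (\<lambda>w. ?f (y, w))"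
      unfolding eq by (rule product_integrable_prod[OF J i])
  qed
  have L: "integrable M ?L"
    by (rule integrable_const_bound[where B=1]) (auto simp: indicator_def)
  have R: "integrable M ?R"
  proof (rule integrable_const_bound[where B=1])
    show "?R \<in> borel_measurable M"
      by (intro borel_measurable_scaleR borel_measurable_prod measurable_char measurable_compose[OF Y k]) measurable
    have "norm (\<Prod>i\<in>J. char (k i (Y \<omega>)) (\<theta> i (Y \<omega>))) \<le> 1" if "\<omega> \<in> space M" for \<omega>
      by (intro norm_prod_char_le rd measurable_space[OF Y that])
    then show "AE \<omega> in M. norm (?R \<omega>) \<le> 1" by (intro AE_I2) (auto simp: indicator_def)
  qed
  have part: "h (\<integral>\<omega>. ?L \<omega> \<partial>M) = h (\<integral>\<omega>. ?R \<omega> \<partial>M)"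
    if h: "bounded_linear h" "\<And>z. \<bar>h z\<bar> \<le> norm z" for h :: "complex \<Rightarrow> real"
  proof -
    interpret h: bounded_linear h by (rule h)
    have [measurable]: "h \<in> borel_measurable borel"
      by (intro borel_measurable_continuous_onI linear_continuous_on h)
    have bnd: "\<bar>h (?f z)\<bar> \<le> 1" for z using h(2)[of "?f z"] by simp
    have "h (\<integral>\<omega>. ?L \<omega> \<partial>M) = (\<integral>\<omega>. indicator A (Y \<omega>) * h (?f (Y \<omega>, \<lambda>i\<in>J. W i \<omega>)) \<partial>M)"
      unfolding integral_bounded_linear[OF h(1) L, symmetric]
      by (intro Bochner_Integration.integral_cong) (auto simp: h.scaleR)
    also have "\<dots> = (\<integral>\<omega>. indicator A (Y \<omega>) * (\<integral>w. h (?f (Y \<omega>, w)) \<partial>Pi\<^sub>M J (\<lambda>i. k i (Y \<omega>))) \<partial>M)"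
      by (rule cond_indep_integral[OF M Y J W k A ci _ bnd]) measurable
    also have "\<dots> = h (\<integral>\<omega>. ?R \<omega> \<partial>M)"
      unfolding integral_bounded_linear[OF h(1) R, symmetric]
    proof (intro Bochner_Integration.integral_cong refl)
      fix \<omega> assume "\<omega> \<in> space M"
      then have y: "Y \<omega> \<in> space N1" by (rule measurable_space[OF Y])
      show "indicator A (Y \<omega>) * (\<integral>w. h (?f (Y \<omega>, w)) \<partial>Pi\<^sub>M J (\<lambda>i. k i (Y \<omega>))) = h (?R \<omega>)"
        by (simp only: integral_bounded_linear[OF h(1) inner(2)[OF y]] inner(1)[OF y] h.scaleR real_scaleR_def)
    qed
    finally show ?thesis .
  qed
  show ?thesis
    using part[OF bounded_linear_Re abs_Re_le_cmod] part[OF bounded_linear_Im abs_Im_le_cmod]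
    by (simp add: complex_eq_iff)
qed

section \<open>The series on the random tree\<close>

context
  fixes c d :: real and \<nu> :: "'a::polish_space mark \<Rightarrow> real measure"
    and T :: "'t measure" and \<G> :: "'t \<Rightarrow> (nat list, 'a) mgraph" and \<W> :: "nat list \<Rightarrow> nat \<Rightarrow> 't \<Rightarrow> real"
  assumes c: "0 \<le> c" and d: "0 < d" "d \<le> 1" "c + d \<le> 1"
    and \<nu>: "\<nu> \<in> restrict_space borel mark_space \<rightarrow>\<^sub>M prob_algebra borel"
    and T: "prob_space T" and \<G>: "\<G> \<in> T \<rightarrow>\<^sub>M mgraph_space"
    and signals: "cond_indep_with_laws T (vimage_algebra (space T) \<G> mgraph_space)
           (\<lambda>\<omega>. verts (\<G> \<omega>) \<times> UNIV) borel
           (\<lambda>(i, k). \<W> i k) (\<lambda>(i, k) \<omega>. \<nu> (mark (\<G> \<omega>) i))"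
    and good: "AE \<omega> in T. good_tree c \<nu> (\<G> \<omega>)"
begin

interpretation T: prob_space T by (rule T)

lemma measurable_signal [measurable]: "\<W> i k \<in> borel_measurable T"
  using signals unfolding cond_indep_with_laws_def by (auto split: prod.splits)

lemma signals_cond_law:
  assumes J: "finite J" and B: "\<forall>z\<in>J. B z \<in> sets borel"
  shows "AE \<omega> in T. good_tree c \<nu> (\<G> \<omega>) \<and> fst ` J \<subseteq> verts (\<G> \<omega>) \<longrightarrow>
    real_cond_exp T (vimage_algebra (space T) \<G> mgraph_space) (indicator {\<omega>\<in>space T. \<forall>z\<in>J. \<W> (fst z) (snd z) \<omega> \<in> B z}) \<omega>
      = (\<Prod>z\<in>J. measure (total_kernel \<nu> (mark (\<G> \<omega>) (fst z))) (B z))"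
proof -
  have "AE \<omega> in T. J \<subseteq> verts (\<G> \<omega>) \<times> UNIV \<longrightarrow>
    real_cond_exp T (vimage_algebra (space T) \<G> mgraph_space) (indicator {\<omega>\<in>space T. \<forall>z\<in>J. \<W> (fst z) (snd z) \<omega> \<in> B z}) \<omega>
      = (\<Prod>z\<in>J. measure (\<nu> (mark (\<G> \<omega>) (fst z))) (B z))"
    using signals J B unfolding cond_indep_with_laws_def case_prod_beta' by blast
  then show ?thesis
  proof eventually_elim
    case (elim \<omega>)
    show ?case
    proof
      assume *: "good_tree c \<nu> (\<G> \<omega>) \<and> fst ` J \<subseteq> verts (\<G> \<omega>)"
      have "J \<subseteq> verts (\<G> \<omega>) \<times> UNIV" using * by force
      moreover have "(\<Prod>z\<in>J. measure (\<nu> (mark (\<G> \<omega>) (fst z))) (B z)) = (\<Prod>z\<in>J. measure (total_kernel \<nu> (mark (\<G> \<omega>) (fst z))) (B z))"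
        using * tree_mark[of "\<G> \<omega>"] by (intro prod.cong refl, subst total_kernel_eq) (auto simp: good_tree_def)
      ultimately show "real_cond_exp T (vimage_algebra (space T) \<G> mgraph_space) (indicator {\<omega>\<in>space T. \<forall>z\<in>J. \<W> (fst z) (snd z) \<omega> \<in> B z}) \<omega>
      = (\<Prod>z\<in>J. measure (total_kernel \<nu> (mark (\<G> \<omega>) (fst z))) (B z))" using elim by simp
    qed
  qed
qed

text \<open>For a fixed node and time, the conditional probability of leaving [-1,1] is 0 wherever
  the node exists. Existence of the node is determined by the tree, so the conditional probability
  may be integrated over that event.\<close>

lemma AE_signal_bounded: "AE \<omega> in T. \<forall>x\<in>verts (\<G> \<omega>). \<forall>s. \<bar>\<W> x s \<omega>\<bar> \<le> 1"
proof -
  let ?F = "vimage_algebra (space T) \<G> mgraph_space"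
  have sub: "subalgebra T ?F" by (rule subalgebra_vimage_mgraph[OF \<G>])
  note [measurable] = \<G>
  have "AE \<omega> in T. x \<in> verts (\<G> \<omega>) \<longrightarrow> \<bar>\<W> x s \<omega>\<bar> \<le> 1" for x s
  proof -
    define H where "H = {\<omega>\<in>space T. x \<in> verts (\<G> \<omega>)}"
    \<comment> \<open>The quantifier over a one-element set gives D the form of the events in
      \<open>signals_cond_law\<close>.\<close>
    define D where "D = {\<omega>\<in>space T. \<forall>z\<in>{(x, s)}. \<W> (fst z) (snd z) \<omega> \<in> - {-1..1}}"
    have D: "D \<in> sets T" unfolding D_def by measurable
    have "\<G> -` {g. x \<in> verts g} \<inter> space T \<in> sets ?F"
    proof (rule in_vimage_algebra)
      have "Measurable.pred mgraph_space (\<lambda>g::(nat list, 'a) mgraph. x \<in> verts g)" by measurable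
      then show "{g. x \<in> verts g} \<in> sets (mgraph_space :: (nat list, 'a) mgraph measure)" by (simp add: pred_def)
    qed
    also have "\<G> -` {g. x \<in> verts g} \<inter> space T = H" by (auto simp: H_def)
    finally have HF: "H \<in> sets ?F" .
    have H: "H \<in> sets T" unfolding H_def by measurable
    have "measure T (H \<inter> D) = (\<integral>\<omega>\<in>H. real_cond_exp T ?F (indicator D) \<omega> \<partial>T)"
      by (rule measure_eq_cond_exp(1)[OF T sub D HF])
    also have "\<dots> = 0"
      unfolding set_lebesgue_integral_def
    proof (rule integral_eq_zero_AE)
      have "AE \<omega> in T. good_tree c \<nu> (\<G> \<omega>) \<and> fst ` {(x, s)} \<subseteq> verts (\<G> \<omega>) \<longrightarrow>
        real_cond_exp T ?F (indicator D) \<omega> = (\<Prod>z\<in>{(x, s)}. measure (total_kernel \<nu> (mark (\<G> \<omega>) (fst z))) (- {-1..1}))"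
        unfolding D_def by (rule signals_cond_law) auto
      then show "AE \<omega> in T. indicator H \<omega> *\<^sub>R real_cond_exp T ?F (indicator D) \<omega> = 0"
        using good
      proof eventually_elim
        case (elim \<omega>)
        show ?case
        proof (cases "x \<in> verts (\<G> \<omega>)")
          case True
          interpret k: real_distribution "total_kernel \<nu> (mark (\<G> \<omega>) x)" by (rule real_distribution_total_kernel[OF \<nu>])
          have "measure (total_kernel \<nu> (mark (\<G> \<omega>) x)) {-1..1} = 1" using elim True by (auto simp: good_tree_def)
          then have "measure (total_kernel \<nu> (mark (\<G> \<omega>) x)) (- {-1..1}) = 0"
            using k.prob_compl[of "{-1..1}"] by (simp add: Compl_eq_Diff_UNIV)
          then show ?thesis using elim True by simp
        qed (simp add: H_def)
      qed
    qed
    finally have "H \<inter> D \<in> null_sets T" using H D by (auto simp: null_sets_def T.emeasure_eq_measure)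
    from AE_not_in[OF this] AE_space show ?thesis
      by eventually_elim (auto simp: H_def D_def)
  qed
  then have "AE \<omega> in T. \<forall>x s. x \<in> verts (\<G> \<omega>) \<longrightarrow> \<bar>\<W> x s \<omega>\<bar> \<le> 1"
    by (intro AE_all_countable[THEN iffD2] allI)
  then show ?thesis by eventually_elim blast
qed

lemma AE_opinion_term_bound: "AE \<omega> in T. \<forall>s. \<bar>opinion_term c d (\<G> \<omega>) (\<lambda>j s. \<W> j s \<omega>) s\<bar> \<le> (1 - d) ^ s"
  using good AE_signal_bounded
proof eventually_elim
  case (elim \<omega>)
  show ?case
    by (intro allI opinion_term_bound) (use elim c d in \<open>auto simp: good_tree_def\<close>)
qed

lemma AE_summable_opinion_term: "AE \<omega> in T. summable (opinion_term c d (\<G> \<omega>) (\<lambda>j s. \<W> j s \<omega>))"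
  using AE_opinion_term_bound
proof eventually_elim
  case (elim \<omega>)
  have "summable (\<lambda>s. (1 - d) ^ s)" using d by (intro summable_geometric) auto
  then show ?case by (rule summable_comparison_test'[where N=0]) (use elim in auto)
qed

text \<open>The set of nodes up to depth k is random, whereas \<open>cond_indep_char\<close> works
  with a fixed finite index set. The space is therefore split according to the value D of this set;
  the equality is shown on each piece, and the pieces are put together by dominated
  convergence.\<close>

lemma char_partial_sum:
  "(\<integral>\<omega>. iexp (u * (\<Sum>s<k. opinion_term c d (\<G> \<omega>) (\<lambda>j s. \<W> j s \<omega>) s)) \<partial>T)
    = (\<integral>\<omega>. tree_char c d (total_kernel \<nu>) u k (\<G> \<omega>) \<partial>T)"
proof -
  note [measurable] = \<G>
  let ?S = "\<lambda>\<omega>. \<Sum>s<k. opinion_term c d (\<G> \<omega>) (\<lambda>j s. \<W> j s \<omega>) s"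
  let ?tc = "tree_char c d (total_kernel \<nu>) u k"
  let ?h = "\<lambda>\<omega>. iexp (u * ?S \<omega>) - ?tc (\<G> \<omega>)"
  define A where "A D = {g. good_tree c \<nu> g \<and> depth_verts g k = D}" for D
  have A: "A D \<in> sets mgraph_space" for D
  proof -
    note [measurable] = measurable_good_tree[OF \<nu>]
    have "A D = {g\<in>space mgraph_space. good_tree c \<nu> g \<and> (\<forall>x. x \<in> verts g \<and> length x \<le> k \<longleftrightarrow> x \<in> D)}"
      by (auto simp: A_def depth_verts_def)
    also have "\<dots> \<in> sets mgraph_space" by measurable
    finally show ?thesis .
  qed
  have [measurable]: "(\<lambda>\<omega>. opinion_term c d (\<G> \<omega>) (\<lambda>j s. \<W> j s \<omega>) s) \<in> borel_measurable T" for s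
    by (intro measurable_opinion_term) measurable
  have Sm: "(\<lambda>\<omega>. iexp (u * ?S \<omega>)) \<in> borel_measurable T" by measurable
  have tcm: "(\<lambda>\<omega>. ?tc (\<G> \<omega>)) \<in> borel_measurable T"
    by (rule measurable_compose[OF \<G> measurable_tree_char[OF \<nu>]])
  have n1: "norm (?tc t) \<le> 1" for t by (intro norm_tree_char_le real_distribution_total_kernel[OF \<nu>])
  have i1: "integrable T (\<lambda>\<omega>. iexp (u * ?S \<omega>))" by (rule T.integrable_const_bound[OF _ Sm, where B=1]) simp
  have i2: "integrable T (\<lambda>\<omega>. ?tc (\<G> \<omega>))" by (rule T.integrable_const_bound[where B=1]) (use n1 tcm in auto)
  let ?i = "\<lambda>D \<omega>. indicator (A D) (\<G> \<omega>) :: real"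
  let ?k = "\<lambda>\<omega> x. total_kernel \<nu> (mark (\<G> \<omega>) x)"
  have iA: "integrable T (\<lambda>\<omega>. ?i D \<omega> *\<^sub>R ?h \<omega>)" for D
  proof (rule T.integrable_const_bound[where B=2])
    have "norm (?h \<omega>) \<le> 2" for \<omega>
      using norm_triangle_ineq4[of "iexp (u * ?S \<omega>)" "?tc (\<G> \<omega>)"] n1[of "\<G> \<omega>"] by simp
    then show "AE \<omega> in T. norm (?i D \<omega> *\<^sub>R ?h \<omega>) \<le> 2" by (auto simp: indicator_def)
    show "(\<lambda>\<omega>. ?i D \<omega> *\<^sub>R ?h \<omega>) \<in> borel_measurable T"
      by (intro borel_measurable_scaleR borel_measurable_diff Sm tcm measurable_compose[OF \<G> borel_measurable_indicator[OF A]])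
  qed
  have zero: "(\<integral>\<omega>. ?i D \<omega> *\<^sub>R ?h \<omega> \<partial>T) = 0" for D
  proof (cases "finite D")
    case False
    \<comment> \<open>A good tree has finitely many nodes up to depth k, so an infinite D cannot
      occur.\<close>
    have "A D = {}"
    proof (intro equals0I)
      fix g assume "g \<in> A D"
      then show False using False finite_depth_verts[of g k] by (auto simp: A_def good_tree_def)
    qed
    then show ?thesis by simp
  next
    case True
    let ?J = "D \<times> {..<k}"
    let ?\<theta> = "\<lambda>z g. u * path_weight g (fst z) * acoef c d (length (fst z)) (snd z)"
    have "(\<integral>\<omega>. ?i D \<omega> *\<^sub>R iexp (\<Sum>z\<in>?J. ?\<theta> z (\<G> \<omega>) * \<W> (fst z) (snd z) \<omega>) \<partial>T)
      = (\<integral>\<omega>. ?i D \<omega> *\<^sub>R (\<Prod>z\<in>?J. char (?k \<omega> (fst z)) (?\<theta> z (\<G> \<omega>))) \<partial>T)"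
    proof (rule cond_indep_char[OF T \<G> _ _ _ A])
      show "(\<lambda>g. total_kernel \<nu> (mark g (fst z))) \<in> mgraph_space \<rightarrow>\<^sub>M prob_algebra borel" for z :: "nat list \<times> nat"
        by (rule measurable_compose[OF _ measurable_total_kernel[OF \<nu>]]) measurable
      fix B :: "nat list \<times> nat \<Rightarrow> real set" assume "\<forall>z\<in>?J. B z \<in> sets borel"
      with True have "AE \<omega> in T. good_tree c \<nu> (\<G> \<omega>) \<and> fst ` ?J \<subseteq> verts (\<G> \<omega>) \<longrightarrow>
        real_cond_exp T (vimage_algebra (space T) \<G> mgraph_space) (indicator {\<omega>\<in>space T. \<forall>z\<in>?J. \<W> (fst z) (snd z) \<omega> \<in> B z}) \<omega>
          = (\<Prod>z\<in>?J. measure (?k \<omega> (fst z)) (B z))"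
        by (intro signals_cond_law) auto
      then show "AE \<omega> in T. \<G> \<omega> \<in> A D \<longrightarrow>
        real_cond_exp T (vimage_algebra (space T) \<G> mgraph_space) (indicator {\<omega>\<in>space T. \<forall>z\<in>?J. \<W> (fst z) (snd z) \<omega> \<in> B z}) \<omega>
          = (\<Prod>z\<in>?J. measure (?k \<omega> (fst z)) (B z))"
      proof eventually_elim
        case (elim \<omega>)
        have "fst ` ?J \<subseteq> verts (\<G> \<omega>)" if "\<G> \<omega> \<in> A D" using that by (auto simp: A_def depth_verts_def)
        then show ?case using elim by (auto simp: A_def)
      qed
    qed (use True in auto)
    also have "(\<integral>\<omega>. ?i D \<omega> *\<^sub>R iexp (\<Sum>z\<in>?J. ?\<theta> z (\<G> \<omega>) * \<W> (fst z) (snd z) \<omega>) \<partial>T)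
       = (\<integral>\<omega>. ?i D \<omega> *\<^sub>R iexp (u * ?S \<omega>) \<partial>T)"
    proof (rule Bochner_Integration.integral_cong[OF refl])
      fix \<omega>
      have "u * ?S \<omega> = (\<Sum>z\<in>?J. ?\<theta> z (\<G> \<omega>) * \<W> (fst z) (snd z) \<omega>)" if "\<G> \<omega> \<in> A D"
      proof -
        have t: "tree_shape (\<G> \<omega>)" and D: "depth_verts (\<G> \<omega>) k = D" using that by (auto simp: A_def good_tree_def)
        have "u * ?S \<omega> = (\<Sum>s<k. \<Sum>x\<in>D. ?\<theta> (x, s) (\<G> \<omega>) * \<W> x s \<omega>)"
          by (simp add: opinion_term_depth_verts[OF t, of _ k] D sum_distrib_left mult.assoc)
        also have "\<dots> = (\<Sum>x\<in>D. \<Sum>s<k. ?\<theta> (x, s) (\<G> \<omega>) * \<W> x s \<omega>)" by (rule sum.swap)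
        also have "\<dots> = (\<Sum>z\<in>?J. ?\<theta> z (\<G> \<omega>) * \<W> (fst z) (snd z) \<omega>)"
          by (simp add: sum.cartesian_product case_prod_beta')
        finally show ?thesis .
      qed
      then show "?i D \<omega> *\<^sub>R iexp (\<Sum>z\<in>?J. ?\<theta> z (\<G> \<omega>) * \<W> (fst z) (snd z) \<omega>) = ?i D \<omega> *\<^sub>R iexp (u * ?S \<omega>)"
        by (cases "\<G> \<omega> \<in> A D") (simp_all del: of_real_sum of_real_mult)
    qed
    also have "(\<integral>\<omega>. ?i D \<omega> *\<^sub>R (\<Prod>z\<in>?J. char (?k \<omega> (fst z)) (?\<theta> z (\<G> \<omega>))) \<partial>T)
       = (\<integral>\<omega>. ?i D \<omega> *\<^sub>R ?tc (\<G> \<omega>) \<partial>T)"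
    proof (rule Bochner_Integration.integral_cong[OF refl])
      fix \<omega>
      have "?tc (\<G> \<omega>) = (\<Prod>z\<in>?J. char (?k \<omega> (fst z)) (?\<theta> z (\<G> \<omega>)))" if "\<G> \<omega> \<in> A D"
      proof -
        have D: "depth_verts (\<G> \<omega>) k = D" using that by (auto simp: A_def good_tree_def)
        have "?tc (\<G> \<omega>) = (\<Prod>x\<in>D. \<Prod>s<k. char (?k \<omega> x) (?\<theta> (x, s) (\<G> \<omega>)))"
          unfolding tree_char_def D by (simp add: prod.swap[of _ D])
        also have "\<dots> = (\<Prod>z\<in>?J. char (?k \<omega> (fst z)) (?\<theta> z (\<G> \<omega>)))"
          by (simp add: prod.cartesian_product case_prod_beta')
        finally show ?thesis .
      qed
      then show "?i D \<omega> *\<^sub>R (\<Prod>z\<in>?J. char (?k \<omega> (fst z)) (?\<theta> z (\<G> \<omega>))) = ?i D \<omega> *\<^sub>R ?tc (\<G> \<omega>)"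
        by (cases "\<G> \<omega> \<in> A D") simp_all
    qed
    finally have "(\<integral>\<omega>. ?i D \<omega> *\<^sub>R iexp (u * ?S \<omega>) \<partial>T) = (\<integral>\<omega>. ?i D \<omega> *\<^sub>R ?tc (\<G> \<omega>) \<partial>T)" .
    moreover have "integrable T (\<lambda>\<omega>. ?i D \<omega> *\<^sub>R iexp (u * ?S \<omega>))" "integrable T (\<lambda>\<omega>. ?i D \<omega> *\<^sub>R ?tc (\<G> \<omega>))"
      using i1 i2 measurable_compose[OF \<G> borel_measurable_indicator[OF A]] n1
      by (auto intro!: T.integrable_const_bound[where B=1] borel_measurable_scaleR tcm Sm simp: indicator_def)
    ultimately show ?thesis by (simp add: scaleR_diff_right)
  qed
  \<comment> \<open>Finite sets increasing to the set of all labels. \<open>X N\<close> has only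
    finitely many subsets D, so \<open>p N\<close> is a finite sum, and it equals the full integrand
    on a good tree as soon as \<open>X N\<close> contains the random node set.\<close>
  define X where "X N = {x::nat list. to_nat x < N}" for N
  have finX: "finite (X N)" for N
  proof -
    have "X N = to_nat -` {..<N}" by (auto simp: X_def)
    then show ?thesis by (simp add: finite_vimageI inj_to_nat)
  qed
  define p where "p N \<omega> = (\<Sum>D\<in>Pow (X N). ?i D \<omega> *\<^sub>R ?h \<omega>)" for N \<omega>
  have p: "p N \<omega> = (if good_tree c \<nu> (\<G> \<omega>) \<and> depth_verts (\<G> \<omega>) k \<subseteq> X N then ?h \<omega> else 0)" for N \<omega>
  proof -
    have "p N \<omega> = (\<Sum>D\<in>Pow (X N). if D = depth_verts (\<G> \<omega>) k then (if good_tree c \<nu> (\<G> \<omega>) then ?h \<omega> else 0) else 0)"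
      unfolding p_def by (intro sum.cong) (auto simp: A_def)
    then show ?thesis using finX[of N] by simp
  qed
  have "(\<lambda>N. \<integral>\<omega>. p N \<omega> \<partial>T) \<longlonglongrightarrow> (\<integral>\<omega>. ?h \<omega> \<partial>T)"
  proof (rule integral_dominated_convergence[where w="\<lambda>\<omega>. norm (?h \<omega>)"])
    show "?h \<in> borel_measurable T" using i1 i2 by (intro borel_measurable_diff borel_measurable_integrable)
    show "p N \<in> borel_measurable T" for N
      unfolding p_def using iA by (intro borel_measurable_sum) (rule borel_measurable_integrable)
    show "integrable T (\<lambda>\<omega>. norm (?h \<omega>))" using i1 i2 by (intro integrable_norm Bochner_Integration.integrable_diff)
    show "AE \<omega> in T. norm (p N \<omega>) \<le> norm (?h \<omega>)" for N by (simp add: p)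
    show "AE \<omega> in T. (\<lambda>N. p N \<omega>) \<longlonglongrightarrow> ?h \<omega>"
      using good
    proof eventually_elim
      case (elim \<omega>)
      have "finite (to_nat ` depth_verts (\<G> \<omega>) k)" using elim by (auto simp: good_tree_def finite_depth_verts)
      then obtain N0 where "\<forall>y\<in>to_nat ` depth_verts (\<G> \<omega>) k. y < N0"
        unfolding finite_nat_set_iff_bounded by blast
      then have "depth_verts (\<G> \<omega>) k \<subseteq> X N" if "N \<ge> N0" for N using that by (force simp: X_def)
      then have "\<forall>\<^sub>F N in sequentially. p N \<omega> = ?h \<omega>"
        using elim unfolding p by (auto simp: eventually_sequentially)
      then show ?case by (rule tendsto_eventually)
    qed
  qed
  moreover have "(\<integral>\<omega>. p N \<omega> \<partial>T) = 0" for N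
    unfolding p_def using iA zero by (subst Bochner_Integration.integral_sum) auto
  ultimately have "(\<lambda>N::nat. 0) \<longlonglongrightarrow> (\<integral>\<omega>. ?h \<omega> \<partial>T)" by (simp only:)
  then have "(\<integral>\<omega>. ?h \<omega> \<partial>T) = 0" by (rule LIMSEQ_unique) (rule tendsto_const)
  then show ?thesis using i1 i2 by simp
qed

text \<open>The partial sums converge almost surely and their phases have modulus 1, so dominated
  convergence applies.\<close>

lemma char_partial_sum_tendsto:
  "(\<lambda>k. \<integral>\<omega>. tree_char c d (total_kernel \<nu>) u k (\<G> \<omega>) \<partial>T)
    \<longlonglongrightarrow> char (distr T borel (\<lambda>\<omega>. \<Sum>s. opinion_term c d (\<G> \<omega>) (\<lambda>j s. \<W> j s \<omega>) s)) u"
proof -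
  note [measurable] = \<G>
  let ?t = "\<lambda>\<omega>. opinion_term c d (\<G> \<omega>) (\<lambda>j s. \<W> j s \<omega>)"
  have tm[measurable]: "(\<lambda>\<omega>. ?t \<omega> s) \<in> borel_measurable T" for s
    by (intro measurable_opinion_term) measurable
  have "(\<lambda>k. \<integral>\<omega>. iexp (u * (\<Sum>s<k. ?t \<omega> s)) \<partial>T) \<longlonglongrightarrow> (\<integral>\<omega>. iexp (u * (\<Sum>s. ?t \<omega> s)) \<partial>T)"
  proof (rule integral_dominated_convergence[where w="\<lambda>_. 1"])
    show "AE \<omega> in T. (\<lambda>k. iexp (u * (\<Sum>s<k. ?t \<omega> s))) \<longlonglongrightarrow> iexp (u * (\<Sum>s. ?t \<omega> s))"
      using AE_summable_opinion_term
    proof eventually_elim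
      case (elim \<omega>)
      then show ?case by (intro tendsto_intros summable_LIMSEQ)
    qed
  qed auto
  then show ?thesis
    unfolding char_partial_sum char_def by (subst integral_distr) auto
qed

end

section \<open>The stationary opinion of a typical vertex\<close>

lemma graph_char_total_kernel:
  assumes "substochastic_graph c' g"
  shows "graph_char c d (total_kernel \<nu>) u t g i = graph_char c d \<nu> u t g i"
  using assms unfolding graph_char_def by (intro prod.cong refl) (simp add: substochastic_graph_def)

abbreviation (input) opinion_space :: "nat \<Rightarrow> (nat \<Rightarrow> real) measure" where
  "opinion_space n \<equiv> Pi\<^sub>M {1..n} (\<lambda>_. borel)"

section \<open>Opinions on the graph of a fixed size n\<close>

context
  fixes c d :: real and \<nu> :: "'a::polish_space mark \<Rightarrow> real measure" and n :: nat
    and M :: "'w measure" and G :: "'w \<Rightarrow> (nat, 'a) mgraph"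
    and R :: "'w \<Rightarrow> nat \<Rightarrow> real" and I :: "'w \<Rightarrow> nat" and \<kappa> :: "'w \<Rightarrow> (nat \<Rightarrow> real) measure"
  assumes d: "0 < d" "d \<le> 1" "c + d \<le> 1"
    and \<nu>: "\<nu> \<in> restrict_space borel mark_space \<rightarrow>\<^sub>M prob_algebra borel"
    and M: "prob_space M" and G: "G \<in> M \<rightarrow>\<^sub>M mgraph_space"
    and good: "AE \<omega> in M. good_graph c \<nu> n (G \<omega>)"
    and R: "has_cond_law M (vimage_algebra (space M) G mgraph_space) (Pi\<^sub>M {1..n} (\<lambda>_. borel)) R \<kappa>"
    and stat: "AE \<omega> in M. stationary_opinion_law c d \<nu> (G \<omega>) (\<kappa> \<omega>)"
    and n: "1 \<le> n"
    and I: "I \<in> M \<rightarrow>\<^sub>M count_space UNIV"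
    and unif: "distr M (count_space UNIV \<Otimes>\<^sub>M (mgraph_space \<Otimes>\<^sub>M Pi\<^sub>M {1..n} (\<lambda>_. borel)))
             (\<lambda>\<omega>. (I \<omega>, G \<omega>, R \<omega>))
           = measure_pmf (pmf_of_set {1..n}) \<Otimes>\<^sub>M
             distr M (mgraph_space \<Otimes>\<^sub>M Pi\<^sub>M {1..n} (\<lambda>_. borel)) (\<lambda>\<omega>. (G \<omega>, R \<omega>))"
begin

interpretation M: prob_space M by (rule M)

lemma measurable_opinions: "R \<in> M \<rightarrow>\<^sub>M opinion_space n"
  using R by (simp add: has_cond_law_def)

text \<open>Outside {1..n} a vector of the product space is \<open>undefined\<close>, so the
  coordinate is constant. All i are covered because the random index I is a variable with values in
  all of \<open>nat\<close>, only almost surely in {1..n}.\<close>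

lemma measurable_coordinate: "(\<lambda>r. r i) \<in> borel_measurable (opinion_space n)"
proof (cases "i \<in> {1..n}")
  case False
  then have "(\<lambda>r. r i) \<in> borel_measurable (opinion_space n) \<longleftrightarrow> (\<lambda>r. undefined :: real) \<in> borel_measurable (opinion_space n)"
    by (intro measurable_cong) (auto simp: space_PiM PiE_def extensional_def)
  then show ?thesis by simp
qed measurable

lemma measurable_opinion: "(\<lambda>\<omega>. R \<omega> i) \<in> borel_measurable M"
  by (rule measurable_compose[OF measurable_opinions measurable_coordinate])

lemma measurable_typical_opinion: "(\<lambda>\<omega>. R \<omega> (I \<omega>)) \<in> borel_measurable M"
  by (rule measurable_compose_countable[OF measurable_opinion I])

lemma cond_law_stationary:
  "AE \<omega> in M. prob_space (\<kappa> \<omega>) \<and> sets (\<kappa> \<omega>) = sets (opinion_space n) \<and> (AE x in \<kappa> \<omega>. \<forall>i\<in>{1..n}. x i \<in> {-1..1})"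
  using stat good by eventually_elim (auto simp: stationary_opinion_law_def good_graph_def)

text \<open>The bound holds under almost every conditional law, so its conditional probability is
  almost surely 1 and integrates to 1.\<close>

lemma AE_opinion_bounded: "AE \<omega> in M. \<forall>i\<in>{1..n}. R \<omega> i \<in> {-1..1}"
proof -
  let ?F = "vimage_algebra (space M) G mgraph_space"
  have sub: "subalgebra M ?F" by (rule subalgebra_vimage_mgraph[OF G])
  interpret sigma_finite_subalgebra M ?F using M sub by (rule prob_space_finite_subalgebra)
  let ?B = "{x \<in> space (opinion_space n). \<forall>i\<in>{1..n}. x i \<in> {-1..1}}"
  let ?E = "{\<omega>\<in>space M. R \<omega> \<in> ?B}"
  have B: "?B \<in> sets (opinion_space n)" by measurable
  have E: "?E \<in> sets M" using measurable_sets[OF measurable_opinions B] by (simp add: vimage_def Int_def conj_commute)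
  have "AE \<omega> in M. real_cond_exp M ?F (indicator ?E) \<omega> = measure (\<kappa> \<omega>) ?B"
    using R B unfolding has_cond_law_def by blast
  then have "AE \<omega> in M. real_cond_exp M ?F (indicator ?E) \<omega> = 1"
    using cond_law_stationary
  proof eventually_elim
    case (elim \<omega>)
    interpret k: prob_space "\<kappa> \<omega>" using elim by simp
    have s: "sets (\<kappa> \<omega>) = sets (opinion_space n)" using elim by simp
    have "AE x in \<kappa> \<omega>. \<forall>i\<in>{1..n}. x i \<in> {-1..1}" using elim by simp
    then have "AE x in \<kappa> \<omega>. x \<in> ?B"
      using AE_space by eventually_elim (simp add: sets_eq_imp_space_eq[OF s])
    then have "measure (\<kappa> \<omega>) ?B = 1" using B s by (subst (asm) k.AE_in_set_eq_1) auto
    then show ?case using elim by simp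
  qed
  then have "(\<integral>\<omega>. real_cond_exp M ?F (indicator ?E) \<omega> \<partial>M) = (\<integral>\<omega>. 1 \<partial>M)"
    by (intro integral_cong_AE) auto
  also have "(\<integral>\<omega>. real_cond_exp M ?F (indicator ?E) \<omega> \<partial>M) = measure M ?E"
    by (rule measure_eq_cond_exp(2)[OF M sub E, symmetric])
  finally have "measure M ?E = 1" by (simp add: M.prob_space)
  then have "AE \<omega> in M. \<omega> \<in> ?E" using E by (subst M.AE_in_set_eq_1) auto
  then show ?thesis by eventually_elim auto
qed

lemma measurable_triple:
  "(\<lambda>\<omega>. (I \<omega>, G \<omega>, R \<omega>)) \<in> M \<rightarrow>\<^sub>M count_space UNIV \<Otimes>\<^sub>M (mgraph_space \<Otimes>\<^sub>M opinion_space n)"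
  by (intro measurable_Pair I G measurable_opinions)

lemma AE_vertex: "AE \<omega> in M. I \<omega> \<in> {1..n}"
proof -
  let ?u = "measure_pmf (pmf_of_set {1..n})"
  let ?N = "distr M (mgraph_space \<Otimes>\<^sub>M opinion_space n) (\<lambda>\<omega>. (G \<omega>, R \<omega>))"
  interpret N: prob_space ?N
    by (intro M.prob_space_distr measurable_Pair G measurable_opinions)
  have "AE i in distr (?u \<Otimes>\<^sub>M ?N) ?u fst. i \<in> {1..n}"
    unfolding N.distr_pair_fst using n by (simp add: AE_measure_pmf_iff)
  from AE_distrD[OF measurable_fst this] have "AE z in ?u \<Otimes>\<^sub>M ?N. fst z \<in> {1..n}" .
  from AE_distrD[OF measurable_triple, unfolded unif, OF this] show ?thesis by simp
qed

text \<open>The factor 2 comes from treating real and imaginary parts separately, since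
  \<open>real_cond_exp\<close> acts on real functions.\<close>

lemma stationary_opinion_char:
  assumes i: "i \<in> {1..n}"
  shows "norm ((\<integral>\<omega>. iexp (u * R \<omega> i) \<partial>M) - (\<integral>\<omega>. graph_char c d (total_kernel \<nu>) u t (G \<omega>) i \<partial>M))
    \<le> 2 * (\<bar>u\<bar> * (1 - d) ^ t)"
proof -
  let ?gc = "\<lambda>\<omega>. graph_char c d (total_kernel \<nu>) u t (G \<omega>) i"
  let ?b = "\<bar>u\<bar> * (1 - d) ^ t"
  let ?F = "vimage_algebra (space M) G mgraph_space"
  have sub: "subalgebra M ?F" by (rule subalgebra_vimage_mgraph[OF G])
  interpret sigma_finite_subalgebra M ?F using M sub by (rule prob_space_finite_subalgebra)
  note [measurable] = measurable_opinion measurable_coordinate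
  have gm[measurable]: "?gc \<in> borel_measurable M"
    by (rule measurable_compose[OF G measurable_graph_char[OF \<nu>]])
  have gi: "integrable M ?gc"
    by (rule M.integrable_const_bound[OF _ gm, where B=1]) (simp add: norm_graph_char_le[OF real_distribution_total_kernel[OF \<nu>]])
  have ei: "integrable M (\<lambda>\<omega>. iexp (u * R \<omega> i))"
    by (rule M.integrable_const_bound[where B=1]) auto
  have approx: "AE \<omega> in M. norm ((\<integral>x. iexp (u * x i) \<partial>\<kappa> \<omega>) - ?gc \<omega>) \<le> ?b \<and> integrable (\<kappa> \<omega>) (\<lambda>x. iexp (u * x i))"
    using good stat cond_law_stationary
  proof eventually_elim
    case (elim \<omega>)
    have sg: "substochastic_graph c (G \<omega>)" and V: "verts (G \<omega>) = {1..n}" using elim by (auto simp: good_graph_def)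
    interpret k: prob_space "\<kappa> \<omega>" using elim by simp
    have s: "sets (\<kappa> \<omega>) = sets (opinion_space n)" using elim by simp
    have "norm ((\<integral>x. iexp (u * x i) \<partial>\<kappa> \<omega>) - graph_char c d \<nu> u t (G \<omega>) i) \<le> ?b"
    proof (rule stationary_char_approx[OF _ sg _ _ d(3,2)])
      show "real_distribution (\<nu> (mark (G \<omega>) j))" if "j \<in> verts (G \<omega>)" for j
        using real_distribution_total_kernel[OF \<nu>, of "mark (G \<omega>) j"] sg that by (simp add: substochastic_graph_def)
    qed (use elim V i in auto)
    moreover have "integrable (\<kappa> \<omega>) (\<lambda>x. iexp (u * x i))"
    proof (rule k.integrable_const_bound[where B=1])
      have "(\<lambda>x. iexp (u * x i)) \<in> borel_measurable (opinion_space n)" by measurable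
      then show "(\<lambda>x. iexp (u * x i)) \<in> borel_measurable (\<kappa> \<omega>)"
        by (simp only: measurable_cong_sets[OF s refl])
    qed simp
    ultimately show ?case by (simp add: graph_char_total_kernel[OF sg])
  qed
  have kp: "AE \<omega> in M. prob_space (\<kappa> \<omega>) \<and> sets (\<kappa> \<omega>) = sets (opinion_space n)"
    using cond_law_stationary by eventually_elim simp
  have part: "\<bar>(\<integral>\<omega>. h (iexp (u * R \<omega> i)) \<partial>M) - (\<integral>\<omega>. h (?gc \<omega>) \<partial>M)\<bar> \<le> ?b"
    if h: "bounded_linear h" "\<And>z. \<bar>h z\<bar> \<le> norm z" for h :: "complex \<Rightarrow> real"
  proof -
    have hm[measurable]: "h \<in> borel_measurable borel"
      by (intro borel_measurable_continuous_onI linear_continuous_on h)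
    let ?C = "real_cond_exp M ?F (\<lambda>\<omega>. h (iexp (u * R \<omega> i)))"
    have hb: "\<bar>h (iexp (u * x i))\<bar> \<le> 1" for x :: "nat \<Rightarrow> real" using h(2)[of "iexp (u * x i)"] by simp
    have hi: "integrable M (\<lambda>\<omega>. h (iexp (u * R \<omega> i)))" "integrable M (\<lambda>\<omega>. h (?gc \<omega>))"
      by (intro integrable_bounded_linear[OF h(1)] ei gi)+
    have "AE \<omega> in M. ?C \<omega> = (\<integral>x. h (iexp (u * x i)) \<partial>\<kappa> \<omega>)"
      by (rule has_cond_law_integral[OF M sub R kp _ hb]) measurable
    then have "AE \<omega> in M. \<bar>?C \<omega> - h (?gc \<omega>)\<bar> \<le> ?b"
      using approx
    proof eventually_elim
      case (elim \<omega>)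
      have "?C \<omega> - h (?gc \<omega>) = h ((\<integral>x. iexp (u * x i) \<partial>\<kappa> \<omega>) - ?gc \<omega>)"
        using elim(1) integral_bounded_linear[OF h(1) conjunct2[OF elim(2)]]
        by (simp only: linear_diff[OF bounded_linear.linear[OF h(1)]])
      then show ?case using h(2)[of "(\<integral>x. iexp (u * x i) \<partial>\<kappa> \<omega>) - ?gc \<omega>"] elim by linarith
    qed
    moreover have Ci: "integrable M ?C" by (rule real_cond_exp_int(1)[OF hi(1)])
    ultimately have le: "(\<integral>\<omega>. \<bar>?C \<omega> - h (?gc \<omega>)\<bar> \<partial>M) \<le> (\<integral>\<omega>. ?b \<partial>M)"
      using hi by (intro integral_mono_AE integrable_abs Bochner_Integration.integrable_diff) auto
    have "(\<integral>\<omega>. h (iexp (u * R \<omega> i)) \<partial>M) - (\<integral>\<omega>. h (?gc \<omega>) \<partial>M) = (\<integral>\<omega>. ?C \<omega> - h (?gc \<omega>) \<partial>M)"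
      by (simp only: Bochner_Integration.integral_diff[OF Ci hi(2)] real_cond_exp_int(2)[OF hi(1)])
    also have "\<bar>\<dots>\<bar> \<le> (\<integral>\<omega>. \<bar>?C \<omega> - h (?gc \<omega>)\<bar> \<partial>M)" by (rule integral_abs_bound)
    also note le
    also have "(\<integral>\<omega>. ?b \<partial>M) = ?b" by (simp add: M.prob_space)
    finally show ?thesis .
  qed
  let ?D = "(\<integral>\<omega>. iexp (u * R \<omega> i) \<partial>M) - (\<integral>\<omega>. ?gc \<omega> \<partial>M)"
  have "\<bar>Re ?D\<bar> \<le> ?b"
    using part[OF bounded_linear_Re abs_Re_le_cmod] integral_Re[OF ei] integral_Re[OF gi] by simp
  moreover have "\<bar>Im ?D\<bar> \<le> ?b"
    using part[OF bounded_linear_Im abs_Im_le_cmod] integral_Im[OF ei] integral_Im[OF gi] by simp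
  ultimately show ?thesis using cmod_le[of ?D] by linarith
qed

text \<open>I is independent of graph and opinions, so by Fubini both integrals are averages over i
  of the quantities compared for a fixed vertex. The second is written with the graph first, the
  form in which the strong coupling presents graph and vertex.\<close>

lemma typical_opinion_char:
  "norm ((\<integral>\<omega>. iexp (u * R \<omega> (I \<omega>)) \<partial>M) -
     (\<integral>z. graph_char c d (total_kernel \<nu>) u t (fst z) (snd z) \<partial>(distr M mgraph_space G \<Otimes>\<^sub>M measure_pmf (pmf_of_set {1..n}))))
    \<le> 2 * (\<bar>u\<bar> * (1 - d) ^ t)"
proof -
  let ?u = "measure_pmf (pmf_of_set {1..n})"
  let ?Q = "mgraph_space \<Otimes>\<^sub>M opinion_space n"
  let ?N = "distr M ?Q (\<lambda>\<omega>. (G \<omega>, R \<omega>))"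
  let ?\<gamma> = "distr M mgraph_space G"
  let ?gc = "\<lambda>g i. graph_char c d (total_kernel \<nu>) u t g i"
  let ?\<phi> = "\<lambda>z::nat \<times> (nat, 'a) mgraph \<times> (nat \<Rightarrow> real). iexp (u * snd (snd z) (fst z))"
  have GR: "(\<lambda>\<omega>. (G \<omega>, R \<omega>)) \<in> M \<rightarrow>\<^sub>M ?Q" by (intro measurable_Pair G measurable_opinions)
  interpret N: prob_space ?N by (rule M.prob_space_distr[OF GR])
  interpret \<gamma>: prob_space ?\<gamma> by (rule M.prob_space_distr[OF G])
  interpret uN: pair_prob_space ?u ?N ..
  interpret \<gamma>u: pair_prob_space ?\<gamma> ?u ..
  have \<phi>: "?\<phi> \<in> borel_measurable (count_space UNIV \<Otimes>\<^sub>M ?Q)"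
  proof (rule measurable_compose_countable[where f="\<lambda>i z. iexp (u * snd (snd z) i)" and g=fst])
    fix i
    have "(\<lambda>z. snd (snd z) i) \<in> borel_measurable (count_space UNIV \<Otimes>\<^sub>M ?Q)"
      by (rule measurable_compose[OF _ measurable_coordinate]) measurable
    then show "(\<lambda>z. iexp (u * snd (snd z) i)) \<in> borel_measurable (count_space UNIV \<Otimes>\<^sub>M ?Q)" by measurable
  qed measurable
  have s: "sets (?u \<Otimes>\<^sub>M ?N) = sets (count_space UNIV \<Otimes>\<^sub>M ?Q)"
    by (intro sets_pair_measure_cong) auto
  have \<phi>': "?\<phi> \<in> borel_measurable (?u \<Otimes>\<^sub>M ?N)" using \<phi> by (simp only: measurable_cong_sets[OF s refl])
  have \<phi>i: "integrable (?u \<Otimes>\<^sub>M ?N) ?\<phi>" by (rule uN.integrable_const_bound[OF _ \<phi>', where B=1]) simp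
  have "(\<integral>\<omega>. iexp (u * R \<omega> (I \<omega>)) \<partial>M) = (\<integral>z. ?\<phi> z \<partial>(?u \<Otimes>\<^sub>M ?N))"
    unfolding unif[symmetric] by (subst integral_distr[OF measurable_triple \<phi>]) simp
  also have "\<dots> = (\<integral>i. (\<integral>z. ?\<phi> (i, z) \<partial>?N) \<partial>?u)" by (rule uN.integral_fst'[OF \<phi>i, symmetric])
  also have "\<dots> = (\<integral>i. (\<integral>\<omega>. iexp (u * R \<omega> i) \<partial>M) \<partial>?u)"
  proof (rule Bochner_Integration.integral_cong[OF refl])
    fix i
    have "(\<lambda>z. ?\<phi> (i, z)) \<in> borel_measurable ?Q"
      using measurable_compose[OF measurable_Pair1' \<phi>, of i] by simp
    then show "(\<integral>z. ?\<phi> (i, z) \<partial>?N) = (\<integral>\<omega>. iexp (u * R \<omega> i) \<partial>M)"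
      by (subst integral_distr[OF GR]) simp_all
  qed
  finally have 1: "(\<integral>\<omega>. iexp (u * R \<omega> (I \<omega>)) \<partial>M) = (\<integral>i. (\<integral>\<omega>. iexp (u * R \<omega> i) \<partial>M) \<partial>?u)" .
  have gm: "(\<lambda>z. ?gc (fst z) (snd z)) \<in> borel_measurable (?\<gamma> \<Otimes>\<^sub>M ?u)"
    by (rule measurable_graph_char_vertex[OF \<nu>]) simp
  have gi: "integrable (?\<gamma> \<Otimes>\<^sub>M ?u) (case_prod ?gc)"
    unfolding case_prod_beta'
    by (rule \<gamma>u.integrable_const_bound[OF _ gm, where B=1]) (simp add: norm_graph_char_le[OF real_distribution_total_kernel[OF \<nu>]])
  have "(\<integral>z. ?gc (fst z) (snd z) \<partial>(?\<gamma> \<Otimes>\<^sub>M ?u)) = (\<integral>i. (\<integral>g. ?gc g i \<partial>?\<gamma>) \<partial>?u)"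
    using \<gamma>u.integral_snd[OF gi] by (simp add: case_prod_beta')
  also have "\<dots> = (\<integral>i. (\<integral>\<omega>. ?gc (G \<omega>) i \<partial>M) \<partial>?u)"
    by (intro Bochner_Integration.integral_cong refl integral_distr[OF G measurable_graph_char[OF \<nu>]])
  finally have 2: "(\<integral>z. ?gc (fst z) (snd z) \<partial>(?\<gamma> \<Otimes>\<^sub>M ?u)) = (\<integral>i. (\<integral>\<omega>. ?gc (G \<omega>) i \<partial>M) \<partial>?u)" .
  have bnd: "norm (\<integral>\<omega>. iexp (u * R \<omega> i) \<partial>M) \<le> 1" "norm (\<integral>\<omega>. ?gc (G \<omega>) i \<partial>M) \<le> 1" for i
  proof -
    have *: "norm (\<integral>\<omega>. f \<omega> \<partial>M) \<le> 1" if f: "\<And>\<omega>. norm (f \<omega>) \<le> 1" "f \<in> borel_measurable M" for f :: "'w \<Rightarrow> complex"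
    proof -
      have "norm (\<integral>\<omega>. f \<omega> \<partial>M) \<le> (\<integral>\<omega>. norm (f \<omega>) \<partial>M)" by (rule integral_norm_bound)
      also have "\<dots> \<le> (\<integral>\<omega>. 1 \<partial>M)"
        using f by (intro integral_mono integrable_norm M.integrable_const_bound[where B=1]) auto
      finally show ?thesis by (simp add: M.prob_space)
    qed
    note [measurable] = measurable_opinion
    show "norm (\<integral>\<omega>. iexp (u * R \<omega> i) \<partial>M) \<le> 1" by (rule *) auto
    show "norm (\<integral>\<omega>. ?gc (G \<omega>) i \<partial>M) \<le> 1"
      by (rule *[OF norm_graph_char_le[OF real_distribution_total_kernel[OF \<nu>]] measurable_compose[OF G measurable_graph_char[OF \<nu>]]])
  qed
  have i: "integrable ?u (\<lambda>i. \<integral>\<omega>. iexp (u * R \<omega> i) \<partial>M)" "integrable ?u (\<lambda>i. \<integral>\<omega>. ?gc (G \<omega>) i \<partial>M)"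
    using bnd by (auto intro!: measure_pmf.integrable_const_bound[where B=1])
  have "norm ((\<integral>\<omega>. iexp (u * R \<omega> (I \<omega>)) \<partial>M) - (\<integral>z. ?gc (fst z) (snd z) \<partial>(?\<gamma> \<Otimes>\<^sub>M ?u)))
    = norm (\<integral>i. (\<integral>\<omega>. iexp (u * R \<omega> i) \<partial>M) - (\<integral>\<omega>. ?gc (G \<omega>) i \<partial>M) \<partial>?u)"
    unfolding 1 2 using i by (simp only: Bochner_Integration.integral_diff)
  also have "\<dots> \<le> (\<integral>i. norm ((\<integral>\<omega>. iexp (u * R \<omega> i) \<partial>M) - (\<integral>\<omega>. ?gc (G \<omega>) i \<partial>M)) \<partial>?u)"
    by (rule integral_norm_bound)
  also have "\<dots> \<le> (\<integral>i. 2 * (\<bar>u\<bar> * (1 - d) ^ t) \<partial>?u)"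
  proof (rule integral_mono_AE)
    show "AE i in ?u. norm ((\<integral>\<omega>. iexp (u * R \<omega> i) \<partial>M) - (\<integral>\<omega>. ?gc (G \<omega>) i \<partial>M)) \<le> 2 * (\<bar>u\<bar> * (1 - d) ^ t)"
      unfolding AE_measure_pmf_iff using n by (intro ballI stationary_opinion_char) auto
  qed (intro integrable_norm Bochner_Integration.integrable_diff i, simp)
  finally show ?thesis by simp
qed

end

section \<open>Identifying the law of the limiting opinion\<close>

lemma has_cond_law_const_distr:
  assumes M: "prob_space M" and \<mu>: "prob_space \<mu>" "sets \<mu> = sets N" and sub: "subalgebra M F"
    and X: "has_cond_law M F N X (\<lambda>_. \<mu>)"
  shows "distr M N X = \<mu>"
proof (rule measure_eqI)
  interpret prob_space M by fact
  interpret \<mu>: prob_space \<mu> by fact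
  have Xm: "X \<in> M \<rightarrow>\<^sub>M N" using X by (simp add: has_cond_law_def)
  show "sets (distr M N X) = sets \<mu>" using \<mu> by simp
  fix B assume "B \<in> sets (distr M N X)"
  then have B: "B \<in> sets N" by simp
  let ?E = "{\<omega>\<in>space M. X \<omega> \<in> B}"
  have eq: "X -` B \<inter> space M = ?E" by auto
  have E: "?E \<in> sets M" using measurable_sets[OF Xm B] unfolding eq .
  have "measure M ?E = (\<integral>\<omega>. real_cond_exp M F (indicator ?E) \<omega> \<partial>M)"
    by (rule measure_eq_cond_exp(2)[OF M sub E])
  also have "\<dots> = (\<integral>\<omega>. measure \<mu> B \<partial>M)"
    using X B unfolding has_cond_law_def by (intro integral_cong_AE) auto
  finally have "measure M ?E = measure \<mu> B" by (simp add: prob_space)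
  then show "emeasure (distr M N X) B = emeasure \<mu> B"
    using B by (simp add: emeasure_distr[OF Xm] eq emeasure_eq_measure \<mu>.emeasure_eq_measure)
qed

text \<open>For distances up to 1 the Lipschitz constant |u| is used, beyond that the trivial bound
  2; |u| + 2 covers both. The truncated distance is the one that
  \<open>tendsto_in_prob_cond_exp_zero\<close> shows to vanish.\<close>

lemma norm_char_diff_le_min:
  fixes X Y :: "'w \<Rightarrow> real"
  assumes "prob_space M" and [measurable]: "X \<in> borel_measurable M" "Y \<in> borel_measurable M"
  shows "norm ((\<integral>\<omega>. iexp (u * X \<omega>) \<partial>M) - (\<integral>\<omega>. iexp (u * Y \<omega>) \<partial>M))
    \<le> (\<bar>u\<bar> + 2) * (\<integral>\<omega>. min 1 \<bar>X \<omega> - Y \<omega>\<bar> \<partial>M)"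
proof -
  interpret prob_space M by fact
  have i: "integrable M (\<lambda>\<omega>. iexp (u * X \<omega>))" "integrable M (\<lambda>\<omega>. iexp (u * Y \<omega>))"
    by (auto intro!: integrable_const_bound[where B=1])
  have m: "integrable M (\<lambda>\<omega>. min 1 \<bar>X \<omega> - Y \<omega>\<bar>)"
    by (rule integrable_const_bound[where B=1]) auto
  have le: "norm (iexp (u * x) - iexp (u * y)) \<le> (\<bar>u\<bar> + 2) * min 1 \<bar>x - y\<bar>" for x y :: real
  proof (cases "\<bar>x - y\<bar> \<le> 1")
    case True
    have "norm (iexp (u * x) - iexp (u * y)) \<le> \<bar>u * x - u * y\<bar>" by (rule norm_iexp_diff_le)
    also have "\<dots> = \<bar>u\<bar> * \<bar>x - y\<bar>" by (simp add: right_diff_distrib[symmetric] abs_mult)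
    also have "\<dots> \<le> (\<bar>u\<bar> + 2) * \<bar>x - y\<bar>" by (intro mult_right_mono) auto
    finally show ?thesis using True by simp
  next
    case False
    have "norm (iexp (u * x) - iexp (u * y)) \<le> norm (iexp (u * x)) + norm (iexp (u * y))"
      by (rule norm_triangle_ineq4)
    also have "\<dots> \<le> \<bar>u\<bar> + 2" by simp
    finally show ?thesis using False by simp
  qed
  have "norm ((\<integral>\<omega>. iexp (u * X \<omega>) \<partial>M) - (\<integral>\<omega>. iexp (u * Y \<omega>) \<partial>M))
    = norm (\<integral>\<omega>. iexp (u * X \<omega>) - iexp (u * Y \<omega>) \<partial>M)"
    using i by (simp only: Bochner_Integration.integral_diff)
  also have "\<dots> \<le> (\<integral>\<omega>. norm (iexp (u * X \<omega>) - iexp (u * Y \<omega>)) \<partial>M)" by (rule integral_norm_bound)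
  also have "\<dots> \<le> (\<integral>\<omega>. (\<bar>u\<bar> + 2) * min 1 \<bar>X \<omega> - Y \<omega>\<bar> \<partial>M)"
    using i m by (intro integral_mono le integrable_norm Bochner_Integration.integrable_diff integrable_mult_right)
  finally show ?thesis by simp
qed

theorem proposition3:
  fixes c d K :: real
    and \<nu> :: "'a::polish_space mark \<Rightarrow> real measure"
    and M :: "nat \<Rightarrow> 'w measure"
    and G :: "nat \<Rightarrow> 'w \<Rightarrow> (nat, 'a) mgraph"
    and I :: "nat \<Rightarrow> 'w \<Rightarrow> nat"
    and R :: "nat \<Rightarrow> 'w \<Rightarrow> nat \<Rightarrow> real"
    and Rstar :: "nat \<Rightarrow> 'w \<Rightarrow> real"
    and \<mu>star :: "real measure"
    and T :: "'t measure"
    and \<G> :: "'t \<Rightarrow> (nat list, 'a) mgraph"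
    and \<W> :: "nat list \<Rightarrow> nat \<Rightarrow> 't \<Rightarrow> real"
  assumes "0 \<le> c" "c < 1" "0 < d" "d \<le> 1" "c + d \<le> 1"
    \<comment> \<open>the random graphs\<close>
    and "\<And>n. n \<ge> 1 \<Longrightarrow> weighted_random_digraph c n (M n) (G n)"
    \<comment> \<open>the laws of the signals\<close>
    and "\<nu> \<in> restrict_space borel mark_space \<rightarrow>\<^sub>M prob_algebra borel"
    and "\<And>n. n \<ge> 1 \<Longrightarrow> AE \<omega> in M n. \<forall>i\<in>{1..n}. AE w in \<nu> (mark (G n \<omega>) i).
           \<bar>w\<bar> \<le> d + c - (\<Sum>r<indeg (G n \<omega>) i. mweight (mark (G n \<omega>) i) r)"
    and "\<And>x y. x \<in> mark_space \<Longrightarrow> y \<in> mark_space \<Longrightarrow>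
           wasserstein1 (\<nu> x) (\<nu> y) \<le> ennreal (K * mark_dist x y)"
    \<comment> \<open>the limiting marked tree and its signals\<close>
    and "prob_space T"
    and "\<G> \<in> T \<rightarrow>\<^sub>M mgraph_space"
    and "AE \<omega> in T. labelled_tree (\<G> \<omega>)"
    and "cond_indep_with_laws T (vimage_algebra (space T) \<G> mgraph_space)
           (\<lambda>\<omega>. verts (\<G> \<omega>) \<times> UNIV) borel
           (\<lambda>(i, k). \<W> i k) (\<lambda>(i, k) \<omega>. \<nu> (mark (\<G> \<omega>) i))"
    and "strong_coupling (\<lambda>n. distr (M n) mgraph_space (G n)) (distr T mgraph_space \<G>) []"
    \<comment> \<open>given the marked graph, the opinions have the stationary distribution\<close>
    and "\<And>n. n \<ge> 1 \<Longrightarrow> \<exists>\<kappa>.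
           has_cond_law (M n) (vimage_algebra (space (M n)) (G n) mgraph_space)
             (Pi\<^sub>M {1..n} (\<lambda>_. borel)) (R n) \<kappa> \<and>
           (AE \<omega> in M n. stationary_opinion_law c d \<nu> (G n \<omega>) (\<kappa> \<omega>))"
    \<comment> \<open>a uniformly chosen vertex, independent of the marked graph and the opinions\<close>
    and "\<And>n. n \<ge> 1 \<Longrightarrow> I n \<in> M n \<rightarrow>\<^sub>M count_space UNIV"
    and "\<And>n. n \<ge> 1 \<Longrightarrow>
           distr (M n) (count_space UNIV \<Otimes>\<^sub>M (mgraph_space \<Otimes>\<^sub>M Pi\<^sub>M {1..n} (\<lambda>_. borel)))
             (\<lambda>\<omega>. (I n \<omega>, G n \<omega>, R n \<omega>))
           = measure_pmf (pmf_of_set {1..n}) \<Otimes>\<^sub>M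
             distr (M n) (mgraph_space \<Otimes>\<^sub>M Pi\<^sub>M {1..n} (\<lambda>_. borel)) (\<lambda>\<omega>. (G n \<omega>, R n \<omega>))"
    \<comment> \<open>the limiting typical stationary opinion, whose law does not depend on the attributes\<close>
    and "prob_space \<mu>star" "sets \<mu>star = sets borel"
    and "\<And>n. n \<ge> 1 \<Longrightarrow>
           has_cond_law (M n) (attr_algebra n (M n) (G n)) borel (Rstar n) (\<lambda>_. \<mu>star)"
    and "\<And>n. n \<ge> 1 \<Longrightarrow> integrable (M n) (Rstar n)"
    and "tendsto_in_prob M (\<lambda>n. real_cond_exp (M n) (attr_algebra n (M n) (G n))
           (\<lambda>\<omega>. \<bar>R n \<omega> (I n \<omega>) - Rstar n \<omega>\<bar>)) 0"
  shows "(AE \<omega> in T. summable (opinion_term c d (\<G> \<omega>) (\<lambda>j s. \<W> j s \<omega>))) \<and>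
         \<mu>star = distr T borel (\<lambda>\<omega>. \<Sum>s. opinion_term c d (\<G> \<omega>) (\<lambda>j s. \<W> j s \<omega>) s)"
proof -
  note cd = assms(1-5) and wrd = assms(6) and \<nu> = assms(7) and sig_bd = assms(8) and lip = assms(9)
    and T = assms(10) and \<G> = assms(11) and lt = assms(12) and sig = assms(13) and sc = assms(14)
    and st = assms(15) and I = assms(16) and unif = assms(17) and \<mu>star = assms(18,19)
    and Rst = assms(20) and Rst_int = assms(21) and conv = assms(22)
  let ?\<gamma> = "\<lambda>n. distr (M n) mgraph_space (G n)"
  let ?\<tau> = "distr T mgraph_space \<G>"
  let ?S = "\<lambda>\<omega>. \<Sum>s. opinion_term c d (\<G> \<omega>) (\<lambda>j s. \<W> j s \<omega>) s"
  have c1: "c \<le> 1" using cd by simp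
  have M: "prob_space (M n)" and G: "G n \<in> M n \<rightarrow>\<^sub>M mgraph_space" if "n \<ge> 1" for n
    using wrd[OF that] by (auto simp: weighted_random_digraph_def)
  have good: "AE \<omega> in M n. good_graph c \<nu> n (G n \<omega>)" if "n \<ge> 1" for n
    by (rule AE_good_graph[OF \<nu> wrd[OF that] cd(1,5) sig_bd[OF that]])
  have \<gamma>: "prob_space (?\<gamma> n)" "sets (?\<gamma> n) = sets mgraph_space" "AE g in ?\<gamma> n. good_graph c \<nu> n g" if n: "n \<ge> 1" for n
  proof -
    show "prob_space (?\<gamma> n)" by (rule prob_space.prob_space_distr[OF M[OF n] G[OF n]])
    show "AE g in ?\<gamma> n. good_graph c \<nu> n g"
      using measurable_good_graph[OF \<nu>] good[OF n] by (subst AE_distr_iff[OF G[OF n]]) (simp_all add: pred_def)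
  qed simp
  have \<tau>: "prob_space ?\<tau>" "sets ?\<tau> = sets mgraph_space" "AE t in ?\<tau>. tree_shape t"
  proof -
    show "prob_space ?\<tau>" by (rule prob_space.prob_space_distr[OF T \<G>])
    have "AE \<omega> in T. tree_shape (\<G> \<omega>)" using lt by eventually_elim (rule labelled_tree_shape)
    then show "AE t in ?\<tau>. tree_shape t"
      using measurable_tree_shape[OF \<nu>] by (subst AE_distr_iff[OF \<G>]) (simp_all add: pred_def)
  qed simp
  have "AE t in ?\<tau>. good_tree c \<nu> t"
    by (rule AE_good_tree[OF cd(1) c1 cd(5) \<nu> lip \<gamma> \<tau> sc])
  from AE_distrD[OF \<G> this] have tree: "AE \<omega> in T. good_tree c \<nu> (\<G> \<omega>)" .
  note tree_ctxt = cd(1,3,4,5) \<nu> T \<G> sig tree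
  \<comment> \<open>The frequency u stays fixed while n and the depth tend to infinity; Levy's
    uniqueness theorem is applied only at the end.\<close>
  have "char \<mu>star u = char (distr T borel ?S) u" for u
  proof -
    let ?gc = "\<lambda>n k. \<integral>z. graph_char c d (total_kernel \<nu>) u k (fst z) (snd z) \<partial>(?\<gamma> n \<Otimes>\<^sub>M measure_pmf (pmf_of_set {1..n}))"
    let ?tc = "\<lambda>k. \<integral>t. tree_char c d (total_kernel \<nu>) u k t \<partial>?\<tau>"
    let ?r = "\<lambda>n. \<integral>\<omega>. iexp (u * R n \<omega> (I n \<omega>)) \<partial>M n"
    let ?Z = "\<lambda>n \<omega>. \<bar>R n \<omega> (I n \<omega>) - Rstar n \<omega>\<bar>"
    have char_bound: "norm (?r n - ?gc n k) \<le> 2 * (\<bar>u\<bar> * (1 - d) ^ k)"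
      and Rm: "(\<lambda>\<omega>. R n \<omega> (I n \<omega>)) \<in> borel_measurable (M n)" and Rb: "AE \<omega> in M n. \<bar>R n \<omega> (I n \<omega>)\<bar> \<le> 1"
      if n: "n \<ge> 1" for n k
    proof -
      from st[OF n] obtain \<kappa> where
        \<kappa>: "has_cond_law (M n) (vimage_algebra (space (M n)) (G n) mgraph_space) (Pi\<^sub>M {1..n} (\<lambda>_. borel)) (R n) \<kappa>"
          "AE \<omega> in M n. stationary_opinion_law c d \<nu> (G n \<omega>) (\<kappa> \<omega>)" by blast
      note ctxt = cd(3,4,5) \<nu> M[OF n] G[OF n] good[OF n] \<kappa> n I[OF n] unif[OF n]
      show "norm (?r n - ?gc n k) \<le> 2 * (\<bar>u\<bar> * (1 - d) ^ k)" by (rule typical_opinion_char[OF ctxt])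
      show "(\<lambda>\<omega>. R n \<omega> (I n \<omega>)) \<in> borel_measurable (M n)" by (rule measurable_typical_opinion[OF ctxt])
      from AE_opinion_bounded[OF ctxt] AE_vertex[OF ctxt]
      show "AE \<omega> in M n. \<bar>R n \<omega> (I n \<omega>)\<bar> \<le> 1" by eventually_elim (auto simp: abs_le_iff)
    qed
    \<comment> \<open>The assumed convergence is conditional on the attributes; its truncated
      unconditional form suffices for characteristic functions.\<close>
    have "(\<lambda>n. \<integral>\<omega>. min 1 (?Z n \<omega>) \<partial>M n) \<longlonglongrightarrow> 0"
    proof (rule tendsto_in_prob_cond_exp_zero[OF conv M])
      show "integrable (M n) (?Z n)" if n: "n \<ge> 1" for n
      proof -
        interpret prob_space "M n" by (rule M[OF n])
        have "integrable (M n) (\<lambda>\<omega>. R n \<omega> (I n \<omega>))"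
          by (rule integrable_const_bound[where B=1]) (use Rm[OF n] Rb[OF n] in auto)
        then show ?thesis using Rst_int[OF n] by (intro integrable_abs Bochner_Integration.integrable_diff)
      qed
    qed (simp_all only: subalgebra_attr_algebra G abs_ge_zero)
    then have "(\<lambda>n. (\<bar>u\<bar> + 2) * (\<integral>\<omega>. min 1 (?Z n \<omega>) \<partial>M n)) \<longlonglongrightarrow> (\<bar>u\<bar> + 2) * 0"
      by (rule tendsto_mult_left)
    then have Z0: "(\<lambda>n. (\<bar>u\<bar> + 2) * (\<integral>\<omega>. min 1 (?Z n \<omega>) \<partial>M n)) \<longlonglongrightarrow> 0"
      by (simp only: mult_zero_right)
    have "norm (?r n - char \<mu>star u) \<le> (\<bar>u\<bar> + 2) * (\<integral>\<omega>. min 1 (?Z n \<omega>) \<partial>M n)" if n: "n \<ge> 1" for n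
    proof -
      have Rsm: "Rstar n \<in> borel_measurable (M n)" using Rst_int[OF n] by (rule borel_measurable_integrable)
      \<comment> \<open>Given the attributes, \<open>Rstar n\<close> has the same deterministic
        conditional law for every n, which is therefore its law.\<close>
      have "distr (M n) borel (Rstar n) = \<mu>star"
        by (rule has_cond_law_const_distr[OF M[OF n] \<mu>star subalgebra_attr_algebra[OF G[OF n]] Rst[OF n]])
      then have "char \<mu>star u = char (distr (M n) borel (Rstar n)) u" by simp
      also have "\<dots> = (\<integral>\<omega>. iexp (u * Rstar n \<omega>) \<partial>M n)"
        unfolding char_def by (rule integral_distr[OF Rsm]) measurable
      finally show ?thesis using norm_char_diff_le_min[OF M[OF n] Rm[OF n] Rsm, of u] by simp
    qed
    then have "\<forall>\<^sub>F n in sequentially. norm (?r n - char \<mu>star u) \<le> (\<bar>u\<bar> + 2) * (\<integral>\<omega>. min 1 (?Z n \<omega>) \<partial>M n)"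
      by (rule eventually_sequentiallyI)
    from LIM_zero_cancel[OF Lim_null_comparison[OF this Z0]]
    have r: "?r \<longlonglongrightarrow> char \<mu>star u" .
    \<comment> \<open>Here n tends to infinity with the depth k fixed; the error bound is uniform in
      n and survives the limit.\<close>
    have bound: "norm (char \<mu>star u - ?tc k) \<le> 2 * (\<bar>u\<bar> * (1 - d) ^ k)" if k: "k \<ge> 1" for k
    proof (rule tendsto_upperbound)
      show "(\<lambda>n. norm (?r n - ?gc n k)) \<longlonglongrightarrow> norm (char \<mu>star u - ?tc k)"
        by (intro tendsto_norm tendsto_diff r graph_char_tendsto_tree_char[OF cd(1) c1 cd(5) \<nu> lip \<gamma> \<tau> sc k])
      show "\<forall>\<^sub>F n in sequentially. norm (?r n - ?gc n k) \<le> 2 * (\<bar>u\<bar> * (1 - d) ^ k)"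
        by (rule eventually_sequentiallyI[of 1]) (rule char_bound)
    qed simp
    \<comment> \<open>Now k tends to infinity: the transforms on the tree converge to that of
      \<mu>star, and through the partial sums also to that of the series, so the two agree.\<close>
    have "(\<lambda>k. 2 * (\<bar>u\<bar> * (1 - d) ^ k)) \<longlonglongrightarrow> 2 * (\<bar>u\<bar> * 0)"
      using cd by (intro tendsto_intros LIMSEQ_realpow_zero) auto
    then have lim0: "(\<lambda>k. 2 * (\<bar>u\<bar> * (1 - d) ^ k)) \<longlonglongrightarrow> 0" by simp
    have "\<forall>\<^sub>F k in sequentially. norm (?tc k - char \<mu>star u) \<le> 2 * (\<bar>u\<bar> * (1 - d) ^ k)"
      using bound by (intro eventually_sequentiallyI[of 1]) (simp only: norm_minus_commute)
    from LIM_zero_cancel[OF Lim_null_comparison[OF this lim0]]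
    have "?tc \<longlonglongrightarrow> char \<mu>star u" .
    moreover have "?tc k = (\<integral>\<omega>. tree_char c d (total_kernel \<nu>) u k (\<G> \<omega>) \<partial>T)" for k
      by (rule integral_distr[OF \<G> measurable_tree_char[OF \<nu>]])
    ultimately show ?thesis
      using char_partial_sum_tendsto[OF tree_ctxt, of u] by (simp add: LIMSEQ_unique)
  qed
  then have char_eq: "char \<mu>star = char (distr T borel ?S)" by (rule ext)
  have Sm: "?S \<in> borel_measurable T"
    by (intro borel_measurable_suminf measurable_opinion_term[OF \<G>] measurable_signal[OF tree_ctxt])
  have "\<mu>star = distr T borel ?S"
  proof (rule Levy_uniqueness[OF _ _ char_eq])
    show "real_distribution \<mu>star"
      using \<mu>star by (auto simp: real_distribution_def real_distribution_axioms_def dest: sets_eq_imp_space_eq)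
    show "real_distribution (distr T borel ?S)"
      using prob_space.prob_space_distr[OF T Sm] by (simp add: real_distribution_def real_distribution_axioms_def)
  qed
  moreover note AE_summable_opinion_term[OF tree_ctxt]
  ultimately show ?thesis by blast
qed

end
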